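(* Let $k$ be a fixed positive integer. There is an algorithm that solves the following problem in $O(|E|\log(2+|V|^2/|E|))$ time: given a digraph $G=(V,E)$, disjoint nonempty sets $S,T\subseteq V$ with $|S|+|T|=k$, and a flow (respectively, an integer flow) $f$ from $S$ to $T$ in $G$, find a decomposition $$f=\sum_{s\in S,\;t\in T} f_{st},$$ where each $f_{st}$ is a flow (respectively, an integer flow) from $s$ to $t$.
   Context: $G$ is a finite digraph, possibly with parallel arcs, and it is assumed that $|V|=O(|E|)$. For $f:E\to\mathbb{R}$ and $v\in V$, $\mathrm{div}_f(v)$ is the sum of $f(e)$ over arcs $e$ leaving $v$ minus the sum of $f(e)$ over arcs $e$ entering $v$. A flow from $S$ to $T$ is a function $f:E\to\mathbb{R}_+$ with $\mathrm{div}_f(v)\ge0$ for $v\in S$, $\mathrm{div}_f(v)\le 0$ for $v\in T$, and $\mathrm{div}_f(v)=0$ for all other $v$. A flow from $s$ to $t$ is a flow from $\{s\}$ to $\{t\}$. A flow is integer if all its values are integers. Running time counts arithmetic operations and comparisons on numbers as unit cost, and the constant in $O(\cdot)$ may depend on $k$. *)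

theory Defs
  imports Complex_Main "Graph_Theory.Digraph"
begin

section \<open>Flows\<close>

definition divergence :: "('a, 'b) pre_digraph \<Rightarrow> ('b \<Rightarrow> real) \<Rightarrow> 'a \<Rightarrow> real" where
  "divergence G f v = (\<Sum>e\<in>out_arcs G v. f e) - (\<Sum>e\<in>in_arcs G v. f e)"

definition is_flow ::
  "('a, 'b) pre_digraph \<Rightarrow> 'a set \<Rightarrow> 'a set \<Rightarrow> ('b \<Rightarrow> real) \<Rightarrow> bool" where
  "is_flow G S T f \<longleftrightarrow>
     (\<forall>e\<in>arcs G. 0 \<le> f e) \<and>
     (\<forall>v\<in>S. divergence G f v \<ge> 0) \<and>
     (\<forall>v\<in>T. divergence G f v \<le> 0) \<and>
     (\<forall>v\<in>verts G - (S \<union> T). divergence G f v = 0)"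

definition is_integer_flow ::
  "('a, 'b) pre_digraph \<Rightarrow> 'a set \<Rightarrow> 'a set \<Rightarrow> ('b \<Rightarrow> real) \<Rightarrow> bool" where
  "is_integer_flow G S T f \<longleftrightarrow> is_flow G S T f \<and> (\<forall>e\<in>arcs G. f e \<in> \<int>)"

text \<open>The first argument is the kind of flow, that is \<^const>\<open>is_flow\<close> or
  \<^const>\<open>is_integer_flow\<close>.\<close>

definition flow_decomposition ::
  "(('a, 'b) pre_digraph \<Rightarrow> 'a set \<Rightarrow> 'a set \<Rightarrow> ('b \<Rightarrow> real) \<Rightarrow> bool) \<Rightarrow>
   ('a, 'b) pre_digraph \<Rightarrow> 'a set \<Rightarrow> 'a set \<Rightarrow> ('b \<Rightarrow> real) \<Rightarrow>
   ('a \<Rightarrow> 'a \<Rightarrow> 'b \<Rightarrow> real) \<Rightarrow> bool" where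
  "flow_decomposition flow G S T f F \<longleftrightarrow>
     (\<forall>e\<in>arcs G. f e = (\<Sum>s\<in>S. \<Sum>t\<in>T. F s t e)) \<and>
     (\<forall>s\<in>S. \<forall>t\<in>T. flow G {s} {t} (F s t))"

section \<open>Algorithms\<close>

text \<open>
  Algorithms are programs of a unit-cost random access machine with two kinds of memory: arrays
  of natural numbers (indices, pointers, counters) and arrays of real numbers (flow values).
  A program mentions only finitely many array names, and array cells are addressed by
  computed natural numbers (indirect addressing); a scalar variable is cell 0 of its own array.

  On real numbers the four arithmetic operations and comparisons are available at unit cost.
  There is no rounding and no transfer between the two kinds of numbers, and the only real
  constants are 0 and 1, so programs cannot contain non-computable advice. On natural numbers
  only addition, truncated subtraction and comparisons are available (the additive RAM of
  Cook and Reckhow), so unit cost cannot be abused by multiplying up huge indices.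
\<close>

datatype iexp =
    INum nat
  | IRead nat iexp
  | IAdd iexp iexp
  | ISub iexp iexp

datatype rexp =
    RZero
  | ROne
  | RRead nat iexp
  | RAdd rexp rexp
  | RSub rexp rexp
  | RMul rexp rexp
  | RDiv rexp rexp

datatype bexp =
    ILess iexp iexp
  | RLess rexp rexp
  | BNot bexp
  | BAnd bexp bexp

datatype com =
    Skip
  | IWrite nat iexp iexp
  | RWrite nat iexp rexp
  | Seq com com
  | Cond bexp com com
  | While bexp com

text \<open>A store maps an array name and an address to the contents of that cell.\<close>

record store =
  istore :: "nat \<Rightarrow> nat \<Rightarrow> nat"
  rstore :: "nat \<Rightarrow> nat \<Rightarrow> real"

primrec ival :: "iexp \<Rightarrow> store \<Rightarrow> nat" where
  "ival (INum n) \<sigma> = n"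
| "ival (IRead x a) \<sigma> = istore \<sigma> x (ival a \<sigma>)"
| "ival (IAdd a b) \<sigma> = ival a \<sigma> + ival b \<sigma>"
| "ival (ISub a b) \<sigma> = ival a \<sigma> - ival b \<sigma>"

primrec rval :: "rexp \<Rightarrow> store \<Rightarrow> real" where
  "rval RZero \<sigma> = 0"
| "rval ROne \<sigma> = 1"
| "rval (RRead x a) \<sigma> = rstore \<sigma> x (ival a \<sigma>)"
| "rval (RAdd a b) \<sigma> = rval a \<sigma> + rval b \<sigma>"
| "rval (RSub a b) \<sigma> = rval a \<sigma> - rval b \<sigma>"
| "rval (RMul a b) \<sigma> = rval a \<sigma> * rval b \<sigma>"
| "rval (RDiv a b) \<sigma> = rval a \<sigma> / rval b \<sigma>"

primrec bval :: "bexp \<Rightarrow> store \<Rightarrow> bool" where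
  "bval (ILess a b) \<sigma> \<longleftrightarrow> ival a \<sigma> < ival b \<sigma>"
| "bval (RLess a b) \<sigma> \<longleftrightarrow> rval a \<sigma> < rval b \<sigma>"
| "bval (BNot b) \<sigma> \<longleftrightarrow> \<not> bval b \<sigma>"
| "bval (BAnd b c) \<sigma> \<longleftrightarrow> bval b \<sigma> \<and> bval c \<sigma>"

text \<open>Every constant, memory access, arithmetic operation, comparison and connective in an
  expression costs one unit.\<close>

primrec icost :: "iexp \<Rightarrow> nat" where
  "icost (INum n) = 1"
| "icost (IRead x a) = icost a + 1"
| "icost (IAdd a b) = icost a + icost b + 1"
| "icost (ISub a b) = icost a + icost b + 1"

primrec rcost :: "rexp \<Rightarrow> nat" where
  "rcost RZero = 1"
| "rcost ROne = 1"
| "rcost (RRead x a) = icost a + 1"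
| "rcost (RAdd a b) = rcost a + rcost b + 1"
| "rcost (RSub a b) = rcost a + rcost b + 1"
| "rcost (RMul a b) = rcost a + rcost b + 1"
| "rcost (RDiv a b) = rcost a + rcost b + 1"

primrec bcost :: "bexp \<Rightarrow> nat" where
  "bcost (ILess a b) = icost a + icost b + 1"
| "bcost (RLess a b) = rcost a + rcost b + 1"
| "bcost (BNot b) = bcost b + 1"
| "bcost (BAnd b c) = bcost b + bcost c + 1"

text \<open>\<open>exec P \<sigma> n \<tau>\<close>: started in store \<open>\<sigma>\<close>, the program \<open>P\<close> terminates in store \<open>\<tau>\<close> after
  running for time \<open>n\<close>.\<close>

inductive exec :: "com \<Rightarrow> store \<Rightarrow> nat \<Rightarrow> store \<Rightarrow> bool" where
  Skip: "exec Skip \<sigma> 1 \<sigma>"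
| IWrite: "exec (IWrite x a b) \<sigma> (icost a + icost b + 1)
    (\<sigma>\<lparr>istore := (istore \<sigma>)(x := (istore \<sigma> x)(ival a \<sigma> := ival b \<sigma>))\<rparr>)"
| RWrite: "exec (RWrite x a r) \<sigma> (icost a + rcost r + 1)
    (\<sigma>\<lparr>rstore := (rstore \<sigma>)(x := (rstore \<sigma> x)(ival a \<sigma> := rval r \<sigma>))\<rparr>)"
| Seq: "exec P \<sigma> m \<rho> \<Longrightarrow> exec Q \<rho> n \<tau> \<Longrightarrow> exec (Seq P Q) \<sigma> (m + n) \<tau>"
| CondTrue: "bval b \<sigma> \<Longrightarrow> exec P \<sigma> n \<tau> \<Longrightarrow> exec (Cond b P Q) \<sigma> (bcost b + n + 1) \<tau>"
| CondFalse: "\<not> bval b \<sigma> \<Longrightarrow> exec Q \<sigma> n \<tau> \<Longrightarrow> exec (Cond b P Q) \<sigma> (bcost b + n + 1) \<tau>"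
| WhileFalse: "\<not> bval b \<sigma> \<Longrightarrow> exec (While b P) \<sigma> (bcost b + 1) \<sigma>"
| WhileTrue: "bval b \<sigma> \<Longrightarrow> exec P \<sigma> m \<rho> \<Longrightarrow> exec (While b P) \<rho> n \<tau> \<Longrightarrow>
    exec (While b P) \<sigma> (bcost b + m + n + 1) \<tau>"

inductive_cases SkipE: "exec Skip \<sigma> n \<tau>"
inductive_cases IWriteE: "exec (IWrite x a b) \<sigma> n \<tau>"
inductive_cases RWriteE: "exec (RWrite x a r) \<sigma> n \<tau>"
inductive_cases SeqE: "exec (Seq P Q) \<sigma> n \<tau>"
inductive_cases CondE: "exec (Cond b P Q) \<sigma> n \<tau>"
inductive_cases WhileE: "exec (While b P) \<sigma> n \<tau>"

lemma exec_deterministic: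
  "exec P \<sigma> n \<tau> \<Longrightarrow> exec P \<sigma> n' \<tau>' \<Longrightarrow> n' = n \<and> \<tau>' = \<tau>"
proof (induction arbitrary: n' \<tau>' rule: exec.induct)
  case (Seq P \<sigma> m \<rho> Q n \<tau>)
  from Seq.prems obtain m1 \<rho>1 n1 where "n' = m1 + n1" "exec P \<sigma> m1 \<rho>1" "exec Q \<rho>1 n1 \<tau>'"
    by (rule SeqE)
  with Seq.IH show ?case by metis
next
  case (WhileTrue b \<sigma> P m \<rho> n \<tau>)
  from WhileTrue.prems obtain m1 \<rho>1 n1 where
    "n' = bcost b + m1 + n1 + 1" "exec P \<sigma> m1 \<rho>1" "exec (While b P) \<rho>1 n1 \<tau>'"
    by (rule WhileE) (use WhileTrue.hyps(1) in auto)
  with WhileTrue.IH show ?case by metis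
qed ((erule SkipE IWriteE RWriteE CondE WhileE; force)+)

section \<open>The decomposition problem\<close>

text \<open>
  As usual for graph algorithms, the vertices and the arcs of the input digraph are numbered
  \<open>0, \<dots>, |V| - 1\<close> and \<open>0, \<dots>, |E| - 1\<close>. Loops and parallel arcs are allowed. The lists \<open>ss\<close> and
  \<open>ts\<close> enumerate the sets of sources and sinks.
\<close>

definition decomposition_instance ::
  "((nat, nat) pre_digraph \<Rightarrow> nat set \<Rightarrow> nat set \<Rightarrow> (nat \<Rightarrow> real) \<Rightarrow> bool) \<Rightarrow> nat \<Rightarrow>
   (nat, nat) pre_digraph \<Rightarrow> nat list \<Rightarrow> nat list \<Rightarrow> (nat \<Rightarrow> real) \<Rightarrow> bool" where
  "decomposition_instance flow k G ss ts f \<longleftrightarrow>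
     fin_digraph G \<and>
     verts G = {..<card (verts G)} \<and> arcs G = {..<card (arcs G)} \<and>
     distinct ss \<and> distinct ts \<and>
     set ss \<subseteq> verts G \<and> set ts \<subseteq> verts G \<and>
     set ss \<noteq> {} \<and> set ts \<noteq> {} \<and> set ss \<inter> set ts = {} \<and>
     card (set ss) + card (set ts) = k \<and>
     flow G (set ss) (set ts) f"

text \<open>
  Input: cells 0 to 3 of the integer array 0 hold \<open>|V|\<close>, \<open>|E|\<close>, \<open>|S|\<close>, \<open>|T|\<close>; the integer
  arrays 1 and 2 hold the tails and heads of the arcs; the integer arrays 3 and 4 hold the
  sources and the sinks; the real array 0 holds the flow. All other cells are initially 0.
\<close>

definition zero_padded :: "'a::zero list \<Rightarrow> nat \<Rightarrow> 'a" where
  "zero_padded xs i = (if i < length xs then xs ! i else 0)"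

definition input_store ::
  "(nat, nat) pre_digraph \<Rightarrow> nat list \<Rightarrow> nat list \<Rightarrow> (nat \<Rightarrow> real) \<Rightarrow> store" where
  "input_store G ss ts f =
     \<lparr>istore = (\<lambda>_ _. 0)
        (0 := zero_padded [card (verts G), card (arcs G), length ss, length ts],
         1 := zero_padded (map (tail G) [0..<card (arcs G)]),
         2 := zero_padded (map (head G) [0..<card (arcs G)]),
         3 := zero_padded ss,
         4 := zero_padded ts),
      rstore = (\<lambda>_ _. 0)
        (0 := zero_padded (map f [0..<card (arcs G)]))\<rparr>"

text \<open>
  Output: the flows \<open>F s t\<close> are stored one after the other in the real array 1, each as a block
  of length \<open>|E|\<close>, in lexicographic order of the positions of \<open>s\<close> and \<open>t\<close> in \<open>ss\<close> and \<open>ts\<close>.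
\<close>

definition output_represents ::
  "(nat, nat) pre_digraph \<Rightarrow> nat list \<Rightarrow> nat list \<Rightarrow> store \<Rightarrow> (nat \<Rightarrow> nat \<Rightarrow> nat \<Rightarrow> real) \<Rightarrow> bool"
where
  "output_represents G ss ts \<tau> F \<longleftrightarrow>
     (\<forall>i<length ss. \<forall>j<length ts. \<forall>e<card (arcs G).
        F (ss ! i) (ts ! j) e = rstore \<tau> 1 ((i * length ts + j) * card (arcs G) + e))"

definition decomposes_within ::
  "((nat, nat) pre_digraph \<Rightarrow> nat set \<Rightarrow> nat set \<Rightarrow> (nat \<Rightarrow> real) \<Rightarrow> bool) \<Rightarrow> com \<Rightarrow>
   (nat, nat) pre_digraph \<Rightarrow> nat list \<Rightarrow> nat list \<Rightarrow> (nat \<Rightarrow> real) \<Rightarrow> real \<Rightarrow> bool" where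
  "decomposes_within flow P G ss ts f bound \<longleftrightarrow>
     (\<exists>n \<tau> F. exec P (input_store G ss ts f) n \<tau> \<and> real n \<le> bound \<and>
        output_represents G ss ts \<tau> F \<and>
        flow_decomposition flow G (set ss) (set ts) f F)"

end

theory Submission
  imports Defs
begin

text \<open>
  Add a new source with an arc into each vertex of \<open>S\<close> and a new sink with an arc out of each vertex
  of \<open>T\<close>, carrying the divergence of the vertex, so that all original vertices conserve flow. Then
  eliminate the original vertices one after the other by splitting off: an arc \<open>a = uv\<close> and an arc
  \<open>b = vw\<close> are replaced, in the amount of the smaller one, by an arc \<open>uw\<close>. Parallel arcs are merged
  with the help of an adjacency matrix, and loops are put aside. In the end only arcs from new
  sources to new sinks are left, one for each pair \<open>(s, t)\<close>. Undoing the splittings in reverse order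
  turns the flow on such an arc into a flow from \<open>s\<close> to \<open>t\<close>; the loops turn into circulations that
  may join any of these flows. No division occurs, so integrality is preserved.

  Splitting off \<open>v\<close> takes time proportional to the degree of \<open>v\<close> and does not increase the number of
  arcs. In rounds, all vertices of degree at most \<open>D\<close> are eliminated, where \<open>D\<close> is about eight times
  the ratio of the current numbers of arcs and vertices; the degrees that were pushed above \<open>D\<close> during
  the round are paid for by the eliminated ones, so that at least a quarter of the vertices
  disappears. A round with \<open>l\<close> vertices costs \<open>O(l + min |E| (l + k)\<^sup>2)\<close>, and these costs sum up to
  \<open>O(|E| log (2 + |V|\<^sup>2 / |E|))\<close>.
\<close>

section \<open>Hoare rules with a real-valued time budget\<close>

section \<open>Timed total correctness\<close>

text \<open>A splitting exhausts one of the two arcs involved, so a vertex of degree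
  \<open>d\<close> needs at most \<open>d\<close> splittings and not one for each pair of its arcs,
  and the arc gained makes up for the arc lost. The obstacle is that eliminations raise the degrees
  of the neighbours, so no order fixed in advance is good; hence rounds with a fixed threshold,
  between which all lists are rebuilt from the arcs that still carry flow. While
  \<open>l\<^sup>2\<close> exceeds \<open>|E|\<close>, a round costs \<open>O(|E|)\<close>, and as
  \<open>l\<close> shrinks geometrically, the number of such rounds is logarithmic in
  \<open>|V|\<^sup>2 / |E|\<close>; from then on the costs themselves shrink geometrically. The
  potential \<open>|E| * ln (1 + (k + 1)\<^sup>2 * l\<^sup>2 / |E|)\<close> treats both regimes at
  once. It bounds the number of splittings too, so undoing them once for each of the
  \<open>|S| * |T|\<close> pairs stays within the time bound. The matrix has too many cells to be
  initialised in time; the construction relies on memory that is 0 at the start, and 0 means that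
  there is no arc.\<close>

primrec loop_free :: "com \<Rightarrow> bool" where
  "loop_free Skip \<longleftrightarrow> True"
| "loop_free (IWrite x a b) \<longleftrightarrow> True"
| "loop_free (RWrite x a r) \<longleftrightarrow> True"
| "loop_free (Seq P Q) \<longleftrightarrow> loop_free P \<and> loop_free Q"
| "loop_free (Cond b P Q) \<longleftrightarrow> loop_free P \<and> loop_free Q"
| "loop_free (While b P) \<longleftrightarrow> False"

text \<open>Loop-free code always terminates and can be executed symbolically by rewriting. The
  values of \<open>sem\<close> and \<open>max_cost\<close> at \<open>While\<close> are mere
  defaults; both functions are applied to \<open>loop_free\<close> programs only.\<close>

primrec sem :: "com \<Rightarrow> store \<Rightarrow> store" where
  "sem Skip \<sigma> = \<sigma>"
| "sem (IWrite x a b) \<sigma> =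
    \<sigma>\<lparr>istore := (istore \<sigma>)(x := (istore \<sigma> x)(ival a \<sigma> := ival b \<sigma>))\<rparr>"
| "sem (RWrite x a r) \<sigma> =
    \<sigma>\<lparr>rstore := (rstore \<sigma>)(x := (rstore \<sigma> x)(ival a \<sigma> := rval r \<sigma>))\<rparr>"
| "sem (Seq P Q) \<sigma> = sem Q (sem P \<sigma>)"
| "sem (Cond b P Q) \<sigma> = (if bval b \<sigma> then sem P \<sigma> else sem Q \<sigma>)"
| "sem (While b P) \<sigma> = \<sigma>"

primrec max_cost :: "com \<Rightarrow> nat" where
  "max_cost Skip = 1"
| "max_cost (IWrite x a b) = icost a + icost b + 1"
| "max_cost (RWrite x a r) = icost a + rcost r + 1"
| "max_cost (Seq P Q) = max_cost P + max_cost Q"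
| "max_cost (Cond b P Q) = bcost b + max (max_cost P) (max_cost Q) + 1"
| "max_cost (While b P) = 0"

lemma exec_sem: "loop_free P \<Longrightarrow> \<exists>n\<le>max_cost P. exec P \<sigma> n (sem P \<sigma>)"
proof (induction P arbitrary: \<sigma>)
  case Skip
  show ?case using exec.Skip by auto
next
  case (IWrite x a b)
  show ?case using exec.IWrite[of x a b \<sigma>] by auto
next
  case (RWrite x a r)
  show ?case using exec.RWrite[of x a r \<sigma>] by auto
next
  case (Seq P Q)
  then show ?case by simp (meson add_le_mono exec.Seq)
next
  case (Cond b P Q)
  show ?case
  proof (cases "bval b \<sigma>")
    case True
    obtain n where "n \<le> max_cost P" "exec P \<sigma> n (sem P \<sigma>)"
      using Cond by auto
    then show ?thesis
      using exec.CondTrue[OF True] True by (intro exI[of _ "bcost b + n + 1"]) auto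
  next
    case False
    obtain n where "n \<le> max_cost Q" "exec Q \<sigma> n (sem Q \<sigma>)"
      using Cond by auto
    then show ?thesis
      using exec.CondFalse[OF False] False by (intro exI[of _ "bcost b + n + 1"]) auto
  qed
qed simp

text \<open>The budget is a real number and only an upper bound, so that budgets add up along a
  program and may involve a logarithm.\<close>

definition runs :: "com \<Rightarrow> store \<Rightarrow> real \<Rightarrow> (store \<Rightarrow> bool) \<Rightarrow> bool" where
  "runs P \<sigma> r Q \<longleftrightarrow> (\<exists>n \<tau>. exec P \<sigma> n \<tau> \<and> real n \<le> r \<and> Q \<tau>)"

lemma runs_loop_free:
  assumes "loop_free P" "real (max_cost P) \<le> r" "Q (sem P \<sigma>)"
  shows "runs P \<sigma> r Q"
  using exec_sem[OF assms(1), of \<sigma>] assms(2,3) unfolding runs_def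
  by (meson of_nat_le_iff order_trans)

lemma runs_mono:
  assumes "runs P \<sigma> r Q" "r \<le> r'" "\<And>\<tau>. Q \<tau> \<Longrightarrow> Q' \<tau>"
  shows "runs P \<sigma> r' Q'"
  using assms unfolding runs_def by (meson order_trans)

lemma runs_Seq:
  assumes "runs P \<sigma> r Q" "\<And>\<rho>. Q \<rho> \<Longrightarrow> runs P' \<rho> r' Q'"
  shows "runs (Seq P P') \<sigma> (r + r') Q'"
proof -
  obtain n \<rho> where 1: "exec P \<sigma> n \<rho>" "real n \<le> r" "Q \<rho>"
    using assms(1) by (auto simp: runs_def)
  obtain n' \<tau> where 2: "exec P' \<rho> n' \<tau>" "real n' \<le> r'" "Q' \<tau>"
    using assms(2)[OF 1(3)] by (auto simp: runs_def)
  show ?thesis unfolding runs_def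
    by (rule exI[of _ "n + n'"]) (use 1 2 exec.Seq in force)
qed

lemma runs_Cond:
  assumes "bval b \<sigma> \<Longrightarrow> runs P \<sigma> r Q" "\<not> bval b \<sigma> \<Longrightarrow> runs P' \<sigma> r Q"
  shows "runs (Cond b P P') \<sigma> (r + bcost b + 1) Q"
proof (cases "bval b \<sigma>")
  case True
  then obtain n \<tau> where "exec P \<sigma> n \<tau>" "real n \<le> r" "Q \<tau>"
    using assms by (auto simp: runs_def)
  then show ?thesis
    using exec.CondTrue[OF True] unfolding runs_def
    by (intro exI[of _ "bcost b + n + 1"] exI[of _ \<tau>]) auto
next
  case False
  then obtain n \<tau> where "exec P' \<sigma> n \<tau>" "real n \<le> r" "Q \<tau>"
    using assms by (auto simp: runs_def)
  then show ?thesis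
    using exec.CondFalse[OF False] unfolding runs_def
    by (intro exI[of _ "bcost b + n + 1"] exI[of _ \<tau>]) auto
qed

text \<open>\<open>I r \<sigma>\<close> says that the loop may start an iteration in store \<open>\<sigma>\<close> with \<open>r\<close> units of credit
  left. Every iteration spends at least one unit, so termination comes for free.\<close>

lemma runs_While:
  assumes "I r \<sigma>"
    and nonneg: "\<And>r \<sigma>. I r \<sigma> \<Longrightarrow> 0 \<le> r"
    and step: "\<And>r \<sigma>. I r \<sigma> \<Longrightarrow> bval b \<sigma> \<Longrightarrow>
      \<exists>d. runs P \<sigma> d (\<lambda>\<tau>. \<exists>r'. I r' \<tau> \<and> r' + d + bcost b + 1 \<le> r)"
  shows "runs (While b P) \<sigma> (r + bcost b + 1) (\<lambda>\<tau>. \<not> bval b \<tau> \<and> (\<exists>r'. I r' \<tau>))"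
  using assms(1)
proof (induction "nat \<lfloor>r\<rfloor>" arbitrary: r \<sigma> rule: less_induct)
  case less
  show ?case
  proof (cases "bval b \<sigma>")
    case False
    then show ?thesis
      using exec.WhileFalse[OF False] nonneg[OF less.prems] less.prems unfolding runs_def
      by (intro exI[of _ "bcost b + 1"] exI[of _ \<sigma>]) auto
  next
    case True
    then obtain d m \<rho> r' where 1: "exec P \<sigma> m \<rho>" "real m \<le> d" "I r' \<rho>" "r' + d + bcost b + 1 \<le> r"
      using step[OF less.prems] by (auto simp: runs_def)
    have "r' + 1 \<le> r" "0 \<le> r'"
      using 1 nonneg by (auto intro: order_trans[rotated] simp: add_increasing)
    then have "nat \<lfloor>r'\<rfloor> < nat \<lfloor>r\<rfloor>"
      by linarith
    from less.hyps[OF this 1(3)] obtain n \<tau> where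
      2: "exec (While b P) \<rho> n \<tau>" "real n \<le> r' + bcost b + 1" "\<not> bval b \<tau>" "\<exists>r'. I r' \<tau>"
      by (auto simp: runs_def)
    have "exec (While b P) \<sigma> (bcost b + m + n + 1) \<tau>"
      by (rule exec.WhileTrue[OF True 1(1) 2(1)])
    moreover have "real (bcost b + m + n + 1) \<le> r + bcost b + 1"
      using 1 2 by simp
    ultimately show ?thesis
      using 2 unfolding runs_def by blast
  qed
qed

text \<open>For loops with a known number of iterations: the credit is the price of the
  \<open>n - i\<close> iterations still to come.\<close>

lemma runs_While_count:
  assumes "J 0 \<sigma>"
    and guard: "\<And>i \<sigma>. J i \<sigma> \<Longrightarrow> i \<le> n \<Longrightarrow> bval b \<sigma> \<longleftrightarrow> i < n"
    and step: "\<And>i \<sigma>. J i \<sigma> \<Longrightarrow> i < n \<Longrightarrow> runs P \<sigma> c (J (Suc i))"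
    and "0 \<le> c"
  shows "runs (While b P) \<sigma> (real n * (c + bcost b + 1) + bcost b + 1) (J n)"
proof -
  define I where "I r \<sigma> \<longleftrightarrow> (\<exists>i\<le>n. J i \<sigma> \<and> r = real (n - i) * (c + bcost b + 1))" for r \<sigma>
  have "runs (While b P) \<sigma> (real n * (c + bcost b + 1) + bcost b + 1)
    (\<lambda>\<tau>. \<not> bval b \<tau> \<and> (\<exists>r'. I r' \<tau>))"
  proof (rule runs_While)
    show "I (real n * (c + bcost b + 1)) \<sigma>"
      using assms(1) unfolding I_def by (intro exI[of _ 0]) auto
    show "0 \<le> r" if "I r \<sigma>" for r \<sigma>
      using that \<open>0 \<le> c\<close> by (auto simp: I_def)
  next
    fix r \<sigma> assume "I r \<sigma>" and b: "bval b \<sigma>"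
    then obtain i where i: "i \<le> n" "J i \<sigma>" "r = real (n - i) * (c + bcost b + 1)"
      by (auto simp: I_def)
    then have "i < n"
      using guard b by auto
    have "runs P \<sigma> c (\<lambda>\<tau>. \<exists>r'. I r' \<tau> \<and> r' + c + bcost b + 1 \<le> r)"
    proof (rule runs_mono[OF step[OF i(2) \<open>i < n\<close>] order_refl])
      fix \<tau> assume "J (Suc i) \<tau>"
      then show "\<exists>r'. I r' \<tau> \<and> r' + c + bcost b + 1 \<le> r"
        using \<open>i < n\<close> i(3) unfolding I_def
        by (intro exI[of _ "real (n - Suc i) * (c + bcost b + 1)"] conjI exI[of _ "Suc i"])
          (auto simp: of_nat_diff algebra_simps)
    qed
    then show "\<exists>d. runs P \<sigma> d (\<lambda>\<tau>. \<exists>r'. I r' \<tau> \<and> r' + d + bcost b + 1 \<le> r)" ..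
  qed
  then show ?thesis
    by (rule runs_mono) (use guard in \<open>auto simp: I_def order_le_less\<close>)
qed

section \<open>Splittings as pieces, and a ledger of the amounts on the arcs\<close>

section \<open>Splitting off\<close>

text \<open>The invariants keep all numbers in a set \<open>Z\<close>, which is either the set of all reals or that of
  all integers; this treats both kinds of flows at once.\<close>

definition add_closed :: "real set \<Rightarrow> bool" where
  "add_closed Z \<longleftrightarrow> 0 \<in> Z \<and> (\<forall>x\<in>Z. \<forall>y\<in>Z. x + y \<in> Z \<and> x - y \<in> Z)"

lemma add_closedD:
  assumes "add_closed Z"
  shows "0 \<in> Z" "x \<in> Z \<Longrightarrow> y \<in> Z \<Longrightarrow> x + y \<in> Z" "x \<in> Z \<Longrightarrow> y \<in> Z \<Longrightarrow> x - y \<in> Z"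
  using assms by (auto simp: add_closed_def)

lemma add_closed_sum: "add_closed Z \<Longrightarrow> (\<And>i. i \<in> A \<Longrightarrow> h i \<in> Z) \<Longrightarrow> sum h A \<in> Z"
  by (induction A rule: infinite_finite_induct) (auto simp: add_closedD)

text \<open>Arc \<open>0\<close> is a pool that collects the loops that arise, and \<open>1\<close> is a dummy.
  Neither has endpoints.\<close>

definition inc :: "(nat \<Rightarrow> nat) \<Rightarrow> (nat \<Rightarrow> nat) \<Rightarrow> nat \<Rightarrow> nat \<Rightarrow> real" where
  "inc s d c v = (if c < 2 then 0 else of_bool (s c = v) - of_bool (d c = v))"

lemma inc_less_2 [simp]: "inc s d 0 v = 0" "inc s d (Suc 0) v = 0"
  by (auto simp: inc_def)

text \<open>With the targets of the pieces as selector this is what splittings have put on arc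
  \<open>c\<close>; with their first or second arcs it is what they have taken from it. The latter
  two add up to \<open>used\<close>.\<close>

definition recv :: "nat \<Rightarrow> (nat \<Rightarrow> nat) \<Rightarrow> (nat \<Rightarrow> real) \<Rightarrow> nat \<Rightarrow> real" where
  "recv k pc X c = (\<Sum>p<k. if pc p = c then X p else 0)"

definition used :: "nat \<Rightarrow> (nat \<Rightarrow> nat) \<Rightarrow> (nat \<Rightarrow> nat) \<Rightarrow> (nat \<Rightarrow> real) \<Rightarrow> nat \<Rightarrow> real" where
  "used k pa pb X c = recv k pa X c + recv k pb X c"

lemma recv_Suc: "recv (Suc k) pc X c = recv k pc X c + (if pc k = c then X k else 0)"
  by (simp add: recv_def)

lemma recv_upd:
  "k \<le> m \<Longrightarrow> recv k (pc(m := c')) (X(m := x)) c = recv k pc X c"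
  unfolding recv_def by (rule sum.cong) auto

lemma recv_upd_value:
  assumes "q < k"
  shows "recv k pc (X(q := X q - y)) c = recv k pc X c - (if pc q = c then y else 0)"
proof -
  have "recv k pc (X(q := X q - y)) c =
      (\<Sum>p<k. (if pc p = c then X p else 0) - (if p = q then if pc q = c then y else 0 else 0))"
    unfolding recv_def by (rule sum.cong) auto
  also have "\<dots> = recv k pc X c - (if pc q = c then y else 0)"
    using assms unfolding sum_subtractf recv_def by simp
  finally show ?thesis .
qed

lemma recv_nonneg: "(\<And>p. p < k \<Longrightarrow> 0 \<le> X p) \<Longrightarrow> 0 \<le> recv k pc X c"
  unfolding recv_def by (rule sum_nonneg) auto

lemma recv_eq_0: "(\<And>p. p < k \<Longrightarrow> pc p \<noteq> c) \<Longrightarrow> recv k pc X c = 0"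
  unfolding recv_def by (rule sum.neutral) auto

lemma sum_recv:
  assumes "\<And>p. p < k \<Longrightarrow> pc p < m"
  shows "(\<Sum>c<m. recv k pc X c * h c) = (\<Sum>p<k. X p * h (pc p))"
proof -
  have "(\<Sum>c<m. recv k pc X c * h c) = (\<Sum>c<m. \<Sum>p<k. if pc p = c then X p * h (pc p) else 0)"
    unfolding recv_def sum_distrib_right by (intro sum.cong) auto
  also have "\<dots> = (\<Sum>p<k. \<Sum>c<m. if pc p = c then X p * h (pc p) else 0)"
    by (rule sum.swap)
  also have "\<dots> = (\<Sum>p<k. X p * h (pc p))"
    using assms by (intro sum.cong) auto
  finally show ?thesis .
qed

text \<open>
  Piece \<open>p\<close> routes an amount \<open>X p\<close> that travels along arc \<open>pc p\<close> over the arcs \<open>pa p\<close> and \<open>pb p\<close>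
  instead. The arcs below \<open>E2\<close> are those of the given network; the others were created by splitting
  off. All pieces into an arc precede the pieces out of it.
\<close>

definition pieces_ok :: "nat \<Rightarrow> nat \<Rightarrow> (nat \<Rightarrow> nat) \<Rightarrow> (nat \<Rightarrow> nat) \<Rightarrow> nat \<Rightarrow>
    (nat \<Rightarrow> nat) \<Rightarrow> (nat \<Rightarrow> nat) \<Rightarrow> (nat \<Rightarrow> nat) \<Rightarrow> bool" where
  "pieces_ok E2 m s d k pa pb pc \<longleftrightarrow> 2 \<le> E2 \<and> E2 \<le> m \<and>
    (\<forall>p<k. 2 \<le> pa p \<and> pa p < m \<and> (pb p = 1 \<or> 2 \<le> pb p \<and> pb p < m) \<and> pa p \<noteq> pb p \<and>
      (pc p = 0 \<or> E2 \<le> pc p \<and> pc p < m)) \<and>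
    (\<forall>p<k. \<forall>v. inc s d (pc p) v = inc s d (pa p) v + inc s d (pb p) v) \<and>
    (\<forall>p<k. \<forall>q<k. pa q = pc p \<or> pb q = pc p \<longrightarrow> p < q)"

lemma pieces_okD:
  assumes "pieces_ok E2 m s d k pa pb pc"
  shows "2 \<le> E2" "E2 \<le> m"
    and "p < k \<Longrightarrow> 2 \<le> pa p" "p < k \<Longrightarrow> pa p < m"
    and "p < k \<Longrightarrow> pb p = 1 \<or> 2 \<le> pb p" "p < k \<Longrightarrow> pb p < m"
    and "p < k \<Longrightarrow> pa p \<noteq> pb p" "p < k \<Longrightarrow> pc p = 0 \<or> E2 \<le> pc p" "p < k \<Longrightarrow> pc p < m"
    and "p < k \<Longrightarrow> inc s d (pc p) v = inc s d (pa p) v + inc s d (pb p) v"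
    and "p < k \<Longrightarrow> q < k \<Longrightarrow> pa q = pc p \<or> pb q = pc p \<Longrightarrow> p < q"
proof -
  show "2 \<le> E2" "E2 \<le> m"
    using assms unfolding pieces_ok_def by blast+
  then have "1 < m" "0 < m" by linarith+
  show "p < k \<Longrightarrow> 2 \<le> pa p" "p < k \<Longrightarrow> pa p < m"
    "p < k \<Longrightarrow> pb p = 1 \<or> 2 \<le> pb p" "p < k \<Longrightarrow> pa p \<noteq> pb p"
    "p < k \<Longrightarrow> pc p = 0 \<or> E2 \<le> pc p"
    "p < k \<Longrightarrow> inc s d (pc p) v = inc s d (pa p) v + inc s d (pb p) v"
    "p < k \<Longrightarrow> q < k \<Longrightarrow> pa q = pc p \<or> pb q = pc p \<Longrightarrow> p < q"
    using assms unfolding pieces_ok_def by blast+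
  show "p < k \<Longrightarrow> pb p < m" "p < k \<Longrightarrow> pc p < m"
    using assms \<open>1 < m\<close> \<open>0 < m\<close> unfolding pieces_ok_def by metis+
qed

text \<open>A ledger for every arc: initial amount plus receipts equals remaining amount plus
  withdrawals. The dummy arc \<open>1\<close> is exempt: it is debited without having any amount, so
  its entry may turn negative while staying in \<open>Z\<close>.\<close>

definition accounts_ok :: "real set \<Rightarrow> (nat \<Rightarrow> real) \<Rightarrow> (nat \<Rightarrow> real) \<Rightarrow> nat \<Rightarrow>
    (nat \<Rightarrow> nat) \<Rightarrow> (nat \<Rightarrow> nat) \<Rightarrow> (nat \<Rightarrow> nat) \<Rightarrow> (nat \<Rightarrow> real) \<Rightarrow> bool" where
  "accounts_ok Z base V k pa pb pc X \<longleftrightarrow>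
    (\<forall>c. V c \<in> Z \<and> X c \<in> Z) \<and> (\<forall>c. c \<noteq> 1 \<longrightarrow> 0 \<le> V c) \<and> (\<forall>p<k. 0 \<le> X p) \<and>
    (\<forall>c. c \<noteq> 1 \<longrightarrow> base c + recv k pc X c = V c + used k pa pb X c)"

text \<open>A piece exchanges one arc for two with the same total incidence vector, so splittings
  preserve the divergence at every vertex. In particular, vertices that conserve flow keep doing
  so.\<close>

lemma accounts_balance:
  assumes P: "pieces_ok E2 m s d k pa pb pc" and A: "accounts_ok Z base V k pa pb pc X"
    and base: "\<forall>c\<ge>E2. base c = 0"
  shows "(\<Sum>c<m. V c * inc s d c v) = (\<Sum>c<E2. base c * inc s d c v)"
proof -
  have E: "E2 \<le> m" "2 \<le> E2"
    using pieces_okD[OF P] by blast+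
  note lt = pieces_okD(4,6,9)[OF P]
  have V: "V c * inc s d c v =
      base c * inc s d c v + recv k pc X c * inc s d c v -
      (recv k pa X c * inc s d c v + recv k pb X c * inc s d c v)" for c
  proof (cases "c = 1")
    case False
    then have "V c = base c + recv k pc X c - (recv k pa X c + recv k pb X c)"
      using A by (simp add: accounts_ok_def used_def)
    then show ?thesis by (simp only: left_diff_distrib distrib_right)
  qed simp
  have "(\<Sum>c<m. V c * inc s d c v) = (\<Sum>c<m. base c * inc s d c v) +
      (\<Sum>p<k. X p * inc s d (pc p) v) -
      ((\<Sum>p<k. X p * inc s d (pa p) v) + (\<Sum>p<k. X p * inc s d (pb p) v))"
    unfolding V sum.distrib sum_subtractf using lt by (simp add: sum_recv)
  also have "\<dots> = (\<Sum>c<m. base c * inc s d c v)"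
    using pieces_okD(10)[OF P] by (simp add: distrib_left sum.distrib)
  also have "\<dots> = (\<Sum>c<E2. base c * inc s d c v)"
    using E base by (intro sum.mono_neutral_right) auto
  finally show ?thesis .
qed

text \<open>An arc number that has not been allocated occurs in no piece, so the ledger forces its
  amount to be 0. New arcs thus start empty, and an arc with a positive amount has been
  allocated.\<close>

lemma accounts_beyond:
  assumes P: "pieces_ok E2 m s d k pa pb pc" and A: "accounts_ok Z base V k pa pb pc X"
    and base: "\<forall>c\<ge>E2. base c = 0" and "m \<le> c"
  shows "V c = 0"
proof -
  have "recv k h X c = 0" if "\<And>p. p < k \<Longrightarrow> h p < m" for h
    using that \<open>m \<le> c\<close> by (intro recv_eq_0) fastforce
  then have "recv k pc X c = 0" "recv k pa X c = 0" "recv k pb X c = 0"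
    using pieces_okD[OF P] by blast+
  moreover have "c \<noteq> 1" "base c = 0"
    using pieces_okD(1,2)[OF P] \<open>m \<le> c\<close> base by auto
  ultimately show ?thesis
    using A by (auto simp: accounts_ok_def used_def)
qed

lemma accounts_add_piece:
  assumes P: "pieces_ok E2 m s d k pa pb pc" and A: "accounts_ok Z base V k pa pb pc X"
    and Z: "add_closed Z"
    and x: "x \<in> Z" "0 \<le> x" "x \<le> V a" "b \<noteq> 1 \<Longrightarrow> x \<le> V b"
    and ab: "a \<noteq> 1" "a \<noteq> b" "c \<noteq> a" "c \<noteq> b" "c \<noteq> 1"
  shows "accounts_ok Z base
    ((V(a := V a - x, b := V b - x))(c := V c + x)) (Suc k)
    (pa(k := a)) (pb(k := b)) (pc(k := c)) (X(k := x))"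
  unfolding accounts_ok_def
proof (intro conjI allI impI)
  fix c' assume "c' \<noteq> (1::nat)"
  then have "base c' + recv k pc X c' = V c' + (recv k pa X c' + recv k pb X c')"
    using A by (auto simp: accounts_ok_def used_def)
  moreover have "recv (Suc k) (h(k := e)) (X(k := x)) c' =
    recv k h X c' + (if e = c' then x else 0)" for h e
    by (simp add: recv_Suc recv_upd)
  ultimately show "base c' + recv (Suc k) (pc(k := c)) (X(k := x)) c' =
      (V(a := V a - x, b := V b - x, c := V c + x)) c' +
      used (Suc k) (pa(k := a)) (pb(k := b)) (X(k := x)) c'"
    unfolding used_def using ab by auto
next
  note V = A[unfolded accounts_ok_def, THEN conjunct1, rule_format]
    A[unfolded accounts_ok_def, THEN conjunct2, THEN conjunct1, rule_format]
    A[unfolded accounts_ok_def, THEN conjunct2, THEN conjunct2, THEN conjunct1, rule_format]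
  show "(V(a := V a - x, b := V b - x, c := V c + x)) c' \<in> Z" "(X(k := x)) c' \<in> Z" for c'
    using V(1) Z x(1) by (auto simp: add_closedD)
  show "0 \<le> (V(a := V a - x, b := V b - x, c := V c + x)) c'" if "c' \<noteq> 1" for c'
    using V(2)[of c'] that x ab by auto
  show "0 \<le> (X(k := x)) p" if "p < Suc k" for p
    using V(3)[of p] that x by auto
qed

lemma pieces_ok_mono:
  assumes P: "pieces_ok E2 m s d k pa pb pc" and "m \<le> m'"
    "\<And>c. c < m \<Longrightarrow> s' c = s c \<and> d' c = d c"
  shows "pieces_ok E2 m' s' d' k pa pb pc"
proof -
  have *: "inc s' d' c v = inc s d c v" if "c < m" for c v
    using that assms(3) by (auto simp: inc_def)
  have "inc s' d' (pc p) v = inc s' d' (pa p) v + inc s' d' (pb p) v" if "p < k" for p v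
    using that pieces_okD(4,6,9,10)[OF P] by (simp add: *)
  then show ?thesis
    unfolding pieces_ok_def
  proof (intro conjI allI impI)
    fix p assume "p < k"
    note * = pieces_okD(3-9)[OF P this]
    show "2 \<le> pa p" "pa p < m'" "pa p \<noteq> pb p"
      "pb p = 1 \<or> 2 \<le> pb p \<and> pb p < m'" "pc p = 0 \<or> E2 \<le> pc p \<and> pc p < m'"
      using * \<open>m \<le> m'\<close> by auto
  qed (use pieces_okD(1,2,11)[OF P] \<open>m \<le> m'\<close> in auto)
qed

text \<open>The new piece is the last one. The order of the pieces survives because no piece has
  drawn on its target \<open>c\<close> so far.\<close>

lemma pieces_ok_add:
  assumes P: "pieces_ok E2 m s d k pa pb pc"
    and ab: "2 \<le> a" "a < m" "b = 1 \<or> 2 \<le> b \<and> b < m" "a \<noteq> b" "c = 0 \<or> E2 \<le> c \<and> c < m"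
    and inc: "\<And>v. inc s d c v = inc s d a v + inc s d b v"
    and fresh: "c \<noteq> a" "c \<noteq> b" "\<And>q. q < k \<Longrightarrow> c \<noteq> pa q \<and> c \<noteq> pb q"
  shows "pieces_ok E2 m s d (Suc k) (pa(k := a)) (pb(k := b)) (pc(k := c))"
  unfolding pieces_ok_def
proof (intro conjI allI impI)
  fix p q
  assume pq: "p < Suc k" "q < Suc k"
    and *: "(pa(k := a)) q = (pc(k := c)) p \<or> (pb(k := b)) q = (pc(k := c)) p"
  show "p < q"
  proof (cases "p = k")
    case True
    then show ?thesis
      using * pq fresh(1,2) fresh(3)[of q] by (cases "q = k") auto
  next
    case False
    then have "pa q = pc p \<or> pb q = pc p" if "q \<noteq> k"
      using * that by auto
    then show ?thesis
      using pq False pieces_okD(11)[OF P, of p q] by (cases "q = k") auto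
  qed
next
  fix p assume "p < Suc k"
  then consider "p < k" | "p = k" by linarith
  then show "2 \<le> (pa(k := a)) p" "(pa(k := a)) p < m" "(pa(k := a)) p \<noteq> (pb(k := b)) p"
    "(pb(k := b)) p = 1 \<or> 2 \<le> (pb(k := b)) p \<and> (pb(k := b)) p < m"
    "(pc(k := c)) p = 0 \<or> E2 \<le> (pc(k := c)) p \<and> (pc(k := c)) p < m"
    "inc s d ((pc(k := c)) p) v =
      inc s d ((pa(k := a)) p) v + inc s d ((pb(k := b)) p) v" for v
    using pieces_okD(3-10)[OF P, of p] ab inc by (cases; auto)+
qed (use pieces_okD(1,2)[OF P] in auto)

section \<open>Singly linked lists of arcs\<close>

section \<open>Adjacency lists\<close>

text \<open>\<open>0\<close> marks the end of a list; this is unambiguous because arc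
  \<open>0\<close> is the pool and is never linked.\<close>

fun chain :: "(nat \<Rightarrow> nat) \<Rightarrow> nat \<Rightarrow> nat list \<Rightarrow> bool" where
  "chain nxt h [] \<longleftrightarrow> h = 0"
| "chain nxt h (x # xs) \<longleftrightarrow> h = x \<and> x \<noteq> 0 \<and> chain nxt (nxt x) xs"

lemma chain_cong: "chain nxt h xs \<Longrightarrow> (\<And>x. x \<in> set xs \<Longrightarrow> nxt' x = nxt x) \<Longrightarrow> chain nxt' h xs"
  by (induction xs arbitrary: h) auto

lemma chain_0 [simp]: "chain nxt 0 xs \<longleftrightarrow> xs = []"
  by (cases xs) auto

lemma chain_neq_0: "0 < h \<Longrightarrow> chain nxt h xs \<longleftrightarrow> (\<exists>ys. xs = h # ys \<and> chain nxt (nxt h) ys)"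
  by (cases xs) auto

definition lists_ok :: "nat set \<Rightarrow> (nat \<Rightarrow> nat) \<Rightarrow> (nat \<Rightarrow> nat) \<Rightarrow> (nat \<Rightarrow> nat) \<Rightarrow> nat set \<Rightarrow> bool"
where
  "lists_ok R s nxt hp L \<longleftrightarrow>
    (\<forall>v\<in>R. \<exists>xs. chain nxt (hp v) xs \<and> distinct xs \<and> set xs = {c \<in> L. s c = v})"

lemma lists_ok_link:
  assumes "lists_ok R s nxt hp L" "c \<notin> L" "c \<noteq> 0" "\<And>e. e \<in> L \<Longrightarrow> s' e = s e"
  shows "lists_ok R s' (nxt(c := hp (s' c))) (hp(s' c := c)) (insert c L)"
  unfolding lists_ok_def
proof
  fix v assume "v \<in> R"
  then obtain xs where xs: "chain nxt (hp v) xs" "distinct xs" "set xs = {c \<in> L. s c = v}"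
    using assms(1) by (auto simp: lists_ok_def)
  then have "c \<notin> set xs"
    using assms by auto
  then have ch: "chain (nxt(c := hp (s' c))) (hp v) xs"
    using xs(1) by (auto intro: chain_cong)
  show "\<exists>xs. chain (nxt(c := hp (s' c))) ((hp(s' c := c)) v) xs \<and> distinct xs \<and>
      set xs = {e \<in> insert c L. s' e = v}"
  proof (cases "s' c = v")
    case True
    then show ?thesis
      using xs ch \<open>c \<notin> set xs\<close> assms by (intro exI[of _ "c # xs"]) auto
  next
    case False
    then show ?thesis
      using xs ch assms by (intro exI[of _ xs]) auto
  qed
qed

section \<open>Invariants of the shrinking graph and of the elimination of one vertex\<close>

section \<open>The graph state\<close>

text \<open>\<open>vl\<close> holds the remaining amounts, \<open>mat\<close> the arc number for
  each pair of vertices, or 0. The lists of leaving and of entering arcs have their heads in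
  \<open>oh\<close>, \<open>ih\<close> and their links in \<open>on\<close>, \<open>inn\<close>;
  \<open>est\<close> counts the entries of both lists. \<open>al\<close> with \<open>cnt\<close>
  enumerates the linked arcs.\<close>

record graph_state =
  vl :: "nat \<Rightarrow> real"
  src :: "nat \<Rightarrow> nat"
  dst :: "nat \<Rightarrow> nat"
  nx :: nat
  mat :: "nat \<Rightarrow> nat"
  pa :: "nat \<Rightarrow> nat"
  pb :: "nat \<Rightarrow> nat"
  pc :: "nat \<Rightarrow> nat"
  px :: "nat \<Rightarrow> real"
  np :: nat
  oh :: "nat \<Rightarrow> nat"
  on :: "nat \<Rightarrow> nat"
  ih :: "nat \<Rightarrow> nat"
  inn :: "nat \<Rightarrow> nat"
  est :: "nat \<Rightarrow> nat"
  al :: "nat \<Rightarrow> nat"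
  cnt :: nat

definition link :: "nat \<Rightarrow> graph_state \<Rightarrow> graph_state" where
  "link c g = g\<lparr>
    on := (on g)(c := oh g (src g c)), oh := (oh g)(src g c := c),
    inn := (inn g)(c := ih g (dst g c)), ih := (ih g)(dst g c := c),
    est := (let e = (est g)(src g c := Suc (est g (src g c))) in
      e(dst g c := Suc (e (dst g c)))),
    al := (al g)(cnt g := c), cnt := Suc (cnt g)\<rparr>"

definition arc_id :: "nat \<Rightarrow> nat \<Rightarrow> nat \<Rightarrow> graph_state \<Rightarrow> nat" where
  "arc_id N u w g =
    (if u = w then 0 else if mat g (u * N + w) \<noteq> 0 then mat g (u * N + w) else nx g)"

definition add_arc :: "nat \<Rightarrow> nat \<Rightarrow> nat \<Rightarrow> graph_state \<Rightarrow> graph_state" where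
  "add_arc N u w g =
    (if u = w \<or> mat g (u * N + w) \<noteq> 0 then g
     else link (nx g) (g\<lparr>src := (src g)(nx g := u), dst := (dst g)(nx g := w),
       mat := (mat g)(u * N + w := nx g), nx := Suc (nx g)\<rparr>))"

definition add_piece :: "nat \<Rightarrow> nat \<Rightarrow> nat \<Rightarrow> real \<Rightarrow> graph_state \<Rightarrow> graph_state" where
  "add_piece a b c x g = g\<lparr>
    vl := (let V = (vl g)(a := vl g a - x); V = V(b := V b - x) in V(c := V c + x)),
    pa := (pa g)(np g := a), pb := (pb g)(np g := b), pc := (pc g)(np g := c),
    px := (px g)(np g := x), np := Suc (np g)\<rparr>"

definition insert_piece ::
  "nat \<Rightarrow> nat \<Rightarrow> nat \<Rightarrow> nat \<Rightarrow> nat \<Rightarrow> real \<Rightarrow> graph_state \<Rightarrow> graph_state" where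
  "insert_piece N a b u w x g = add_piece a b (arc_id N u w g) x (add_arc N u w g)"

text \<open>An arc is linked on creation and stays linked when its amount drops to 0. Hence the
  lists may contain empty arcs, and \<open>est\<close> is only an upper bound on the degree, until
  the next rebuilding.\<close>

definition linked :: "graph_state \<Rightarrow> nat set" where
  "linked g = al g ` {..<cnt g}"

definition links_ok :: "nat set \<Rightarrow> graph_state \<Rightarrow> bool" where
  "links_ok R g \<longleftrightarrow> inj_on (al g) {..<cnt g} \<and> 0 \<notin> linked g \<and>
    lists_ok R (src g) (on g) (oh g) (linked g) \<and>
    lists_ok R (dst g) (inn g) (ih g) (linked g) \<and>
    (\<forall>v\<in>R. est g v = card {c \<in> linked g. src g c = v} + card {c \<in> linked g. dst g c = v})"

lemma finite_linked [simp]: "finite (linked g)"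
  by (simp add: linked_def)

lemma linked_link: "linked (link c g) = insert c (linked g)"
  by (auto simp: linked_def link_def lessThan_Suc)

lemma links_ok_link:
  assumes "links_ok R g" "c \<notin> linked g" "c \<noteq> 0" "src g c \<noteq> dst g c"
  shows "links_ok R (link c g)"
proof -
  have 1: "inj_on (al (link c g)) {..<cnt (link c g)}"
    using assms(1,2) by (auto simp: links_ok_def linked_def link_def inj_on_def less_Suc_eq)
  have card: "card {e \<in> insert c (linked g). h e = v} =
      card {e \<in> linked g. h e = v} + (if h c = v then 1 else 0)" for h :: "nat \<Rightarrow> nat" and v
  proof (cases "h c = v")
    case True
    then have "{e \<in> insert c (linked g). h e = v} = insert c {e \<in> linked g. h e = v}"
      by auto
    then show ?thesis
      using True assms(2) by simp
  next
    case False
    then have "{e \<in> insert c (linked g). h e = v} = {e \<in> linked g. h e = v}"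
      by auto
    then show ?thesis
      using False by simp
  qed
  have 2: "lists_ok R (src (link c g)) (on (link c g)) (oh (link c g)) (linked (link c g))"
    "lists_ok R (dst (link c g)) (inn (link c g)) (ih (link c g)) (linked (link c g))"
    unfolding linked_link using assms
    by (auto simp: link_def links_ok_def intro!: lists_ok_link)
  have 3: "est (link c g) v = card {e \<in> linked (link c g). src (link c g) e = v} +
      card {e \<in> linked (link c g). dst (link c g) e = v}" if "v \<in> R" for v
  proof -
    have "src (link c g) = src g" "dst (link c g) = dst g"
      "est (link c g) v = est g v + (if src g c = v then 1 else 0) + (if dst g c = v then 1 else 0)"
      using assms(4) by (auto simp: link_def)
    then show ?thesis
      unfolding linked_link using that assms(1) by (simp only: card) (simp add: links_ok_def)
  qed
  show ?thesis
    unfolding links_ok_def using 1 2 3 assms(1,3)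
    by (auto simp: linked_link links_ok_def)
qed

text \<open>The vertices \<open>n, \<dots>, n + ls - 1\<close> are new sources without entering arcs, and
  \<open>n + ls, \<dots>, N - 1\<close> are new sinks without leaving arcs.\<close>

definition arcs_ok :: "nat \<Rightarrow> nat \<Rightarrow> nat \<Rightarrow> nat \<Rightarrow> graph_state \<Rightarrow> bool" where
  "arcs_ok N n ls E2 g \<longleftrightarrow>
    (\<forall>c. 2 \<le> c \<and> c < nx g \<longrightarrow>
      src g c < N \<and> dst g c < N \<and> src g c < n + ls \<and> (dst g c < n \<or> n + ls \<le> dst g c)) \<and>
    (\<forall>c. E2 \<le> c \<and> c < nx g \<longrightarrow> src g c \<noteq> dst g c \<and> mat g (src g c * N + dst g c) = c) \<and>
    (\<forall>u<N. \<forall>w<N. mat g (u * N + w) \<noteq> 0 \<longrightarrow>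
      E2 \<le> mat g (u * N + w) \<and> mat g (u * N + w) < nx g \<and>
      src g (mat g (u * N + w)) = u \<and> dst g (mat g (u * N + w)) = w) \<and>
    linked g \<subseteq> {E2..<nx g}"

text \<open>The vertices in \<open>Dead0\<close> are eliminated, and \<open>Dead\<close> contains in addition the vertex that is
  being eliminated. The adjacency lists are only maintained for the vertices in \<open>R\<close>.\<close>

definition live_ok :: "nat \<Rightarrow> nat set \<Rightarrow> nat set \<Rightarrow> graph_state \<Rightarrow> bool" where
  "live_ok E2 Dead0 Dead g \<longleftrightarrow>
    (\<forall>c. E2 \<le> c \<and> c < nx g \<longrightarrow>
      (0 < vl g c \<longrightarrow> c \<in> linked g) \<and>
      (src g c \<notin> Dead \<and> dst g c \<notin> Dead \<longrightarrow> 0 < vl g c) \<and>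
      (src g c \<in> Dead0 \<or> dst g c \<in> Dead0 \<longrightarrow> vl g c = 0))"

text \<open>Among the created arcs, flow is taken only from those at a vertex that is eliminated or
  being eliminated. An arc between two other vertices has not been drawn on, so pieces into it may
  still be added; this secures the order of the pieces.\<close>

definition used_dead :: "nat \<Rightarrow> nat set \<Rightarrow> graph_state \<Rightarrow> bool" where
  "used_dead E2 Dead g \<longleftrightarrow> (\<forall>p<np g. \<forall>c\<in>{pa g p, pb g p}. E2 \<le> c \<longrightarrow>
     src g c \<in> Dead \<or> dst g c \<in> Dead)"

definition graph_ok ::
  "real set \<Rightarrow> nat \<Rightarrow> nat \<Rightarrow> nat \<Rightarrow> nat \<Rightarrow> (nat \<Rightarrow> real) \<Rightarrow> nat set \<Rightarrow> nat set \<Rightarrow> nat set \<Rightarrow>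
    graph_state \<Rightarrow> bool" where
  "graph_ok Z N n ls E2 base R Dead0 Dead g \<longleftrightarrow>
    pieces_ok E2 (nx g) (src g) (dst g) (np g) (pa g) (pb g) (pc g) \<and>
    accounts_ok Z base (vl g) (np g) (pa g) (pb g) (pc g) (px g) \<and>
    links_ok R g \<and> arcs_ok N n ls E2 g \<and> live_ok E2 Dead0 Dead g \<and> used_dead E2 Dead g"

definition active :: "nat \<Rightarrow> graph_state \<Rightarrow> nat set" where
  "active E2 g = {c. E2 \<le> c \<and> c < nx g \<and> 0 < vl g c}"

lemma finite_active [simp]: "finite (active E2 g)"
  by (simp add: active_def)

lemma add_arc_simps [simp]:
  "vl (add_arc N u w g) = vl g" "pa (add_arc N u w g) = pa g" "pb (add_arc N u w g) = pb g"
  "pc (add_arc N u w g) = pc g" "px (add_arc N u w g) = px g" "np (add_arc N u w g) = np g"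
  by (auto simp: add_arc_def link_def)

lemma add_piece_simps [simp]:
  "src (add_piece a b c x g) = src g" "dst (add_piece a b c x g) = dst g"
  "nx (add_piece a b c x g) = nx g" "mat (add_piece a b c x g) = mat g"
  "oh (add_piece a b c x g) = oh g" "on (add_piece a b c x g) = on g"
  "ih (add_piece a b c x g) = ih g" "inn (add_piece a b c x g) = inn g"
  "est (add_piece a b c x g) = est g" "al (add_piece a b c x g) = al g"
  "cnt (add_piece a b c x g) = cnt g" "linked (add_piece a b c x g) = linked g"
  by (auto simp: add_piece_def linked_def)

lemma links_ok_add_piece [simp]: "links_ok R (add_piece a b c x g) = links_ok R g"
  by (simp add: links_ok_def)

lemma arcs_ok_add_piece [simp]: "arcs_ok N n ls E2 (add_piece a b c x g) = arcs_ok N n ls E2 g"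
  by (simp add: arcs_ok_def)

lemma index_inj:
  fixes u w u' w' N :: nat
  assumes "u * N + w = u' * N + w'" "w < N" "w' < N"
  shows "u = u'" "w = w'"
proof -
  have "(u * N + w) div N = u" "(u' * N + w') div N = u'"
    using assms(2,3) by auto
  then show "u = u'" using assms(1) by metis
  then show "w = w'" using assms by simp
qed

lemma add_arc_frame:
  assumes A: "arcs_ok N n ls E2 g"
  shows "nx g \<le> nx (add_arc N u w g)"
    and "c' < nx g \<Longrightarrow> src (add_arc N u w g) c' = src g c' \<and> dst (add_arc N u w g) c' = dst g c'"
    and "linked g \<subseteq> linked (add_arc N u w g)"
    and "c' < nx g \<Longrightarrow> on (add_arc N u w g) c' = on g c' \<and> inn (add_arc N u w g) c' = inn g c'"
    and "cnt (add_arc N u w g) \<le> Suc (cnt g)"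
    and "est g v \<le> est (add_arc N u w g) v"
  using A by (auto simp: add_arc_def link_def linked_def)

text \<open>The matrix provides one arc for each ordered pair of distinct vertices, and the arc it
  names is the only one that can have been newly allocated.\<close>

lemma add_arc_ok:
  assumes P: "pieces_ok E2 (nx g) (src g) (dst g) (np g) (pa g) (pb g) (pc g)"
    and L: "links_ok R g" and A: "arcs_ok N n ls E2 g"
    and uw: "u < N" "w < N" "u < n + ls" "w < n \<or> n + ls \<le> w"
  defines "g' \<equiv> add_arc N u w g" and "c \<equiv> arc_id N u w g"
  shows "pieces_ok E2 (nx g') (src g') (dst g') (np g) (pa g) (pb g) (pc g)"
    and "links_ok R g'" "arcs_ok N n ls E2 g'"
    and "c = 0 \<and> u = w \<or> u \<noteq> w \<and> E2 \<le> c \<and> c < nx g' \<and> src g' c = u \<and> dst g' c = w"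
    and "nx g \<le> c' \<Longrightarrow> c' < nx g' \<Longrightarrow> c' = c \<and> c \<in> linked g'"
proof -
  note E2 = pieces_okD(1,2)[OF P]
  show "pieces_ok E2 (nx g') (src g') (dst g') (np g) (pa g) (pb g) (pc g)"
    using add_arc_frame[OF A] by (intro pieces_ok_mono[OF P]) (auto simp: g'_def)
  show "links_ok R g'"
  proof (cases "u = w \<or> mat g (u * N + w) \<noteq> 0")
    case False
    have fresh: "nx g \<notin> linked g"
      using A by (auto simp: arcs_ok_def)
    let ?h = "g\<lparr>src := (src g)(nx g := u), dst := (dst g)(nx g := w),
       mat := (mat g)(u * N + w := nx g), nx := Suc (nx g)\<rparr>"
    have lk: "linked ?h = linked g"
      by (simp add: linked_def)
    have s: "{c \<in> linked g. ((src g)(nx g := u)) c = v} = {c \<in> linked g. src g c = v}"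
      "{c \<in> linked g. ((dst g)(nx g := w)) c = v} = {c \<in> linked g. dst g c = v}" for v
      using fresh by auto
    have "links_ok R ?h"
      using L s unfolding links_ok_def lk lists_ok_def by simp
    then have "links_ok R (link (nx g) ?h)"
      using fresh False E2 by (intro links_ok_link) (auto simp: lk)
    then show ?thesis
      using False by (simp add: g'_def add_arc_def)
  qed (use L in \<open>auto simp: g'_def add_arc_def\<close>)
  show "arcs_ok N n ls E2 g'"
  proof (cases "u = w \<or> mat g (u * N + w) \<noteq> 0")
    case False
    then have g': "src g' = (src g)(nx g := u)" "dst g' = (dst g)(nx g := w)"
      "mat g' = (mat g)(u * N + w := nx g)" "nx g' = Suc (nx g)"
      "linked g' = insert (nx g) (linked g)"
      by (auto simp: g'_def add_arc_def linked_link) (auto simp: link_def linked_def)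
    show ?thesis
      unfolding arcs_ok_def g'
    proof (intro conjI allI impI)
      fix c' assume c': "E2 \<le> c' \<and> c' < Suc (nx g)"
      show "((mat g)(u * N + w := nx g))
          (((src g)(nx g := u)) c' * N + ((dst g)(nx g := w)) c') = c'"
      proof (cases "c' = nx g")
        case nn: False
        then have "mat g (src g c' * N + dst g c') = c'" "c' \<noteq> 0"
          using A c' E2 by (auto simp: arcs_ok_def)
        then show ?thesis
          using nn False by (auto simp: less_Suc_eq)
      qed simp
    next
      fix u' w' assume uw': "u' < N" "w' < N"
        "((mat g)(u * N + w := nx g)) (u' * N + w') \<noteq> 0"
      have *: "E2 \<le> mat g (u' * N + w') \<and> mat g (u' * N + w') < nx g \<and>
          src g (mat g (u' * N + w')) = u' \<and> dst g (mat g (u' * N + w')) = w'"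
        if "u' * N + w' \<noteq> u * N + w"
        using that uw' A by (auto simp: arcs_ok_def)
      show "E2 \<le> ((mat g)(u * N + w := nx g)) (u' * N + w')"
        "((mat g)(u * N + w := nx g)) (u' * N + w') < Suc (nx g)"
        "((src g)(nx g := u)) (((mat g)(u * N + w := nx g)) (u' * N + w')) = u'"
        "((dst g)(nx g := w)) (((mat g)(u * N + w := nx g)) (u' * N + w')) = w'"
        using * E2 index_inj[OF _ uw'(2) uw(2), of u' u] by auto
    qed (use A False uw E2 in \<open>auto simp: arcs_ok_def less_Suc_eq\<close>)
  qed (use A in \<open>auto simp: g'_def add_arc_def\<close>)
  show "c = 0 \<and> u = w \<or> u \<noteq> w \<and> E2 \<le> c \<and> c < nx g' \<and> src g' c = u \<and> dst g' c = w"
    using A uw E2 by (auto simp: c_def g'_def arc_id_def add_arc_def link_def arcs_ok_def)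
  show "c' = c \<and> c \<in> linked g'" if "nx g \<le> c'" "c' < nx g'"
    using that by (auto simp: c_def g'_def arc_id_def add_arc_def linked_link split: if_splits)
      (auto simp: link_def)
qed

lemma insert_piece_simps:
  "np (insert_piece N a b u w x g) = Suc (np g)"
  "src (insert_piece N a b u w x g) = src (add_arc N u w g)"
  "dst (insert_piece N a b u w x g) = dst (add_arc N u w g)"
  "nx (insert_piece N a b u w x g) = nx (add_arc N u w g)"
  "on (insert_piece N a b u w x g) = on (add_arc N u w g)"
  "inn (insert_piece N a b u w x g) = inn (add_arc N u w g)"
  "est (insert_piece N a b u w x g) = est (add_arc N u w g)"
  "cnt (insert_piece N a b u w x g) = cnt (add_arc N u w g)"
  "linked (insert_piece N a b u w x g) = linked (add_arc N u w g)"
  by (auto simp: insert_piece_def) (simp add: add_piece_def)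

lemma graph_okD:
  assumes "graph_ok Z N n ls E2 base R Dead0 Dead g"
  shows "pieces_ok E2 (nx g) (src g) (dst g) (np g) (pa g) (pb g) (pc g)"
    "accounts_ok Z base (vl g) (np g) (pa g) (pb g) (pc g) (px g)"
    "links_ok R g" "arcs_ok N n ls E2 g" "live_ok E2 Dead0 Dead g" "used_dead E2 Dead g"
  using assms by (auto simp: graph_ok_def)

lemma arcs_okD:
  assumes "arcs_ok N n ls E2 g"
  shows "2 \<le> c \<Longrightarrow> c < nx g \<Longrightarrow>
      src g c < N \<and> dst g c < N \<and> src g c < n + ls \<and> (dst g c < n \<or> n + ls \<le> dst g c)"
    and "E2 \<le> c \<Longrightarrow> c < nx g \<Longrightarrow> src g c \<noteq> dst g c \<and> mat g (src g c * N + dst g c) = c"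
    and "c \<in> linked g \<Longrightarrow> E2 \<le> c \<and> c < nx g"
  using assms by (auto simp: arcs_ok_def)

lemma live_okD:
  assumes "live_ok E2 Dead0 Dead g" "E2 \<le> c" "c < nx g"
  shows "0 < vl g c \<Longrightarrow> c \<in> linked g"
    "src g c \<notin> Dead \<Longrightarrow> dst g c \<notin> Dead \<Longrightarrow> 0 < vl g c"
    "src g c \<in> Dead0 \<Longrightarrow> vl g c = 0" "dst g c \<in> Dead0 \<Longrightarrow> vl g c = 0"
  using assms by (auto simp: live_ok_def)

lemma accounts_okD:
  assumes "accounts_ok Z base V k p1 p2 p3 X"
  shows "V c \<in> Z" "X c \<in> Z" "c \<noteq> 1 \<Longrightarrow> 0 \<le> V c" "p < k \<Longrightarrow> 0 \<le> X p"
    "c \<noteq> 1 \<Longrightarrow> base c + recv k p3 X c = V c + used k p1 p2 X c"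
  using assms by (auto simp: accounts_ok_def)

text \<open>The common core of splitting off and, with \<open>b = 1\<close>, of moving a given arc
  into the simple graph. At most one arc gains flow; if \<open>x\<close> is the whole amount on a
  created arc, that arc drops out, and so the number of arcs with flow does not grow.\<close>

lemma insert_piece_ok:
  assumes G: "graph_ok Z N n ls E2 base R Dead0 Dead g" and Z: "add_closed Z"
    and base: "\<forall>c\<ge>E2. base c = 0" and "Dead0 \<subseteq> Dead"
    and a: "2 \<le> a" "a < nx g" "src g a = u" "E2 \<le> a \<Longrightarrow> dst g a \<in> Dead"
    and b: "b = 1 \<and> dst g a = w \<or>
      2 \<le> b \<and> b < nx g \<and> a \<noteq> b \<and> dst g a = src g b \<and> dst g b = w \<and> (E2 \<le> b \<longrightarrow> src g b \<in> Dead)"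
    and uw: "u \<notin> Dead" "w \<notin> Dead"
    and x: "x \<in> Z" "0 < x" "x \<le> vl g a" "b \<noteq> 1 \<Longrightarrow> x \<le> vl g b"
  defines "g' \<equiv> insert_piece N a b u w x g"
  shows "graph_ok Z N n ls E2 base R Dead0 Dead g'"
    and "vl g' a = vl g a - x" "b \<noteq> 1 \<Longrightarrow> vl g' b = vl g b - x"
    and "\<And>c. 2 \<le> c \<Longrightarrow> c \<noteq> a \<Longrightarrow> c \<noteq> b \<Longrightarrow> c < E2 \<or> src g' c \<in> Dead \<or> dst g' c \<in> Dead \<Longrightarrow>
      vl g' c = vl g c"
    and "card (active E2 g') \<le> Suc (card (active E2 g))"
    and "(x = vl g a \<and> E2 \<le> a) \<or> (x = vl g b \<and> E2 \<le> b) \<Longrightarrow>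
      card (active E2 g') \<le> card (active E2 g)"
proof -
  define g1 where "g1 = add_arc N u w g"
  define c where "c = arc_id N u w g"
  have g': "g' = add_piece a b c x g1"
    by (simp add: g'_def insert_piece_def g1_def c_def)
  note G' = graph_okD[OF G]
  note E2 = pieces_okD(1,2)[OF G'(1)]
  have uw': "u < N" "w < N" "u < n + ls" "w < n \<or> n + ls \<le> w"
    using arcs_okD(1)[OF G'(4), of a] arcs_okD(1)[OF G'(4), of b] a b by auto
  note 1 = add_arc_ok[OF G'(1,3,4) uw', folded g1_def c_def]
  note F = add_arc_frame[OF G'(4), where u = u and w = w, folded g1_def]
  have vl1: "vl g1 = vl g" "np g1 = np g" "pa g1 = pa g" "pb g1 = pb g" "pc g1 = pc g" "px g1 = px g"
    by (simp_all add: g1_def)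
  have c: "c = 0 \<and> u = w \<or> u \<noteq> w \<and> E2 \<le> c \<and> c < nx g1 \<and> src g1 c = u \<and> dst g1 c = w"
    using 1(4) by blast
  have b1: "b = 1 \<or> 2 \<le> b \<and> b < nx g1" "a < nx g1"
    using b a F(1) by auto
  have sd: "src g1 a = u" "dst g1 a = dst g a" "b \<noteq> 1 \<Longrightarrow> src g1 b = src g b \<and> dst g1 b = w"
    using F(2)[of a] F(2)[of b] a b by auto
  have "c \<noteq> 1"
    using c E2 by auto
  have "c \<noteq> a"
  proof
    assume "c = a"
    then show False using c a sd uw E2 by auto
  qed
  have "c \<noteq> b"
  proof
    assume "c = b"
    then show False using c b sd uw E2 by auto
  qed
  have "a \<noteq> b"
    using a b by auto
  \<comment> \<open>Otherwise a created arc with both ends outside \<open>Dead\<close> would have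
    been drawn on, against \<open>used_dead\<close>.\<close>
  have fresh: "c \<noteq> pa g q \<and> c \<noteq> pb g q" if "q < np g" for q
  proof -
    have *: "c \<noteq> e" if "e = pa g q \<or> e = pb g q" for e
    proof
      assume "c = e"
      have "e \<noteq> 0"
        using \<open>q < np g\<close> that pieces_okD(3,5)[OF G'(1)] by fastforce
      then have "E2 \<le> e" "src g1 e = u" "dst g1 e = w"
        using c \<open>c = e\<close> by auto
      moreover have "e < nx g"
        using that \<open>q < np g\<close> pieces_okD(4,6)[OF G'(1)] by auto
      ultimately have "src g e = u" "dst g e = w"
        using F(2)[of e] by auto
      then show False
        using G'(6) that \<open>q < np g\<close> \<open>E2 \<le> e\<close> uw by (auto simp: used_dead_def)
    qed
    show ?thesis using *[of "pa g q"] *[of "pb g q"] by blast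
  qed
  \<comment> \<open>The contributions of the middle vertex cancel. For \<open>u = w\<close> both
    sides vanish, in accordance with the pool having no endpoints.\<close>
  have inc: "inc (src g1) (dst g1) c v = inc (src g1) (dst g1) a v + inc (src g1) (dst g1) b v" for v
  proof -
    have i: "inc (src g1) (dst g1) a v = of_bool (u = v) - of_bool (dst g a = v)"
      using a(1) sd(1,2) by (simp add: inc_def)
    have ic: "inc (src g1) (dst g1) c v = of_bool (u = v) - of_bool (w = v)"
      using c
    proof (elim disjE conjE)
      assume "E2 \<le> c" "src g1 c = u" "dst g1 c = w"
      then show ?thesis using E2(1) by (simp add: inc_def)
    qed simp
    show ?thesis
    proof (cases "b = 1")
      case True
      then have "dst g a = w" using b by auto
      then show ?thesis
        using i ic True by simp
    next
      case False
      then have "dst g a = src g b" using b by blast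
      then have "inc (src g1) (dst g1) b v = of_bool (dst g a = v) - of_bool (w = v)"
        using sd(3) b1 False by (simp add: inc_def)
      then show ?thesis
        using i ic by simp
    qed
  qed
  have V: "vl g' = (vl g)(a := vl g a - x, b := vl g b - x, c := vl g c + x)"
    using \<open>a \<noteq> b\<close> \<open>c \<noteq> a\<close> \<open>c \<noteq> b\<close> by (simp add: g' add_piece_def vl1)
  have lk: "linked g' = linked g1" "nx g' = nx g1" "src g' = src g1" "dst g' = dst g1"
    by (auto simp: g')
  have P: "np g' = Suc (np g)" "pa g' = (pa g)(np g := a)" "pb g' = (pb g)(np g := b)"
    "pc g' = (pc g)(np g := c)" "px g' = (px g)(np g := x)"
    by (simp_all add: g' add_piece_def vl1)
  have "c = 0 \<or> E2 \<le> c \<and> c < nx g1"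
    using c by blast
  then have p: "pieces_ok E2 (nx g') (src g') (dst g') (np g') (pa g') (pb g') (pc g')"
    unfolding P lk
    by (intro pieces_ok_add[OF 1(1)] a(1) b1 \<open>a \<noteq> b\<close> inc fresh) (use \<open>c \<noteq> a\<close> \<open>c \<noteq> b\<close> in auto)
  have acc: "accounts_ok Z base (vl g') (np g') (pa g') (pb g') (pc g') (px g')"
    unfolding P V
    by (intro accounts_add_piece[OF G'(1,2) Z x(1)] x \<open>a \<noteq> b\<close> \<open>c \<noteq> a\<close> \<open>c \<noteq> b\<close> \<open>c \<noteq> 1\<close>)
      (use x(2) a(1) in auto)
  have old: "e < nx g" if "0 < vl g e" "2 \<le> e" for e
    using that accounts_beyond[OF G'(1,2) base, of e] by (rule_tac ccontr) simp
  have live: "live_ok E2 Dead0 Dead g'"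
    unfolding live_ok_def lk
  proof (intro allI impI conjI)
    fix e assume e: "E2 \<le> e \<and> e < nx g1"
    have small: "vl g e = 0" if "nx g \<le> e"
      using that accounts_beyond[OF G'(1,2) base, of e] by simp
    have e_sd: "src g1 e = src g e \<and> dst g1 e = dst g e" if "e < nx g"
      using that F(2) by auto
    \<comment> \<open>A rebuilding may have removed an empty arc from the lists, and giving it flow
      again would hide that flow. An already existing target joins two surviving vertices, so it
      carries flow by \<open>live_ok\<close> and is still linked.\<close>
    have mem: "c \<in> linked g1" if "e = c"
    proof (cases "c < nx g")
      case True
      then have "src g e = u" "dst g e = w" "E2 \<le> e"
        using c that e_sd e E2 by auto
      then have "0 < vl g e" using live_okD(2)[OF G'(5), of e] uw True that by auto
      then have "e \<in> linked g" using live_okD(1)[OF G'(5), of e] True that \<open>E2 \<le> e\<close> by auto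
      then show ?thesis using F(3) that by auto
    next
      case False
      then show ?thesis using 1(5)[of e] e that by auto
    qed
    have le: "vl g' e \<le> vl g e" if "e \<noteq> c"
      using that x(2) by (auto simp: V)
    show "e \<in> linked g1" if pos: "0 < vl g' e"
    proof (cases "e = c")
      case False
      then have "0 < vl g e"
        using le pos by simp
      then have "e \<in> linked g"
        using live_okD(1)[OF G'(5), of e] old[of e] e E2 by auto
      then show ?thesis using F(3) by auto
    qed (use mem in simp)
    have cpos: "0 < vl g' c"
      using x(2) accounts_okD(3)[OF G'(2) \<open>c \<noteq> 1\<close>] by (simp add: V)
    show "0 < vl g' e" if "src g1 e \<notin> Dead \<and> dst g1 e \<notin> Dead"
    proof (cases "e = c")
      case False
      have "e < nx g"
        using 1(5)[of e] e False by (meson not_le)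
      then have "0 < vl g e"
        using that e_sd live_okD(2)[OF G'(5), of e] e by auto
      moreover have "e \<noteq> a" "e \<noteq> b"
        using that sd a(4) b e E2 by auto
      ultimately show ?thesis
        using False by (simp add: V)
    qed (use cpos in simp)
    show "vl g' e = 0" if "src g1 e \<in> Dead0 \<or> dst g1 e \<in> Dead0"
    proof -
      have "e \<noteq> c"
        using that c uw \<open>Dead0 \<subseteq> Dead\<close> e E2 by auto
      then have "e < nx g"
        using 1(5)[of e] e by (meson not_le)
      then have "vl g e = 0"
        using that e_sd live_okD(3,4)[OF G'(5), of e] e by auto
      moreover have "e \<noteq> a" "e \<noteq> b"
        using calculation x b e E2 by auto
      ultimately show ?thesis
        using \<open>e \<noteq> c\<close> by (simp add: V)
    qed
  qed
  have ud: "used_dead E2 Dead g'"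
    unfolding used_dead_def lk
  proof (intro allI impI ballI)
    fix p e assume "p < np g'" "e \<in> {pa g' p, pb g' p}" "E2 \<le> e"
    then have "p < np g \<and> e \<in> {pa g p, pb g p} \<or> e = a \<or> e = b"
      by (auto simp: g' add_piece_def vl1 less_Suc_eq split: if_splits)
    then show "src g1 e \<in> Dead \<or> dst g1 e \<in> Dead"
    proof (elim disjE conjE)
      assume *: "p < np g" "e \<in> {pa g p, pb g p}"
      then have "e < nx g" using pieces_okD(4,6)[OF G'(1)] by auto
      then show ?thesis
        using * F(2)[of e] G'(6) \<open>E2 \<le> e\<close> unfolding used_dead_def by auto
    qed (use a(4) b sd \<open>E2 \<le> e\<close> E2 in auto)
  qed
  show "graph_ok Z N n ls E2 base R Dead0 Dead g'"
    unfolding graph_ok_def using p acc live ud 1(2,3) by (simp add: g')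
  show va: "vl g' a = vl g a - x" "b \<noteq> 1 \<Longrightarrow> vl g' b = vl g b - x"
    using \<open>a \<noteq> b\<close> \<open>c \<noteq> a\<close> \<open>c \<noteq> b\<close> by (auto simp: V)
  show "vl g' e = vl g e" if "2 \<le> e" "e \<noteq> a" "e \<noteq> b" "e < E2 \<or> src g' e \<in> Dead \<or> dst g' e \<in> Dead" for e
    using that c uw E2 by (auto simp: V lk)
  have sub: "active E2 g' \<subseteq> insert c (active E2 g - {e. vl g' e \<le> 0})"
  proof
    fix e assume e: "e \<in> active E2 g'"
    have "0 < vl g e" if "e \<noteq> c"
      using e x(2) that by (auto simp: V active_def split: if_splits)
    then show "e \<in> insert c (active E2 g - {e. vl g' e \<le> 0})"
      using e old[of e] E2 by (cases "e = c") (auto simp: active_def)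
  qed
  then have "active E2 g' \<subseteq> insert c (active E2 g)" by auto
  then have "card (active E2 g') \<le> card (insert c (active E2 g))"
    by (intro card_mono) auto
  also have "\<dots> \<le> Suc (card (active E2 g))"
    by (simp add: card_insert_if)
  finally show "card (active E2 g') \<le> Suc (card (active E2 g))" .
  assume z: "(x = vl g a \<and> E2 \<le> a) \<or> (x = vl g b \<and> E2 \<le> b)"
  then obtain e where "e \<in> active E2 g" "vl g' e \<le> 0"
  proof (elim disjE conjE)
    assume "x = vl g a" "E2 \<le> a"
    then show ?thesis
      using that[of a] va(1) x(2) a(2) by (simp add: active_def)
  next
    assume *: "x = vl g b" "E2 \<le> b"
    then have "b \<noteq> 1" using E2 by auto
    then have "b < nx g" using b by auto
    then show ?thesis
      using that[of b] va(2)[OF \<open>b \<noteq> 1\<close>] x(2) * by (simp add: active_def)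
  qed
  then have "active E2 g' \<subseteq> insert c (active E2 g - {e})"
    using sub by auto
  then have "card (active E2 g') \<le> card (insert c (active E2 g - {e}))"
    by (intro card_mono) auto
  also have "\<dots> \<le> Suc (card (active E2 g - {e}))"
    by (simp add: card_insert_if)
  also have "\<dots> = card (active E2 g)"
    by (rule card_Suc_Diff1) (simp_all add: \<open>e \<in> active E2 g\<close>)
  finally show "card (active E2 g') \<le> card (active E2 g)" .
qed

text \<open>Invariant of a simultaneous sweep through both lists of \<open>v\<close>:
  \<open>xs\<close> and \<open>ys\<close> are the parts not yet passed, and whatever flow the
  created arcs at \<open>v\<close> still carry is on these. The given arcs, below \<open>E2\<close>,
  are empty.\<close>

definition elim_ok ::
  "real set \<Rightarrow> nat \<Rightarrow> nat \<Rightarrow> nat \<Rightarrow> nat \<Rightarrow> (nat \<Rightarrow> real) \<Rightarrow> nat set \<Rightarrow> nat set \<Rightarrow> nat \<Rightarrow>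
    nat list \<Rightarrow> nat list \<Rightarrow> nat \<Rightarrow> nat \<Rightarrow> graph_state \<Rightarrow> bool" where
  "elim_ok Z N n ls E2 base R Dead v xs ys pin pout g \<longleftrightarrow>
    graph_ok Z N n ls E2 base R Dead (insert v Dead) g \<and>
    chain (inn g) pin xs \<and> chain (on g) pout ys \<and>
    (\<forall>c\<in>set xs. c \<in> linked g \<and> dst g c = v) \<and> (\<forall>c\<in>set ys. c \<in> linked g \<and> src g c = v) \<and>
    (\<forall>c. E2 \<le> c \<and> c < nx g \<and> 0 < vl g c \<longrightarrow>
      (dst g c = v \<longrightarrow> c \<in> set xs) \<and> (src g c = v \<longrightarrow> c \<in> set ys)) \<and>
    (\<forall>c. 2 \<le> c \<and> c < E2 \<longrightarrow> vl g c = 0)"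

lemma elim_okD:
  assumes "elim_ok Z N n ls E2 base R Dead v xs ys pin pout g"
  shows "graph_ok Z N n ls E2 base R Dead (insert v Dead) g"
    "chain (inn g) pin xs" "chain (on g) pout ys"
    "c \<in> set xs \<Longrightarrow> c \<in> linked g \<and> dst g c = v" "c \<in> set ys \<Longrightarrow> c \<in> linked g \<and> src g c = v"
    "E2 \<le> c \<Longrightarrow> c < nx g \<Longrightarrow> 0 < vl g c \<Longrightarrow> dst g c = v \<Longrightarrow> c \<in> set xs"
    "E2 \<le> c \<Longrightarrow> c < nx g \<Longrightarrow> 0 < vl g c \<Longrightarrow> src g c = v \<Longrightarrow> c \<in> set ys"
    "2 \<le> c \<Longrightarrow> c < E2 \<Longrightarrow> vl g c = 0"
  using assms by (auto simp: elim_ok_def)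

lemma elim_start:
  assumes G: "graph_ok Z N n ls E2 base R Dead Dead g" and "v \<in> R"
    and slots: "\<And>c. 2 \<le> c \<Longrightarrow> c < E2 \<Longrightarrow> vl g c = 0"
  obtains xs ys where "elim_ok Z N n ls E2 base R Dead v xs ys (ih g v) (oh g v) g"
    "length xs + length ys = est g v"
proof -
  note G' = graph_okD[OF G]
  obtain xs where xs: "chain (inn g) (ih g v) xs" "distinct xs" "set xs = {c \<in> linked g. dst g c = v}"
    using G'(3) \<open>v \<in> R\<close> by (auto simp: links_ok_def lists_ok_def)
  obtain ys where ys: "chain (on g) (oh g v) ys" "distinct ys" "set ys = {c \<in> linked g. src g c = v}"
    using G'(3) \<open>v \<in> R\<close> by (auto simp: links_ok_def lists_ok_def)
  have "live_ok E2 Dead (insert v Dead) g" "used_dead E2 (insert v Dead) g"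
    using G'(5,6) by (auto simp: live_ok_def used_dead_def)
  then have "elim_ok Z N n ls E2 base R Dead v xs ys (ih g v) (oh g v) g"
    unfolding elim_ok_def graph_ok_def using G' xs ys slots live_okD(1)[OF G'(5)] by auto
  moreover have "length xs + length ys = est g v"
    using G'(3) \<open>v \<in> R\<close> distinct_card[OF xs(2)] distinct_card[OF ys(2)] xs(3) ys(3)
    by (simp add: links_ok_def)
  ultimately show ?thesis using that by blast
qed

lemma elim_skip_in:
  assumes "elim_ok Z N n ls E2 base R Dead v (a # xs) ys a pout g" "\<not> 0 < vl g a"
  shows "elim_ok Z N n ls E2 base R Dead v xs ys (inn g a) pout g"
  using assms unfolding elim_ok_def by (auto split: if_splits)

lemma elim_skip_out:
  assumes "elim_ok Z N n ls E2 base R Dead v xs (b # ys) pin b g" "\<not> 0 < vl g b"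
  shows "elim_ok Z N n ls E2 base R Dead v xs ys pin (on g b) g"
  using assms unfolding elim_ok_def by (auto split: if_splits)

text \<open>Both arcs carry flow, so their outer ends are not eliminated, and they differ from
  \<open>v\<close> because created arcs are not loops. The new arc therefore avoids
  \<open>v\<close>, and the sweep through the lists of \<open>v\<close> is undisturbed.\<close>

lemma elim_piece:
  assumes I: "elim_ok Z N n ls E2 base R Dead v (a # xs) (b # ys) a b g" and Z: "add_closed Z"
    and base: "\<forall>c\<ge>E2. base c = 0"
    and x: "0 < x" "x \<le> vl g a" "x \<le> vl g b" "x = vl g a \<or> x = vl g b"
  defines "g' \<equiv> insert_piece N a b (src g a) (dst g b) x g"
  shows "elim_ok Z N n ls E2 base R Dead v (a # xs) (b # ys) a b g'"
    and "vl g' a = vl g a - x" "vl g' b = vl g b - x"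
    and "inn g' a = inn g a" "on g' b = on g b"
    and "card (active E2 g') \<le> card (active E2 g)"
proof -
  note I' = elim_okD[OF I]
  note G = graph_okD[OF I'(1)]
  note E2 = pieces_okD(1,2)[OF G(1)]
  have ab: "a \<in> linked g" "dst g a = v" "b \<in> linked g" "src g b = v"
    using I'(4)[of a] I'(5)[of b] by auto
  then have ab': "E2 \<le> a" "a < nx g" "E2 \<le> b" "b < nx g"
    using arcs_okD(3)[OF G(4)] by auto
  have ne: "src g a \<noteq> v" "dst g b \<noteq> v" "a \<noteq> b"
    using arcs_okD(2)[OF G(4) ab'(1,2)] arcs_okD(2)[OF G(4) ab'(3,4)] ab by auto
  have nd: "src g a \<notin> insert v Dead" "dst g b \<notin> insert v Dead"
    using live_okD(3)[OF G(5) ab'(1,2)] live_okD(4)[OF G(5) ab'(3,4)] x ne by auto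
  have xZ: "x \<in> Z"
    using x(4) accounts_okD(1)[OF G(2)] by auto
  have b': "b = 1 \<and> dst g a = dst g b \<or>
      2 \<le> b \<and> b < nx g \<and> a \<noteq> b \<and> dst g a = src g b \<and> dst g b = dst g b \<and>
      (E2 \<le> b \<longrightarrow> src g b \<in> insert v Dead)"
    using ab ab' ne E2 by auto
  note ins = insert_piece_ok[OF I'(1) Z base subset_insertI _ ab'(2) refl _ b' nd xZ x(1,2),
      folded g'_def]
  have b1: "b \<noteq> 1" "2 \<le> a" "E2 \<le> a \<Longrightarrow> dst g a \<in> insert v Dead"
    using ab ab' E2 by auto
  show va: "vl g' a = vl g a - x" "vl g' b = vl g b - x"
    using ins(2,3) b1 x(3) by auto
  show "card (active E2 g') \<le> card (active E2 g)"
    using ins(6) b1 x(3,4) ab' by auto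
  note F = add_arc_frame[OF G(4), where u = "src g a" and w = "dst g b"]
  have F': "inn g' c = inn g c" "on g' c = on g c" "src g' c = src g c" "dst g' c = dst g c"
    if "c < nx g" for c
    using F(2,4)[OF that] by (auto simp: g'_def insert_piece_simps)
  then show "inn g' a = inn g a" "on g' b = on g b"
    using ab' by auto
  have lk: "c \<in> linked g' \<and> c < nx g" if "c \<in> linked g" for c
    using that F(3) arcs_okD(3)[OF G(4) that] by (auto simp: g'_def insert_piece_simps)
  have gok: "graph_ok Z N n ls E2 base R Dead (insert v Dead) g'"
    using ins(1) b1 x(3) by auto
  have other: "vl g' c = vl g c"
    if "2 \<le> c" "c \<noteq> a" "c \<noteq> b" "c < E2 \<or> src g' c = v \<or> dst g' c = v" for c
    using ins(4)[of c] b1 x(3) that by auto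
  have cov: "c < nx g \<and> 0 < vl g c \<and> src g' c = src g c \<and> dst g' c = dst g c"
    if c: "E2 \<le> c" "c < nx g'" "0 < vl g' c" "src g' c = v \<or> dst g' c = v" for c
  proof -
    have pos: "0 < vl g c"
      using c other[of c] va x E2 by (cases "c = a \<or> c = b") auto
    then have "c < nx g"
      using accounts_beyond[OF G(1,2) base, of c] by (rule_tac ccontr) simp
    then show ?thesis using pos F' by auto
  qed
  show "elim_ok Z N n ls E2 base R Dead v (a # xs) (b # ys) a b g'"
    unfolding elim_ok_def
  proof (intro conjI allI impI ballI)
    show "chain (inn g') a (a # xs)"
      using I'(2) by (rule chain_cong) (use I'(4) lk F' in blast)
    show "chain (on g') b (b # ys)"
      using I'(3) by (rule chain_cong) (use I'(5) lk F' in blast)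
    show "c \<in> linked g'" "dst g' c = v" if "c \<in> set (a # xs)" for c
      using I'(4)[OF that] lk F' by auto
    show "c \<in> linked g'" "src g' c = v" if "c \<in> set (b # ys)" for c
      using I'(5)[OF that] lk F' by auto
    show "c \<in> set (a # xs)" if "E2 \<le> c \<and> c < nx g' \<and> 0 < vl g' c" "dst g' c = v" for c
      using that cov[of c] I'(6)[of c] by auto
    show "c \<in> set (b # ys)" if "E2 \<le> c \<and> c < nx g' \<and> 0 < vl g' c" "src g' c = v" for c
      using that cov[of c] I'(7)[of c] by auto
    show "vl g' c = 0" if "2 \<le> c \<and> c < E2" for c
      using that other[of c] I'(8)[of c] ab' by auto
  qed (rule gok)
qed

text \<open>Once the arcs on one side of \<open>v\<close> carry nothing, conservation empties the other side.\<close>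

lemma elim_finish:
  assumes I: "elim_ok Z N n ls E2 base R Dead v xs ys pin pout g" and "xs = [] \<or> ys = []"
    and base: "\<forall>c\<ge>E2. base c = 0"
    and circ: "(\<Sum>c<E2. base c * inc (src g) (dst g) c v) = 0"
  shows "graph_ok Z N n ls E2 base R (insert v Dead) (insert v Dead) g"
proof -
  note I' = elim_okD[OF I]
  note G = graph_okD[OF I'(1)]
  note E2 = pieces_okD(1,2)[OF G(1)]
  have nn: "0 \<le> vl g c" if "2 \<le> c" for c
    using accounts_okD(3)[OF G(2), of c] that by auto
  have bal: "(\<Sum>c<nx g. vl g c * inc (src g) (dst g) c v) = 0"
    using accounts_balance[OF G(1,2) base] circ by auto
  have zero: "vl g c = 0" if c: "E2 \<le> c" "c < nx g" "src g c = v \<or> dst g c = v" for c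
  proof (cases "xs = []")
    case True
    then have d0: "vl g e = 0" if "2 \<le> e" "e < nx g" "dst g e = v" for e
      using I'(6)[of e] I'(8)[of e] nn[of e] that by (cases "e < E2") force+
    have *: "0 \<le> vl g e * inc (src g) (dst g) e v" if "e < nx g" for e
      using d0[of e] nn[of e] that by (auto simp: inc_def)
    then have "vl g c * inc (src g) (dst g) c v = 0"
      using bal c sum_nonneg_eq_0_iff[of "{..<nx g}" "\<lambda>c. vl g c * inc (src g) (dst g) c v"]
      by auto
    then show ?thesis
      using c d0[of c] E2 arcs_okD(2)[OF G(4) c(1,2)] by (auto simp: inc_def)
  next
    case False
    then have d0: "vl g e = 0" if "2 \<le> e" "e < nx g" "src g e = v" for e
      using I'(7)[of e] I'(8)[of e] nn[of e] that assms(2) by (cases "e < E2") force+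
    have *: "vl g e * inc (src g) (dst g) e v \<le> 0" if "e < nx g" for e
      using d0[of e] nn[of e] that by (auto simp: inc_def)
    then have "- (vl g c * inc (src g) (dst g) c v) = 0"
      using bal c sum_nonneg_eq_0_iff[of "{..<nx g}" "\<lambda>c. - (vl g c * inc (src g) (dst g) c v)"]
      by (auto simp: sum_negf)
    then show ?thesis
      using c d0[of c] E2 arcs_okD(2)[OF G(4) c(1,2)] by (auto simp: inc_def)
  qed
  have "live_ok E2 (insert v Dead) (insert v Dead) g"
    using G(5) zero by (auto simp: live_ok_def)
  then show ?thesis
    using G by (auto simp: graph_ok_def)
qed

section \<open>Elimination of a single vertex on the machine\<close>

section \<open>The elimination program\<close>

text \<open>
  Integer arrays: 5 registers, 6 row offsets of the matrix, 7 uneliminated vertices, 8 and 9 tails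
  and heads, 10 the adjacency matrix, 11 to 13 the pieces, 14 to 17 the adjacency lists, 18 their
  lengths, 19 the linked arcs. Real arrays: 2 unrouted amounts, 3 amounts of the pieces, 4 the flow
  being extracted, 5 divergences, 6 a register.
\<close>

definition graph_of :: "store \<Rightarrow> graph_state" where
  "graph_of \<sigma> = \<lparr>vl = rstore \<sigma> 2, src = istore \<sigma> 8, dst = istore \<sigma> 9, nx = istore \<sigma> 5 3,
    mat = istore \<sigma> 10, pa = istore \<sigma> 11, pb = istore \<sigma> 12, pc = istore \<sigma> 13,
    px = rstore \<sigma> 3, np = istore \<sigma> 5 4, oh = istore \<sigma> 14, on = istore \<sigma> 15,
    ih = istore \<sigma> 16, inn = istore \<sigma> 17, est = istore \<sigma> 18, al = istore \<sigma> 19,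
    cnt = istore \<sigma> 5 5\<rparr>"

abbreviation Reg :: "nat \<Rightarrow> iexp" where "Reg r \<equiv> IRead 5 (INum r)"
abbreviation SetReg :: "nat \<Rightarrow> iexp \<Rightarrow> com" where "SetReg r e \<equiv> IWrite 5 (INum r) e"
abbreviation reg :: "store \<Rightarrow> nat \<Rightarrow> nat" where "reg \<sigma> r \<equiv> istore \<sigma> 5 r"
abbreviation incr :: "nat \<Rightarrow> com" where "incr r \<equiv> SetReg r (IAdd (Reg r) (INum 1))"

abbreviation seq :: "com \<Rightarrow> com \<Rightarrow> com" (infixr ";;" 60) where "P ;; Q \<equiv> Seq P Q"

abbreviation (input) "rN \<equiv> 2 :: nat"
abbreviation (input) "rnx \<equiv> 3 :: nat"
abbreviation (input) "rnp \<equiv> 4 :: nat"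
abbreviation (input) "rcnt \<equiv> 5 :: nat"
abbreviation (input) "rnl \<equiv> 6 :: nat"
abbreviation (input) "rA \<equiv> 7 :: nat"
abbreviation (input) "rB \<equiv> 8 :: nat"
abbreviation (input) "rU \<equiv> 9 :: nat"
abbreviation (input) "rW \<equiv> 10 :: nat"
abbreviation (input) "rC \<equiv> 11 :: nat"
abbreviation (input) "ri \<equiv> 12 :: nat"
abbreviation (input) "rold \<equiv> 13 :: nat"
abbreviation (input) "rD \<equiv> 14 :: nat"
abbreviation (input) "racc \<equiv> 15 :: nat"
abbreviation (input) "rv \<equiv> 16 :: nat"
abbreviation (input) "rpin \<equiv> 17 :: nat"
abbreviation (input) "rpout \<equiv> 18 :: nat"
abbreviation (input) "rj \<equiv> 20 :: nat"
abbreviation (input) "ro \<equiv> 21 :: nat"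
abbreviation (input) "rq \<equiv> 22 :: nat"
abbreviation (input) "re \<equiv> 23 :: nat"
abbreviation (input) "rE2 \<equiv> 24 :: nat"

abbreviation xreg :: "store \<Rightarrow> real" where "xreg \<sigma> \<equiv> rstore \<sigma> 6 2"
abbreviation "Xreg \<equiv> RRead 6 (INum 2)"

definition link_code :: com where
  "link_code =
    IWrite 15 (Reg rC) (IRead 14 (IRead 8 (Reg rC))) ;;
    IWrite 14 (IRead 8 (Reg rC)) (Reg rC) ;;
    IWrite 17 (Reg rC) (IRead 16 (IRead 9 (Reg rC))) ;;
    IWrite 16 (IRead 9 (Reg rC)) (Reg rC) ;;
    IWrite 18 (IRead 8 (Reg rC)) (IAdd (IRead 18 (IRead 8 (Reg rC))) (INum 1)) ;;
    IWrite 18 (IRead 9 (Reg rC)) (IAdd (IRead 18 (IRead 9 (Reg rC))) (INum 1)) ;;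
    IWrite 19 (Reg rcnt) (Reg rC) ;;
    incr rcnt"

definition insert_code :: com where
  "insert_code =
    Cond (BAnd (BNot (ILess (Reg rU) (Reg rW))) (BNot (ILess (Reg rW) (Reg rU))))
      (SetReg rC (INum 0))
      (SetReg rC (IRead 10 (IAdd (IRead 6 (Reg rU)) (Reg rW))) ;;
       Cond (ILess (INum 0) (Reg rC)) Skip
        (SetReg rC (Reg rnx) ;;
         incr rnx ;;
         IWrite 8 (Reg rC) (Reg rU) ;;
         IWrite 9 (Reg rC) (Reg rW) ;;
         IWrite 10 (IAdd (IRead 6 (Reg rU)) (Reg rW)) (Reg rC) ;;
         link_code)) ;;
    RWrite 2 (Reg rA) (RSub (RRead 2 (Reg rA)) Xreg) ;;
    RWrite 2 (Reg rB) (RSub (RRead 2 (Reg rB)) Xreg) ;;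
    RWrite 2 (Reg rC) (RAdd (RRead 2 (Reg rC)) Xreg) ;;
    IWrite 11 (Reg rnp) (Reg rA) ;;
    IWrite 12 (Reg rnp) (Reg rB) ;;
    IWrite 13 (Reg rnp) (Reg rC) ;;
    RWrite 3 (Reg rnp) Xreg ;;
    incr rnp"

definition frame :: "store \<Rightarrow> store \<Rightarrow> bool" where
  "frame \<sigma> \<tau> \<longleftrightarrow>
    (\<forall>k<8. k \<noteq> 5 \<longrightarrow> istore \<tau> k = istore \<sigma> k) \<and>
    (\<forall>r. r \<notin> {rnx, rnp, rcnt, rA, rB, rU, rW, rC, rpin, rpout} \<longrightarrow> reg \<tau> r = reg \<sigma> r) \<and>
    (\<forall>k. k \<notin> {2, 3, 6} \<longrightarrow> rstore \<tau> k = rstore \<sigma> k)"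

lemma frame_refl [simp]: "frame \<sigma> \<sigma>"
  by (simp add: frame_def)

lemma frame_trans: "frame \<sigma> \<rho> \<Longrightarrow> frame \<rho> \<tau> \<Longrightarrow> frame \<sigma> \<tau>"
  by (simp add: frame_def)

lemma frameD:
  assumes "frame \<sigma> \<tau>"
  shows "k < 8 \<Longrightarrow> k \<noteq> 5 \<Longrightarrow> istore \<tau> k = istore \<sigma> k"
    "r \<notin> {rnx, rnp, rcnt, rA, rB, rU, rW, rC, rpin, rpout} \<Longrightarrow> reg \<tau> r = reg \<sigma> r"
    "k \<notin> {2, 3, 6} \<Longrightarrow> rstore \<tau> k = rstore \<sigma> k"
  using assms by (auto simp: frame_def)

text \<open>The machine cannot multiply indices. The row offsets are tabulated once by repeated
  addition, which gives access to a matrix cell in constant time.\<close>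

definition rows_ok :: "nat \<Rightarrow> store \<Rightarrow> bool" where
  "rows_ok N \<sigma> \<longleftrightarrow> (\<forall>u<N. istore \<sigma> 6 u = u * N)"

lemma rows_ok_frame: "frame \<sigma> \<tau> \<Longrightarrow> rows_ok N \<tau> = rows_ok N \<sigma>"
  by (simp add: frame_def rows_ok_def)

lemma loop_free_insert: "loop_free link_code" "loop_free insert_code"
  by (simp_all add: link_code_def insert_code_def)

lemma sem_link:
  "graph_of (sem link_code \<sigma>) = link (reg \<sigma> rC) (graph_of \<sigma>)"
  "frame \<sigma> (sem link_code \<sigma>)"
  by (simp_all add: link_code_def graph_of_def link_def Let_def frame_def)

lemma sem_insert:
  assumes "rows_ok N \<sigma>" "reg \<sigma> rU < N"
  shows "graph_of (sem insert_code \<sigma>) =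
      insert_piece N (reg \<sigma> rA) (reg \<sigma> rB) (reg \<sigma> rU) (reg \<sigma> rW) (xreg \<sigma>) (graph_of \<sigma>)"
    and "frame \<sigma> (sem insert_code \<sigma>)"
    and "reg (sem insert_code \<sigma>) rpin = reg \<sigma> rpin"
    and "reg (sem insert_code \<sigma>) rpout = reg \<sigma> rpout"
proof -
  have r: "istore \<sigma> 6 (istore \<sigma> 5 9) = reg \<sigma> rU * N"
    using assms by (simp add: rows_ok_def)
  show "graph_of (sem insert_code \<sigma>) =
      insert_piece N (reg \<sigma> rA) (reg \<sigma> rB) (reg \<sigma> rU) (reg \<sigma> rW) (xreg \<sigma>) (graph_of \<sigma>)"
    by (cases "reg \<sigma> rU = reg \<sigma> rW"; cases "istore \<sigma> 10 (reg \<sigma> rU * N + reg \<sigma> rW) = 0")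
      (auto simp: insert_code_def link_code_def graph_of_def insert_piece_def add_piece_def
        arc_id_def add_arc_def link_def Let_def r)
  show "frame \<sigma> (sem insert_code \<sigma>)"
    "reg (sem insert_code \<sigma>) rpin = reg \<sigma> rpin" "reg (sem insert_code \<sigma>) rpout = reg \<sigma> rpout"
    by (auto simp: insert_code_def link_code_def frame_def)
qed

text \<open>Here \<open>k\<close> counts iterations, each of which adds at most one piece and one
  link. Monotonicity of \<open>est\<close> keeps a vertex that was found above the threshold there
  until the round ends.\<close>

definition progress :: "nat \<Rightarrow> nat \<Rightarrow> graph_state \<Rightarrow> graph_state \<Rightarrow> bool" where
  "progress E2 k g h \<longleftrightarrow> np h \<le> np g + k \<and> cnt h \<le> cnt g + k \<and>
    card (active E2 h) \<le> card (active E2 g) \<and> (\<forall>v. est g v \<le> est h v) \<and>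
    nx g \<le> nx h \<and> (\<forall>c<nx g. src h c = src g c \<and> dst h c = dst g c)"

lemma progress_refl [simp]: "progress E2 0 g g"
  by (simp add: progress_def)

lemma progress_mono: "progress E2 k g h \<Longrightarrow> k \<le> l \<Longrightarrow> progress E2 l g h"
  by (auto simp: progress_def)

lemma progress_trans:
  assumes "progress E2 k g h" "progress E2 l h j"
  shows "progress E2 (k + l) g j"
  using assms unfolding progress_def by (force intro: order_trans)

lemma progress_insert:
  assumes "arcs_ok N n ls E2 g" "card (active E2 (insert_piece N a b u w x g)) \<le> card (active E2 g)"
  shows "progress E2 1 g (insert_piece N a b u w x g)"
  using add_arc_frame[OF assms(1), where u = u and w = w] assms(2)
  by (simp add: progress_def insert_piece_simps)

text \<open>A sweep as in merging: every iteration moves exactly one of the two pointers, past an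
  arc that is empty or has just been exhausted. If both arcs are exhausted together, the second is
  left for a later iteration.\<close>

definition elim_body :: com where
  "elim_body =
    SetReg rA (Reg rpin) ;;
    SetReg rB (Reg rpout) ;;
    Cond (RLess RZero (RRead 2 (Reg rA)))
      (Cond (RLess RZero (RRead 2 (Reg rB)))
        (Cond (RLess (RRead 2 (Reg rB)) (RRead 2 (Reg rA)))
          (RWrite 6 (INum 2) (RRead 2 (Reg rB)) ;; SetReg rpout (IRead 15 (Reg rB)))
          (RWrite 6 (INum 2) (RRead 2 (Reg rA)) ;; SetReg rpin (IRead 17 (Reg rA))) ;;
         SetReg rU (IRead 8 (Reg rA)) ;;
         SetReg rW (IRead 9 (Reg rB)) ;;
         insert_code)
        (SetReg rpout (IRead 15 (Reg rB))))
      (SetReg rpin (IRead 17 (Reg rA)))"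

definition elim_guard :: bexp where
  "elim_guard = BAnd (ILess (INum 0) (Reg rpin)) (ILess (INum 0) (Reg rpout))"

definition elim_code :: com where
  "elim_code =
    (SetReg rpin (IRead 16 (Reg rv)) ;; SetReg rpout (IRead 14 (Reg rv))) ;;
    While elim_guard elim_body"

lemma loop_free_elim_body: "loop_free elim_body"
  by (simp add: elim_body_def loop_free_insert)

lemma sem_elim_body:
  assumes "rows_ok N \<sigma>" "src (graph_of \<sigma>) (reg \<sigma> rpin) < N"
  defines "a \<equiv> reg \<sigma> rpin" and "b \<equiv> reg \<sigma> rpout" and "g \<equiv> graph_of \<sigma>" and "\<tau> \<equiv> sem elim_body \<sigma>"
  shows "frame \<sigma> \<tau>"
    and "\<not> 0 < vl g a \<Longrightarrow> graph_of \<tau> = g \<and> reg \<tau> rpin = inn g a \<and> reg \<tau> rpout = b"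
    and "0 < vl g a \<Longrightarrow> \<not> 0 < vl g b \<Longrightarrow> graph_of \<tau> = g \<and> reg \<tau> rpin = a \<and> reg \<tau> rpout = on g b"
    and "0 < vl g a \<Longrightarrow> 0 < vl g b \<Longrightarrow> vl g b < vl g a \<Longrightarrow>
      graph_of \<tau> = insert_piece N a b (src g a) (dst g b) (vl g b) g \<and>
      reg \<tau> rpin = a \<and> reg \<tau> rpout = on g b"
    and "0 < vl g a \<Longrightarrow> 0 < vl g b \<Longrightarrow> \<not> vl g b < vl g a \<Longrightarrow>
      graph_of \<tau> = insert_piece N a b (src g a) (dst g b) (vl g a) g \<and>
      reg \<tau> rpin = inn g a \<and> reg \<tau> rpout = b"
proof -
  define \<sigma>1 where "\<sigma>1 = sem
     (SetReg rA (Reg rpin) ;; SetReg rB (Reg rpout) ;;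
      Cond (RLess (RRead 2 (Reg rB)) (RRead 2 (Reg rA)))
          (RWrite 6 (INum 2) (RRead 2 (Reg rB)) ;; SetReg rpout (IRead 15 (Reg rB)))
          (RWrite 6 (INum 2) (RRead 2 (Reg rA)) ;; SetReg rpin (IRead 17 (Reg rA))) ;;
         SetReg rU (IRead 8 (Reg rA)) ;;
         SetReg rW (IRead 9 (Reg rB))) \<sigma>"
  have \<tau>: "\<tau> = sem insert_code \<sigma>1" if "0 < vl g a" "0 < vl g b"
    using that by (simp add: \<tau>_def \<sigma>1_def elim_body_def g_def a_def b_def graph_of_def)
  have 1: "frame \<sigma> \<sigma>1" "graph_of \<sigma>1 = g" "reg \<sigma>1 rA = a" "reg \<sigma>1 rB = b"
    "reg \<sigma>1 rU = src g a" "reg \<sigma>1 rW = dst g b"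
    by (auto simp: \<sigma>1_def frame_def graph_of_def g_def a_def b_def)
  have 2: "xreg \<sigma>1 = (if vl g b < vl g a then vl g b else vl g a)"
    "reg \<sigma>1 rpin = (if vl g b < vl g a then a else inn g a)"
    "reg \<sigma>1 rpout = (if vl g b < vl g a then on g b else b)"
    by (auto simp: \<sigma>1_def graph_of_def g_def a_def b_def)
  have r: "rows_ok N \<sigma>1" "reg \<sigma>1 rU < N"
    using assms(1,2) 1 by (simp_all add: rows_ok_frame a_def g_def)
  note ins = sem_insert[OF r]
  show "frame \<sigma> \<tau>"
  proof (cases "0 < vl g a \<and> 0 < vl g b")
    case True
    then show ?thesis
      using \<tau> 1(1) ins(2) frame_trans by blast
  next
    case False
    then show ?thesis
      by (auto simp: \<tau>_def elim_body_def g_def a_def b_def graph_of_def frame_def)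
  qed
  show "\<not> 0 < vl g a \<Longrightarrow> graph_of \<tau> = g \<and> reg \<tau> rpin = inn g a \<and> reg \<tau> rpout = b"
    "0 < vl g a \<Longrightarrow> \<not> 0 < vl g b \<Longrightarrow> graph_of \<tau> = g \<and> reg \<tau> rpin = a \<and> reg \<tau> rpout = on g b"
    by (auto simp: \<tau>_def elim_body_def g_def a_def b_def graph_of_def)
  show "graph_of \<tau> = insert_piece N a b (src g a) (dst g b) (vl g b) g \<and>
      reg \<tau> rpin = a \<and> reg \<tau> rpout = on g b" if "0 < vl g a" "0 < vl g b" "vl g b < vl g a"
    using \<tau>[OF that(1,2)] ins 1 2 that(3) by simp
  show "graph_of \<tau> = insert_piece N a b (src g a) (dst g b) (vl g a) g \<and>
      reg \<tau> rpin = inn g a \<and> reg \<tau> rpout = b" if "0 < vl g a" "0 < vl g b" "\<not> vl g b < vl g a"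
    using \<tau>[OF that(1,2)] ins 1 2 that(3) by simp
qed

definition elim_cost :: real where
  "elim_cost = real (max_cost elim_body) + bcost elim_guard + 1"

lemma elim_body_step:
  assumes I: "elim_ok Z N n ls E2 base R Dead v xs ys (reg \<sigma> rpin) (reg \<sigma> rpout) (graph_of \<sigma>)"
    and Z: "add_closed Z" and base: "\<forall>c\<ge>E2. base c = 0" and rows: "rows_ok N \<sigma>"
    and guard: "bval elim_guard \<sigma>"
  defines "\<tau> \<equiv> sem elim_body \<sigma>"
  shows "frame \<sigma> \<tau>"
    "\<exists>xs' ys'. elim_ok Z N n ls E2 base R Dead v xs' ys' (reg \<tau> rpin) (reg \<tau> rpout) (graph_of \<tau>) \<and>
      length xs' + length ys' + 1 = length xs + length ys \<and>
      progress E2 1 (graph_of \<sigma>) (graph_of \<tau>)"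
    (is ?thesis2)
proof -
  define g where "g = graph_of \<sigma>"
  define a where "a = reg \<sigma> rpin"
  define b where "b = reg \<sigma> rpout"
  have ab: "0 < a" "0 < b"
    using guard by (auto simp: elim_guard_def a_def b_def)
  obtain xs' where xs: "xs = a # xs'"
    using elim_okD(2)[OF I] chain_neq_0 ab a_def by auto
  obtain ys' where ys: "ys = b # ys'"
    using elim_okD(3)[OF I] chain_neq_0 ab b_def by auto
  have I: "elim_ok Z N n ls E2 base R Dead v (a # xs') (b # ys') a b g"
    using I by (simp add: xs ys a_def b_def g_def)
  note G = graph_okD[OF elim_okD(1)[OF I]]
  have "a \<in> linked g"
    using elim_okD(4)[OF I] by auto
  then have "src g a < N"
    using arcs_okD(1)[OF G(4), of a] arcs_okD(3)[OF G(4), of a] pieces_okD(1)[OF G(1)] by auto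
  note S = sem_elim_body[OF rows, folded a_def b_def g_def \<tau>_def, OF this]
  show "frame \<sigma> \<tau>" by (rule S(1))
  have "\<exists>xs'' ys''. elim_ok Z N n ls E2 base R Dead v xs'' ys'' (reg \<tau> rpin) (reg \<tau> rpout) (graph_of \<tau>) \<and>
      length xs'' + length ys'' + 1 = length (a # xs') + length (b # ys') \<and>
      progress E2 1 g (graph_of \<tau>)"
  proof (cases "0 < vl g a")
    case False
    have "elim_ok Z N n ls E2 base R Dead v xs' (b # ys') (inn g a) b g"
      by (rule elim_skip_in[OF I False])
    then show ?thesis
      using S(2)[OF False] progress_mono[OF progress_refl, of 1]
      by (intro exI[of _ xs'] exI[of _ "b # ys'"]) simp
  next
    case True
    note a0 = this
    show ?thesis
    proof (cases "0 < vl g b")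
      case False
      have "elim_ok Z N n ls E2 base R Dead v (a # xs') ys' a (on g b) g"
        by (rule elim_skip_out[OF I False])
      then show ?thesis
        using S(3)[OF True False] progress_mono[OF progress_refl, of 1]
        by (intro exI[of _ "a # xs'"] exI[of _ ys']) simp
    next
      case True
      show ?thesis
      proof (cases "vl g b < vl g a")
        case lt: True
        note E = elim_piece[OF I Z base True]
        let ?h = "insert_piece N a b (src g a) (dst g b) (vl g b) g"
        have "elim_ok Z N n ls E2 base R Dead v (a # xs') ys' a (on ?h b) ?h"
          by (rule elim_skip_out[OF E(1)]) (use lt E(3) in auto)
        moreover have "on ?h b = on g b"
          using E(5) lt by auto
        moreover have "progress E2 1 g ?h"
          using E(6) lt by (intro progress_insert[OF G(4)]) auto
        ultimately show ?thesis
          using S(4)[OF a0 True lt]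
          by (intro exI[of _ "a # xs'"] exI[of _ ys']) simp
      next
        case ge: False
        note E = elim_piece[OF I Z base a0]
        let ?h = "insert_piece N a b (src g a) (dst g b) (vl g a) g"
        have "elim_ok Z N n ls E2 base R Dead v xs' (b # ys') (inn ?h a) b ?h"
          by (rule elim_skip_in[OF E(1)]) (use ge E(2) in auto)
        moreover have "inn ?h a = inn g a"
          using E(4) ge by auto
        moreover have "progress E2 1 g ?h"
          using E(6) ge by (intro progress_insert[OF G(4)]) auto
        ultimately show ?thesis
          using S(5)[OF a0 True ge]
          by (intro exI[of _ xs'] exI[of _ "b # ys'"]) simp
      qed
    qed
  qed
  then show ?thesis2
    by (simp add: xs ys g_def)
qed

text \<open>Every iteration shortens one of two lists that have \<open>est\<close> entries
  altogether, so elimination is paid for by the length of the lists, empty arcs included.\<close>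

lemma runs_elim:
  assumes G: "graph_ok Z N n ls E2 base R Dead Dead (graph_of \<sigma>)"
    and Z: "add_closed Z" and base: "\<forall>c\<ge>E2. base c = 0" and rows: "rows_ok N \<sigma>"
    and "reg \<sigma> rv \<in> R" and slots: "\<And>c. 2 \<le> c \<Longrightarrow> c < E2 \<Longrightarrow> vl (graph_of \<sigma>) c = 0"
    and circ: "(\<Sum>c<E2. base c * inc (src (graph_of \<sigma>)) (dst (graph_of \<sigma>)) c (reg \<sigma> rv)) = 0"
  defines "v \<equiv> reg \<sigma> rv"
  defines "k \<equiv> est (graph_of \<sigma>) v"
  shows "runs elim_code \<sigma> (elim_cost * (real k + 1) + 10) (\<lambda>\<tau>. frame \<sigma> \<tau> \<and>
    graph_ok Z N n ls E2 base R (insert v Dead) (insert v Dead) (graph_of \<tau>) \<and>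
    (\<forall>c. 2 \<le> c \<and> c < E2 \<longrightarrow> vl (graph_of \<tau>) c = 0) \<and>
    progress E2 k (graph_of \<sigma>) (graph_of \<tau>))"
    (is "runs _ _ _ ?Q")
proof -
  define g where "g = graph_of \<sigma>"
  note G' = graph_okD[OF G]
  obtain xs ys where 0: "elim_ok Z N n ls E2 base R Dead v xs ys (ih g v) (oh g v) g"
    "length xs + length ys = k"
    using elim_start[OF G _ slots] assms(5) unfolding g_def v_def k_def by metis
  define I where "I r \<tau> \<longleftrightarrow> frame \<sigma> \<tau> \<and> (\<exists>xs ys i.
    elim_ok Z N n ls E2 base R Dead v xs ys (reg \<tau> rpin) (reg \<tau> rpout) (graph_of \<tau>) \<and>
    r = elim_cost * real (length xs + length ys) \<and> length xs + length ys + i = k \<and>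
    progress E2 i g (graph_of \<tau>))" for r \<tau>
  have cost: "0 \<le> elim_cost" by (simp add: elim_cost_def)
  define \<sigma>0 where "\<sigma>0 = sem (SetReg rpin (IRead 16 (Reg rv)) ;; SetReg rpout (IRead 14 (Reg rv))) \<sigma>"
  have "frame \<sigma> \<sigma>0" "graph_of \<sigma>0 = g" "reg \<sigma>0 rpin = ih g v" "reg \<sigma>0 rpout = oh g v"
    by (auto simp: \<sigma>0_def frame_def graph_of_def g_def v_def)
  then have I0: "I (elim_cost * real k) \<sigma>0"
    unfolding I_def using 0 progress_refl[of E2 g]
    by (intro conjI exI[of _ xs] exI[of _ ys] exI[of _ 0]) auto
  have while: "runs (While elim_guard elim_body) \<sigma>0 (elim_cost * real k + bcost elim_guard + 1)
    (\<lambda>\<tau>. \<not> bval elim_guard \<tau> \<and> (\<exists>r'. I r' \<tau>))"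
  proof (rule runs_While[of I, OF I0])
    show "0 \<le> r" if "I r \<tau>" for r \<tau>
      using that cost by (auto simp: I_def)
    fix r \<rho> assume "I r \<rho>" and guard: "bval elim_guard \<rho>"
    then obtain xs ys i where *: "frame \<sigma> \<rho>"
      "elim_ok Z N n ls E2 base R Dead v xs ys (reg \<rho> rpin) (reg \<rho> rpout) (graph_of \<rho>)"
      "r = elim_cost * real (length xs + length ys)" "length xs + length ys + i = k"
      "progress E2 i g (graph_of \<rho>)"
      by (auto simp: I_def)
    define \<tau> where "\<tau> = sem elim_body \<rho>"
    have "rows_ok N \<rho>"
      using rows rows_ok_frame[OF *(1)] by simp
    note S = elim_body_step[OF *(2) Z base this guard, folded \<tau>_def]
    obtain xs' ys' where S2:
      "elim_ok Z N n ls E2 base R Dead v xs' ys' (reg \<tau> rpin) (reg \<tau> rpout) (graph_of \<tau>)"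
      "length xs' + length ys' + 1 = length xs + length ys"
      "progress E2 1 (graph_of \<rho>) (graph_of \<tau>)"
      using S(2) by blast
    have "I (elim_cost * real (length xs' + length ys')) \<tau>"
      unfolding I_def
      using frame_trans[OF *(1) S(1)] S2 *(4) progress_trans[OF *(5) S2(3)]
      by (intro conjI exI[of _ xs'] exI[of _ ys'] exI[of _ "i + 1"]) auto
    moreover have "elim_cost * real (length xs' + length ys') + max_cost elim_body +
        bcost elim_guard + 1 \<le> r"
      unfolding *(3) S2(2)[symmetric] by (simp add: elim_cost_def algebra_simps)
    ultimately have "runs elim_body \<rho> (real (max_cost elim_body))
      (\<lambda>\<tau>. \<exists>r'. I r' \<tau> \<and> r' + max_cost elim_body + bcost elim_guard + 1 \<le> r)"
      by (intro runs_loop_free[OF loop_free_elim_body]) (auto simp: \<tau>_def)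
    then show "\<exists>d. runs elim_body \<rho> d (\<lambda>\<tau>. \<exists>r'. I r' \<tau> \<and> r' + d + bcost elim_guard + 1 \<le> r)"
      by blast
  qed
  have "runs elim_code \<sigma> (10 + (elim_cost * real k + bcost elim_guard + 1))
    (\<lambda>\<tau>. \<not> bval elim_guard \<tau> \<and> (\<exists>r'. I r' \<tau>))"
    unfolding elim_code_def
  proof (rule runs_Seq)
    show "runs (SetReg rpin (IRead 16 (Reg rv)) ;; SetReg rpout (IRead 14 (Reg rv))) \<sigma> 10
      (\<lambda>\<rho>. \<rho> = \<sigma>0)"
      by (rule runs_loop_free) (auto simp: \<sigma>0_def)
  qed (use while in simp)
  then show ?thesis
  proof (rule runs_mono)
    show "10 + (elim_cost * real k + bcost elim_guard + 1) \<le> elim_cost * (real k + 1) + 10"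
      by (simp add: elim_cost_def algebra_simps)
    fix \<tau> assume "\<not> bval elim_guard \<tau> \<and> (\<exists>r'. I r' \<tau>)"
    then obtain xs ys i where *: "frame \<sigma> \<tau>" "\<not> bval elim_guard \<tau>"
      "elim_ok Z N n ls E2 base R Dead v xs ys (reg \<tau> rpin) (reg \<tau> rpout) (graph_of \<tau>)"
      "length xs + length ys + i = k" "progress E2 i g (graph_of \<tau>)"
      by (auto simp: I_def)
    have "xs = [] \<or> ys = []"
      using *(2) elim_okD(2,3)[OF *(3)] by (auto simp: elim_guard_def)
    moreover have "(\<Sum>c<E2. base c * inc (src (graph_of \<tau>)) (dst (graph_of \<tau>)) c v) = 0"
    proof -
      have "inc (src (graph_of \<tau>)) (dst (graph_of \<tau>)) c v = inc (src g) (dst g) c v" if "c < E2" for c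
        using *(5) that pieces_okD(2)[OF G'(1)] by (auto simp: progress_def inc_def g_def)
      then show ?thesis using circ by (simp add: g_def v_def)
    qed
    ultimately show "?Q \<tau>"
      using * elim_finish[OF *(3) _ base] elim_okD(8)[OF *(3)] progress_mono[OF *(5), of k]
      by (auto simp: g_def)
  qed
qed

section \<open>One round: rebuilding the lists, choosing the threshold, scanning the
  vertices\<close>

definition clear_body :: com where
  "clear_body =
    IWrite 14 (IRead 7 (Reg ri)) (INum 0) ;; IWrite 16 (IRead 7 (Reg ri)) (INum 0) ;;
    IWrite 18 (IRead 7 (Reg ri)) (INum 0) ;; incr ri"

definition clear_code :: com where
  "clear_code = SetReg ri (INum 0) ;; While (ILess (Reg ri) (Reg rnl)) clear_body"

definition relink_body :: com where
  "relink_body =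
    SetReg rC (IRead 19 (Reg ri)) ;;
    Cond (RLess RZero (RRead 2 (Reg rC))) link_code Skip ;;
    incr ri"

definition relink_code :: com where
  "relink_code =
    (SetReg rold (Reg rcnt) ;; SetReg rcnt (INum 0) ;; SetReg ri (INum 0)) ;;
    While (ILess (Reg ri) (Reg rold)) relink_body"

text \<open>The factor 8 is expressed by repeated doubling, since indices can only be added.\<close>

definition threshold_guard :: bexp where
  "threshold_guard =
    (let c2 = IAdd (Reg rcnt) (Reg rcnt); c4 = IAdd c2 c2 in ILess (Reg racc) (IAdd c4 c4))"

definition threshold_code :: com where
  "threshold_code =
    (SetReg rD (INum 0) ;; SetReg racc (INum 0)) ;;
    While threshold_guard (SetReg racc (IAdd (Reg racc) (Reg rnl)) ;; incr rD)"

definition scan_body :: com where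
  "scan_body =
    (SetReg rv (IRead 7 (Reg ri)) ;; incr ri) ;;
    Cond (BNot (ILess (Reg rD) (IRead 18 (Reg rv)))) elim_code
      (IWrite 7 (Reg rnl) (Reg rv) ;; incr rnl)"

definition scan_code :: com where
  "scan_code =
    (SetReg rold (Reg rnl) ;; SetReg rnl (INum 0) ;; SetReg ri (INum 0)) ;;
    While (ILess (Reg ri) (Reg rold)) scan_body"

definition round_code :: com where
  "round_code = clear_code ;; relink_code ;; threshold_code ;; scan_code"

definition main_frame :: "store \<Rightarrow> store \<Rightarrow> bool" where
  "main_frame \<sigma> \<tau> \<longleftrightarrow>
    (\<forall>k<7. k \<noteq> 5 \<longrightarrow> istore \<tau> k = istore \<sigma> k) \<and>
    (\<forall>r. r = rN \<or> 20 \<le> r \<longrightarrow> reg \<tau> r = reg \<sigma> r) \<and>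
    (\<forall>k. k \<notin> {2, 3, 6} \<longrightarrow> rstore \<tau> k = rstore \<sigma> k)"

lemma main_frame_refl [simp]: "main_frame \<sigma> \<sigma>"
  by (simp add: main_frame_def)

lemma main_frame_trans: "main_frame \<sigma> \<rho> \<Longrightarrow> main_frame \<rho> \<tau> \<Longrightarrow> main_frame \<sigma> \<tau>"
  by (simp add: main_frame_def)

lemma frame_main_frame: "frame \<sigma> \<tau> \<Longrightarrow> main_frame \<sigma> \<tau>"
  unfolding frame_def main_frame_def by auto

lemma rows_ok_main_frame: "main_frame \<sigma> \<tau> \<Longrightarrow> rows_ok N \<tau> = rows_ok N \<sigma>"
  by (simp add: main_frame_def rows_ok_def)

definition same_network :: "graph_state \<Rightarrow> graph_state \<Rightarrow> bool" where
  "same_network g h \<longleftrightarrow> vl h = vl g \<and> src h = src g \<and> dst h = dst g \<and> nx h = nx g \<and>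
    mat h = mat g \<and> pa h = pa g \<and> pb h = pb g \<and> pc h = pc g \<and> px h = px g \<and> np h = np g"

text \<open>Only arcs with flow have to be linked, so between two eliminations the lists may be
  reduced to these.\<close>

lemma graph_ok_relinked:
  assumes G: "graph_ok Z N n ls E2 base R Dead Dead g" and S: "same_network g h"
    and L: "links_ok R' h" "linked h = active E2 g"
  shows "graph_ok Z N n ls E2 base R' Dead Dead h"
proof -
  have "arcs_ok N n ls E2 h"
    using graph_okD(4)[OF G] S L(2) by (auto simp: arcs_ok_def same_network_def active_def)
  moreover have "live_ok E2 Dead Dead h"
    using graph_okD(5)[OF G] S L(2) by (auto simp: live_ok_def same_network_def active_def)
  ultimately show ?thesis
    using G S L(1) by (auto simp: graph_ok_def same_network_def used_dead_def)
qed

lemma active_linked: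
  "graph_ok Z N n ls E2 base R Dead0 Dead g \<Longrightarrow> active E2 g = {c \<in> linked g. 0 < vl g c}"
  by (auto simp: graph_ok_def live_ok_def arcs_ok_def active_def)

text \<open>Only the surviving vertices, listed in array 7, are reset, so that the cost is
  proportional to their number and not to \<open>|V|\<close>.\<close>

lemma runs_clear:
  "runs clear_code \<sigma> (30 * (real (reg \<sigma> rnl) + 1)) (\<lambda>\<tau>. main_frame \<sigma> \<tau> \<and>
    istore \<tau> 7 = istore \<sigma> 7 \<and> reg \<tau> rnl = reg \<sigma> rnl \<and> reg \<tau> rcnt = reg \<sigma> rcnt \<and>
    istore \<tau> 19 = istore \<sigma> 19 \<and> same_network (graph_of \<sigma>) (graph_of \<tau>) \<and>
    (\<forall>v \<in> istore \<sigma> 7 ` {..<reg \<sigma> rnl}.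
      oh (graph_of \<tau>) v = 0 \<and> ih (graph_of \<tau>) v = 0 \<and> est (graph_of \<tau>) v = 0))"
proof -
  define J where "J i \<tau> \<longleftrightarrow> main_frame \<sigma> \<tau> \<and>
    istore \<tau> 7 = istore \<sigma> 7 \<and> reg \<tau> rnl = reg \<sigma> rnl \<and> reg \<tau> rcnt = reg \<sigma> rcnt \<and>
    istore \<tau> 19 = istore \<sigma> 19 \<and> same_network (graph_of \<sigma>) (graph_of \<tau>) \<and> reg \<tau> ri = i \<and>
    (\<forall>v \<in> istore \<sigma> 7 ` {..<i}. istore \<tau> 14 v = 0 \<and> istore \<tau> 16 v = 0 \<and> istore \<tau> 18 v = 0)" for i \<tau>
  have step: "runs clear_body \<tau> 23 (J (Suc i))" if "J i \<tau>" for i \<tau>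
    by (rule runs_loop_free)
      (use that in \<open>auto simp: clear_body_def J_def main_frame_def same_network_def graph_of_def
        lessThan_Suc\<close>)
  have "runs clear_code \<sigma> (4 + (real (reg \<sigma> rnl) *
      (23 + real (bcost (ILess (Reg ri) (Reg rnl))) + 1) + real (bcost (ILess (Reg ri) (Reg rnl))) + 1))
    (J (reg \<sigma> rnl))"
    unfolding clear_code_def
  proof (rule runs_Seq)
    show "runs (SetReg ri (INum 0)) \<sigma> 4 (J 0)"
      by (rule runs_loop_free)
        (auto simp: J_def main_frame_def same_network_def graph_of_def)
    show "runs (While (ILess (Reg ri) (Reg rnl)) clear_body) \<rho> (real (reg \<sigma> rnl) *
      (23 + real (bcost (ILess (Reg ri) (Reg rnl))) + 1) + real (bcost (ILess (Reg ri) (Reg rnl))) + 1)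
      (J (reg \<sigma> rnl))" if "J 0 \<rho>" for \<rho>
      using that
    proof (rule runs_While_count)
      show "runs clear_body \<tau> 23 (J (Suc i))" if "J i \<tau>" for i \<tau>
        by (rule step[OF that])
    qed (auto simp: J_def)
  qed
  then show ?thesis
    by (rule runs_mono) (auto simp: J_def graph_of_def)
qed

text \<open>Array 19 is compacted in place. The write position \<open>rcnt\<close> never overtakes
  the read position \<open>ri\<close>, so the entries still to be read are intact.\<close>

lemma runs_relink:
  assumes G: "graph_ok Z N n ls E2 base R Dead Dead g" and S: "same_network g (graph_of \<sigma>)"
    and al: "istore \<sigma> 19 = al g" "reg \<sigma> rcnt = cnt g"
    and clear: "\<And>v. v \<in> R' \<Longrightarrow>
      oh (graph_of \<sigma>) v = 0 \<and> ih (graph_of \<sigma>) v = 0 \<and> est (graph_of \<sigma>) v = 0"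
  shows "runs relink_code \<sigma> (100 * (real (cnt g) + 1)) (\<lambda>\<tau>. main_frame \<sigma> \<tau> \<and>
    istore \<tau> 7 = istore \<sigma> 7 \<and> reg \<tau> rnl = reg \<sigma> rnl \<and>
    same_network g (graph_of \<tau>) \<and> links_ok R' (graph_of \<tau>) \<and> linked (graph_of \<tau>) = active E2 g)"
    (is "runs _ _ _ ?Q")
proof -
  note G' = graph_okD[OF G]
  have inj: "inj_on (al g) {..<cnt g}" "0 \<notin> linked g"
    using G'(3) by (auto simp: links_ok_def)
  define J where "J i \<tau> \<longleftrightarrow> main_frame \<sigma> \<tau> \<and>
    istore \<tau> 7 = istore \<sigma> 7 \<and> reg \<tau> rnl = reg \<sigma> rnl \<and> reg \<tau> rold = cnt g \<and>
    same_network g (graph_of \<tau>) \<and> reg \<tau> ri = i \<and> reg \<tau> rcnt \<le> i \<and>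
    (\<forall>j\<ge>i. istore \<tau> 19 j = al g j) \<and> links_ok R' (graph_of \<tau>) \<and>
    linked (graph_of \<tau>) = {al g j |j. j < i \<and> 0 < vl g (al g j)}" for i \<tau>
  have step: "runs relink_body \<tau> 81 (J (Suc i))" if J: "J i \<tau>" "i < cnt g" for i \<tau>
  proof (rule runs_loop_free)
    show "loop_free relink_body"
      by (simp add: relink_body_def loop_free_insert)
    show "real (max_cost relink_body) \<le> 81"
      by (simp add: relink_body_def link_code_def)
    define c where "c = al g i"
    define \<tau>1 where "\<tau>1 = sem (SetReg rC (IRead 19 (Reg ri))) \<tau>"
    define \<tau>2 where "\<tau>2 = (if 0 < vl g c then sem link_code \<tau>1 else \<tau>1)"
    have 1: "frame \<tau> \<tau>1" "graph_of \<tau>1 = graph_of \<tau>" "reg \<tau>1 rC = c" "reg \<tau>1 ri = i"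
      using J by (auto simp: \<tau>1_def frame_def graph_of_def J_def c_def)
    have body: "sem relink_body \<tau> = sem (incr ri) \<tau>2"
      using J 1 by (auto simp: relink_body_def \<tau>2_def \<tau>1_def J_def same_network_def graph_of_def)
    have fr: "frame \<tau> \<tau>2"
      using 1 sem_link(2)[of \<tau>1] frame_trans by (auto simp: \<tau>2_def)
    have c: "c \<in> linked g"
      using J(2) by (auto simp: c_def linked_def)
    have "c \<notin> linked (graph_of \<tau>)"
      using J inj_onD[OF inj(1), of i] by (fastforce simp: J_def c_def)
    moreover have "src (graph_of \<tau>) c \<noteq> dst (graph_of \<tau>) c" "c \<noteq> 0"
      using arcs_okD(2)[OF G'(4), of c] arcs_okD(3)[OF G'(4) c] J(1) pieces_okD(1)[OF G'(1)]
      by (auto simp: J_def same_network_def)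
    ultimately have lnk: "links_ok R' (link c (graph_of \<tau>))"
      using J(1) by (intro links_ok_link) (auto simp: J_def)
    have g2: "graph_of \<tau>2 = (if 0 < vl g c then link c (graph_of \<tau>) else graph_of \<tau>)"
      using 1 sem_link(1)[of \<tau>1] by (simp add: \<tau>2_def)
    have links2: "links_ok R' (graph_of \<tau>2)"
      using lnk J(1) by (simp add: g2 J_def)
    have linked2: "linked (graph_of \<tau>2) = {al g j |j. j < Suc i \<and> 0 < vl g (al g j)}"
      using J(1) by (auto simp: g2 linked_link J_def c_def less_Suc_eq)
    have same2: "same_network g (graph_of \<tau>2)"
      using J(1) by (auto simp: g2 J_def same_network_def link_def)
    have al2: "istore \<tau>2 19 = al (graph_of \<tau>2)" "reg \<tau>2 rcnt = cnt (graph_of \<tau>2)"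
      by (simp_all add: graph_of_def)
    have al3: "istore \<tau>2 19 j = al g j" if "Suc i \<le> j" for j
      using J(1) that unfolding al2 g2
      by (auto simp: J_def link_def) (auto simp: graph_of_def)
    have cnt3: "reg \<tau>2 rcnt \<le> Suc i"
      using J(1) unfolding al2 g2 by (auto simp: J_def link_def) (auto simp: graph_of_def)
    have "graph_of (sem (incr ri) \<tau>2) = graph_of \<tau>2"
      by (simp add: graph_of_def)
    then show "J (Suc i) (sem relink_body \<tau>)"
      unfolding body J_def
      using links2 linked2 same2 al3 cnt3 J(1) frame_main_frame[OF fr] frameD[OF fr]
      by (auto simp: J_def main_frame_def)
  qed
  have "runs relink_code \<sigma> (20 + (real (cnt g) *
      (81 + real (bcost (ILess (Reg ri) (Reg rold))) + 1) + real (bcost (ILess (Reg ri) (Reg rold))) + 1))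
    (J (cnt g))"
    unfolding relink_code_def
  proof (rule runs_Seq)
    define \<tau> where "\<tau> = sem (SetReg rold (Reg rcnt) ;; SetReg rcnt (INum 0) ;; SetReg ri (INum 0)) \<sigma>"
    have 1: "linked (graph_of \<tau>) = {}"
      by (simp add: \<tau>_def graph_of_def linked_def)
    have 2: "\<And>v. v \<in> R' \<Longrightarrow>
      oh (graph_of \<tau>) v = 0 \<and> ih (graph_of \<tau>) v = 0 \<and> est (graph_of \<tau>) v = 0"
      using clear by (simp add: \<tau>_def graph_of_def)
    have "cnt (graph_of \<tau>) = 0"
      by (simp add: \<tau>_def graph_of_def)
    then have "links_ok R' (graph_of \<tau>)"
      using 1 2 by (simp add: links_ok_def lists_ok_def)
    then have "J 0 \<tau>"
      using 1 S al by (auto simp: J_def \<tau>_def main_frame_def same_network_def graph_of_def)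
    then show "runs (SetReg rold (Reg rcnt) ;; SetReg rcnt (INum 0) ;; SetReg ri (INum 0)) \<sigma> 20 (J 0)"
      by (intro runs_loop_free) (auto simp: \<tau>_def)
    show "runs (While (ILess (Reg ri) (Reg rold)) relink_body) \<rho> (real (cnt g) *
      (81 + real (bcost (ILess (Reg ri) (Reg rold))) + 1) + real (bcost (ILess (Reg ri) (Reg rold))) + 1)
      (J (cnt g))" if "J 0 \<rho>" for \<rho>
      using that
    proof (rule runs_While_count)
      show "runs relink_body \<tau> 81 (J (Suc i))" if "J i \<tau>" "i < cnt g" for i \<tau>
        by (rule step[OF that])
    qed (auto simp: J_def)
  qed
  then show ?thesis
  proof (rule runs_mono)
    show "20 + (real (cnt g) *
      (81 + real (bcost (ILess (Reg ri) (Reg rold))) + 1) + real (bcost (ILess (Reg ri) (Reg rold))) + 1)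
      \<le> 100 * (real (cnt g) + 1)"
      by simp
    have "{al g j |j. j < cnt g \<and> 0 < vl g (al g j)} = active E2 g"
      unfolding active_linked[OF G] by (auto simp: linked_def)
    then show "?Q \<tau>" if "J (cnt g) \<tau>" for \<tau>
      using that by (auto simp: J_def)
  qed
qed

lemma runs_threshold:
  assumes "0 < reg \<sigma> rnl"
  shows "runs threshold_code \<sigma> (50 * (8 * real (reg \<sigma> rcnt) + 2)) (\<lambda>\<tau>. main_frame \<sigma> \<tau> \<and>
    istore \<tau> 7 = istore \<sigma> 7 \<and> reg \<tau> rnl = reg \<sigma> rnl \<and> graph_of \<tau> = graph_of \<sigma> \<and>
    8 * reg \<sigma> rcnt \<le> reg \<tau> rD * reg \<sigma> rnl \<and>
    reg \<tau> rD * reg \<sigma> rnl \<le> 8 * reg \<sigma> rcnt + reg \<sigma> rnl)"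
proof -
  define m where "m = reg \<sigma> rcnt"
  define l where "l = reg \<sigma> rnl"
  have "0 < l" using assms by (simp add: l_def)
  define d where "d = (LEAST d. 8 * m \<le> d * l)"
  have ex: "8 * m \<le> (8 * m) * l"
    using \<open>0 < l\<close> by simp
  have d1: "8 * m \<le> d * l" unfolding d_def by (rule LeastI, rule ex)
  have d2: "i * l < 8 * m" if "i < d" for i
    using not_less_Least[of i "\<lambda>d. 8 * m \<le> d * l"] that by (simp add: d_def)
  have d3: "d \<le> 8 * m" unfolding d_def by (rule Least_le, rule ex)
  have d4: "d * l \<le> 8 * m + l"
    using d2[of "d - 1"] by (cases d) auto
  define J where "J i \<tau> \<longleftrightarrow> main_frame \<sigma> \<tau> \<and>
    istore \<tau> 7 = istore \<sigma> 7 \<and> reg \<tau> rnl = l \<and> reg \<tau> rcnt = m \<and> graph_of \<tau> = graph_of \<sigma> \<and>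
    reg \<tau> rD = i \<and> reg \<tau> racc = i * l" for i \<tau>
  let ?b = "SetReg racc (IAdd (Reg racc) (Reg rnl)) ;; incr rD"
  have step: "runs ?b \<tau> 15 (J (Suc i))" if "J i \<tau>" for i \<tau>
    by (rule runs_loop_free) (use that in \<open>auto simp: J_def main_frame_def graph_of_def\<close>)
  have "runs threshold_code \<sigma> (10 + (real d * (15 + real (bcost threshold_guard) + 1) +
      bcost threshold_guard + 1)) (J d)"
    unfolding threshold_code_def
  proof (rule runs_Seq)
    show "runs (SetReg rD (INum 0) ;; SetReg racc (INum 0)) \<sigma> 10 (J 0)"
      by (rule runs_loop_free) (auto simp: J_def main_frame_def graph_of_def m_def l_def)
    show "runs (While threshold_guard ?b) \<rho> (real d * (15 + real (bcost threshold_guard) + 1) +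
      bcost threshold_guard + 1) (J d)" if "J 0 \<rho>" for \<rho>
      using that
    proof (rule runs_While_count)
      show "bval threshold_guard \<tau> \<longleftrightarrow> i < d" if "J i \<tau>" "i \<le> d" for i \<tau>
        using that d1 d2[of i] by (cases "i = d") (auto simp: threshold_guard_def J_def Let_def)
    qed (use step in auto)
  qed
  then show ?thesis
  proof (rule runs_mono)
    show "10 + (real d * (15 + real (bcost threshold_guard) + 1) + bcost threshold_guard + 1)
      \<le> 50 * (8 * real (reg \<sigma> rcnt) + 2)"
    proof -
      have "real d \<le> 8 * real (reg \<sigma> rcnt)"
        using d3 by (simp add: m_def)
      then show ?thesis by (simp add: threshold_guard_def Let_def)
    qed
  qed (use d1 d4 in \<open>auto simp: J_def m_def l_def\<close>)
qed

text \<open>The state between two eliminations. The given arcs are empty but keep their endpoints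
  \<open>sd\<close>. Conservation at the original vertices is stated for the unchanging
  \<open>base\<close>; \<open>accounts_balance\<close> transfers it to the current amounts.\<close>

definition main_ok ::
  "real set \<Rightarrow> nat \<Rightarrow> nat \<Rightarrow> nat \<Rightarrow> nat \<Rightarrow> (nat \<Rightarrow> real) \<Rightarrow> (nat \<Rightarrow> nat \<times> nat) \<Rightarrow>
    nat set \<Rightarrow> nat set \<Rightarrow> store \<Rightarrow> bool" where
  "main_ok Z N n ls E2 base sd R Live \<sigma> \<longleftrightarrow>
    graph_ok Z N n ls E2 base R ({..<n} - Live) ({..<n} - Live) (graph_of \<sigma>) \<and>
    (\<forall>c. 2 \<le> c \<and> c < E2 \<longrightarrow> vl (graph_of \<sigma>) c = 0) \<and>
    (\<forall>c<E2. src (graph_of \<sigma>) c = fst (sd c) \<and> dst (graph_of \<sigma>) c = snd (sd c)) \<and>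
    (\<forall>v<n. (\<Sum>c<E2. base c * inc (src (graph_of \<sigma>)) (dst (graph_of \<sigma>)) c v) = 0) \<and>
    rows_ok N \<sigma>"

lemma elim_cost_bound: "0 \<le> elim_cost" "elim_cost \<le> 300"
  by (simp_all add: elim_cost_def elim_body_def elim_guard_def insert_code_def link_code_def)

text \<open>Double counting: a linked arc has only two ends.\<close>

lemma est_sum_le:
  assumes "links_ok R g" "A \<subseteq> R" "finite A"
  shows "(\<Sum>v\<in>A. est g v) \<le> 2 * cnt g"
proof -
  have *: "(\<Sum>v\<in>A. card {c \<in> linked g. h c = v}) \<le> cnt g" for h
  proof -
    have "(\<Sum>v\<in>A. card {c \<in> linked g. h c = v}) = card (\<Union>v\<in>A. {c \<in> linked g. h c = v})"
      using assms(3) by (subst card_UN_disjoint) auto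
    also have "\<dots> \<le> card (linked g)"
      by (intro card_mono) auto
    also have "\<dots> \<le> cnt g"
      unfolding linked_def using card_image_le[of "{..<cnt g}" "al g"] by simp
    finally show ?thesis .
  qed
  have "(\<Sum>v\<in>A. est g v) =
      (\<Sum>v\<in>A. card {c \<in> linked g. src g c = v}) + (\<Sum>v\<in>A. card {c \<in> linked g. dst g c = v})"
    unfolding sum.distrib[symmetric] using assms(1,2)
    by (intro sum.cong) (auto simp: links_ok_def)
  then show ?thesis
    using *[of "src g"] *[of "dst g"] by linarith
qed

text \<open>A vertex is judged by its degree at the moment it is scanned. Each elimination adds at
  most \<open>D\<close> pieces and links; a vertex that is kept stays above \<open>D\<close>, since
  \<open>est\<close> only grows. The list of kept vertices overwrites the front of the list being
  scanned.\<close>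

lemma runs_scan:
  fixes \<sigma> :: store
  defines "LV \<equiv> istore \<sigma> 7" and "l \<equiv> reg \<sigma> rnl" and "D \<equiv> reg \<sigma> rD" and "g \<equiv> graph_of \<sigma>"
  assumes M: "main_ok Z N n ls E2 base sd (LV ` {..<l}) (LV ` {..<l}) \<sigma>"
    and Z: "add_closed Z" and base: "\<forall>c\<ge>E2. base c = 0"
    and LV: "inj_on LV {..<l}" "LV ` {..<l} \<subseteq> {..<n}"
  shows "runs scan_code \<sigma> (400 * (real l * (real D + 1)) + 100) (\<lambda>\<tau>. main_frame \<sigma> \<tau> \<and>
    main_ok Z N n ls E2 base sd (LV ` {..<l}) (istore \<tau> 7 ` {..<reg \<tau> rnl}) \<tau> \<and>
    inj_on (istore \<tau> 7) {..<reg \<tau> rnl} \<and> istore \<tau> 7 ` {..<reg \<tau> rnl} \<subseteq> LV ` {..<l} \<and>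
    reg \<tau> rnl \<le> l \<and> progress E2 (D * (l - reg \<tau> rnl)) g (graph_of \<tau>) \<and>
    (\<forall>j<reg \<tau> rnl. D < est (graph_of \<tau>) (istore \<tau> 7 j)))"
    (is "runs _ _ _ ?Q")
proof -
  define R where "R = LV ` {..<l}"
  define live where "live \<tau> i = istore \<tau> 7 ` {..<reg \<tau> rnl} \<union> LV ` {i..<l}" for \<tau> i
  define J where "J i \<tau> \<longleftrightarrow> main_frame \<sigma> \<tau> \<and> reg \<tau> ri = i \<and> reg \<tau> rold = l \<and> reg \<tau> rD = D \<and>
    reg \<tau> rnl \<le> i \<and> (\<forall>j\<ge>i. istore \<tau> 7 j = LV j) \<and> inj_on (istore \<tau> 7) {..<reg \<tau> rnl} \<and>
    istore \<tau> 7 ` {..<reg \<tau> rnl} \<subseteq> LV ` {..<i} \<and>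
    main_ok Z N n ls E2 base sd R (live \<tau> i) \<tau> \<and>
    progress E2 (D * (i - reg \<tau> rnl)) g (graph_of \<tau>) \<and>
    (\<forall>j<reg \<tau> rnl. D < est (graph_of \<tau>) (istore \<tau> 7 j))" for i \<tau>
  define c where "c = 12 + (elim_cost * (real D + 1) + 20 + 8 + 1)"
  have step: "runs scan_body \<tau> c (J (Suc i))" if J: "J i \<tau>" "i < l" for i \<tau>
  proof -
    define v where "v = LV i"
    define \<tau>1 where "\<tau>1 = sem (SetReg rv (IRead 7 (Reg ri)) ;; incr ri) \<tau>"
    have 1: "main_frame \<tau> \<tau>1" "graph_of \<tau>1 = graph_of \<tau>" "reg \<tau>1 rv = v" "reg \<tau>1 ri = Suc i"
      "reg \<tau>1 rold = l" "reg \<tau>1 rD = D" "reg \<tau>1 rnl = reg \<tau> rnl" "istore \<tau>1 7 = istore \<tau> 7"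
      using J by (auto simp: \<tau>1_def main_frame_def graph_of_def J_def v_def)
    have M1: "main_ok Z N n ls E2 base sd R (live \<tau> i) \<tau>1"
      using J(1) 1(2) rows_ok_main_frame[OF 1(1)] by (auto simp: J_def main_ok_def)
    have vR: "v \<in> R" "v < n"
      using J(2) LV(2) by (auto simp: v_def R_def)
    have new: "v \<notin> LV ` {..<i}" "v \<notin> LV ` {Suc i..<l}"
      using inj_onD[OF LV(1), of i] J(2) by (fastforce simp: v_def)+
    have frame1: "main_frame \<sigma> \<tau>1"
      using J(1) 1(1) main_frame_trans by (auto simp: J_def)
    have split: "{i..<l} = insert i {Suc i..<l}"
      using J(2) by auto
    have live: "live \<tau> i = insert v (istore \<tau> 7 ` {..<reg \<tau> rnl} \<union> LV ` {Suc i..<l})"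
      unfolding live_def split by (auto simp: v_def)
    have "runs scan_body \<tau> (12 + ((elim_cost * (real D + 1) + 20) +
      real (bcost (BNot (ILess (Reg rD) (IRead 18 (Reg rv))))) + 1)) (J (Suc i))"
      unfolding scan_body_def
    proof (rule runs_Seq)
      show "runs (SetReg rv (IRead 7 (Reg ri)) ;; incr ri) \<tau> 12 (\<lambda>\<rho>. \<rho> = \<tau>1)"
        by (rule runs_loop_free) (auto simp: \<tau>1_def)
      fix \<rho> assume "\<rho> = \<tau>1"
      have "runs (Cond (BNot (ILess (Reg rD) (IRead 18 (Reg rv)))) elim_code
          (IWrite 7 (Reg rnl) (Reg rv) ;; incr rnl)) \<tau>1
          (elim_cost * (real D + 1) + 20 + bcost (BNot (ILess (Reg rD) (IRead 18 (Reg rv)))) + 1)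
          (J (Suc i))"
      proof (rule runs_Cond)
        assume "bval (BNot (ILess (Reg rD) (IRead 18 (Reg rv)))) \<tau>1"
        then have le: "est (graph_of \<tau>1) v \<le> D"
          using 1 by (simp add: graph_of_def)
        have "runs elim_code \<tau>1 (elim_cost * (real (est (graph_of \<tau>1) v) + 1) + 10) (\<lambda>\<rho>. frame \<tau>1 \<rho> \<and>
          graph_ok Z N n ls E2 base R (insert v ({..<n} - live \<tau> i)) (insert v ({..<n} - live \<tau> i))
            (graph_of \<rho>) \<and>
          (\<forall>c. 2 \<le> c \<and> c < E2 \<longrightarrow> vl (graph_of \<rho>) c = 0) \<and>
          progress E2 (est (graph_of \<tau>1) v) (graph_of \<tau>1) (graph_of \<rho>))"
          (is "runs _ _ _ ?E")
          using runs_elim[of Z N n ls E2 base R "{..<n} - live \<tau> i" \<tau>1] M1 Z base vR 1(3)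
          by (auto simp: main_ok_def)
        then show "runs elim_code \<tau>1 (elim_cost * (real D + 1) + 20) (J (Suc i))"
        proof (rule runs_mono)
          have "elim_cost * (real (est (graph_of \<tau>1) v) + 1) \<le> elim_cost * (real D + 1)"
            using le elim_cost_bound(1) by (intro mult_left_mono) auto
          then show "elim_cost * (real (est (graph_of \<tau>1) v) + 1) + 10 \<le> elim_cost * (real D + 1) + 20"
            by simp
          fix \<rho> assume *: "?E \<rho>"
          then have fr: "frame \<tau>1 \<rho>" by blast
          have same: "istore \<rho> 7 = istore \<tau> 7" "reg \<rho> rnl = reg \<tau> rnl" "reg \<rho> ri = Suc i"
            "reg \<rho> rold = l" "reg \<rho> rD = D"
            using frameD[OF fr] 1 by auto
          have dead: "insert v ({..<n} - live \<tau> i) = {..<n} - live \<rho> (Suc i)"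
            using vR(2) new J(1) unfolding live by (auto simp: live_def same J_def)
          have E2: "E2 \<le> nx (graph_of \<tau>1)"
            using M1 by (auto simp: main_ok_def graph_ok_def pieces_ok_def)
          have inc: "inc (src (graph_of \<rho>)) (dst (graph_of \<rho>)) c u =
              inc (src (graph_of \<tau>1)) (dst (graph_of \<tau>1)) c u" if "c < E2" for c u
            using * E2 that by (auto simp: progress_def inc_def)
          have sd: "src (graph_of \<rho>) c = fst (sd c) \<and> dst (graph_of \<rho>) c = snd (sd c)" if "c < E2" for c
            using * E2 that M1 by (auto simp: progress_def main_ok_def)
          have M2: "main_ok Z N n ls E2 base sd R (live \<rho> (Suc i)) \<rho>"
            using * M1 inc sd rows_ok_frame[OF fr] by (auto simp: main_ok_def dead)
          have "progress E2 (D * (i - reg \<tau> rnl) + D) g (graph_of \<rho>)"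
            using * J(1) 1(2) progress_mono[OF _ le] progress_trans by (force simp: J_def)
          moreover have "D * (i - reg \<tau> rnl) + D = D * (Suc i - reg \<rho> rnl)"
            using J(1) by (simp add: same J_def Suc_diff_le)
          moreover have "D < est (graph_of \<rho>) (istore \<rho> 7 j)" if "j < reg \<rho> rnl" for j
            using that J(1) * 1(2) by (auto simp: same J_def progress_def intro: less_le_trans)
          ultimately show "J (Suc i) \<rho>"
            using J(1) M2 main_frame_trans[OF frame1 frame_main_frame[OF fr]]
            by (auto simp: J_def same lessThan_Suc)
        qed
      next
        assume "\<not> bval (BNot (ILess (Reg rD) (IRead 18 (Reg rv)))) \<tau>1"
        then have gt: "D < est (graph_of \<tau>1) v"
          using 1 by (simp add: graph_of_def)
        define \<rho> where "\<rho> = sem (IWrite 7 (Reg rnl) (Reg rv) ;; incr rnl) \<tau>1"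
        have same: "main_frame \<tau>1 \<rho>" "graph_of \<rho> = graph_of \<tau>" "reg \<rho> ri = Suc i" "reg \<rho> rold = l"
          "reg \<rho> rD = D" "reg \<rho> rnl = Suc (reg \<tau> rnl)" "istore \<rho> 7 = (istore \<tau> 7)(reg \<tau> rnl := v)"
          using 1 by (auto simp: \<rho>_def main_frame_def graph_of_def)
        have im: "istore \<rho> 7 ` {..<reg \<rho> rnl} = insert v (istore \<tau> 7 ` {..<reg \<tau> rnl})"
          unfolding same by (auto simp: lessThan_Suc)
        have inj: "inj_on (istore \<rho> 7) {..<reg \<rho> rnl}"
          using J(1) new(1) unfolding same lessThan_Suc
          by (auto simp: J_def inj_on_def)
        have "live \<rho> (Suc i) = live \<tau> i"
          unfolding live unfolding live_def im by auto
        then have M2: "main_ok Z N n ls E2 base sd R (live \<rho> (Suc i)) \<rho>"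
          using M1 same(2) 1(2) rows_ok_main_frame[OF same(1)] by (simp add: main_ok_def)
        have est: "D < est (graph_of \<rho>) (istore \<rho> 7 j)" if "j < reg \<rho> rnl" for j
          using that J(1) gt 1(2) by (auto simp: same J_def less_Suc_eq)
        have "J (Suc i) \<rho>"
          using J(1) M2 inj est main_frame_trans[OF frame1 same(1)]
          unfolding J_def im by (auto simp: same J_def lessThan_Suc v_def)
        then show "runs (IWrite 7 (Reg rnl) (Reg rv) ;; incr rnl) \<tau>1
            (elim_cost * (real D + 1) + 20) (J (Suc i))"
          using elim_cost_bound(1) by (intro runs_loop_free) (auto simp: \<rho>_def)
      qed
      then show "runs (Cond (BNot (ILess (Reg rD) (IRead 18 (Reg rv)))) elim_code
          (IWrite 7 (Reg rnl) (Reg rv) ;; incr rnl)) \<rho>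
          (elim_cost * (real D + 1) + 20 + real (bcost (BNot (ILess (Reg rD) (IRead 18 (Reg rv))))) + 1)
          (J (Suc i))"
        by (simp add: \<open>\<rho> = \<tau>1\<close>)
    qed
    then show ?thesis
      by (rule runs_mono) (auto simp: c_def)
  qed
  have "runs scan_code \<sigma> (20 + (real l * (c + real (bcost (ILess (Reg ri) (Reg rold))) + 1) +
      real (bcost (ILess (Reg ri) (Reg rold))) + 1)) (J l)"
    unfolding scan_code_def
  proof (rule runs_Seq)
    define \<tau> where "\<tau> = sem (SetReg rold (Reg rnl) ;; SetReg rnl (INum 0) ;; SetReg ri (INum 0)) \<sigma>"
    have "main_frame \<sigma> \<tau>" "graph_of \<tau> = graph_of \<sigma>"
      by (simp_all add: \<tau>_def main_frame_def graph_of_def)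
    moreover have "live \<tau> 0 = R"
      by (simp add: live_def \<tau>_def R_def atLeast0LessThan)
    ultimately have "J 0 \<tau>"
      using M rows_ok_main_frame[of \<sigma> \<tau>]
      by (simp add: J_def R_def main_ok_def g_def) (simp add: \<tau>_def LV_def l_def D_def)
    then show "runs (SetReg rold (Reg rnl) ;; SetReg rnl (INum 0) ;; SetReg ri (INum 0)) \<sigma> 20 (J 0)"
      by (intro runs_loop_free) (auto simp: \<tau>_def)
    show "runs (While (ILess (Reg ri) (Reg rold)) scan_body) \<rho>
      (real l * (c + real (bcost (ILess (Reg ri) (Reg rold))) + 1) +
      real (bcost (ILess (Reg ri) (Reg rold))) + 1) (J l)" if "J 0 \<rho>" for \<rho>
      using that
    proof (rule runs_While_count)
      show "runs scan_body \<tau> c (J (Suc i))" if "J i \<tau>" "i < l" for i \<tau>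
        by (rule step[OF that])
    qed (use elim_cost_bound in \<open>auto simp: J_def c_def\<close>)
  qed
  then show ?thesis
  proof (rule runs_mono)
    have "elim_cost * (real D + 1) \<le> 300 * (real D + 1)"
      using elim_cost_bound(2) by (intro mult_right_mono) auto
    then have "c + real (bcost (ILess (Reg ri) (Reg rold))) + 1 \<le> 300 * (real D + 1) + 50"
      by (simp add: c_def)
    also have "\<dots> \<le> 400 * (real D + 1)"
      by simp
    finally have "real l * (c + real (bcost (ILess (Reg ri) (Reg rold))) + 1)
        \<le> real l * (400 * (real D + 1))"
      by (intro mult_left_mono) auto
    then show "20 + (real l * (c + real (bcost (ILess (Reg ri) (Reg rold))) + 1) +
      real (bcost (ILess (Reg ri) (Reg rold))) + 1) \<le> 400 * (real l * (real D + 1)) + 100"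
      by (simp add: algebra_simps)
    fix \<tau> assume J: "J l \<tau>"
    have "live \<tau> l = istore \<tau> 7 ` {..<reg \<tau> rnl}"
      by (simp add: live_def)
    then show "?Q \<tau>"
      using J unfolding J_def R_def by simp
  qed
qed

text \<open>Clearing costs \<open>O(l)\<close>, relinking \<open>O(cnt g)\<close>, the threshold
  \<open>O(m)\<close>, and the scan \<open>O(l * (D + 1))\<close>, which is \<open>O(m + l)\<close>
  by the choice of \<open>D\<close>.\<close>

lemma runs_round:
  fixes \<sigma> :: store and E2 :: nat
  defines "l \<equiv> reg \<sigma> rnl" and "g \<equiv> graph_of \<sigma>"
  defines "L \<equiv> istore \<sigma> 7 ` {..<l}" and "m \<equiv> card (active E2 g)"
  assumes M: "main_ok Z N n ls E2 base sd R L \<sigma>"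
    and Z: "add_closed Z" and base: "\<forall>c\<ge>E2. base c = 0"
    and LV: "inj_on (istore \<sigma> 7) {..<l}" "L \<subseteq> {..<n}" and "0 < l"
  shows "runs round_code \<sigma> (5000 * (real l + real (cnt g) + real m)) (\<lambda>\<tau>. main_frame \<sigma> \<tau> \<and>
    main_ok Z N n ls E2 base sd L (istore \<tau> 7 ` {..<reg \<tau> rnl}) \<tau> \<and>
    inj_on (istore \<tau> 7) {..<reg \<tau> rnl} \<and> istore \<tau> 7 ` {..<reg \<tau> rnl} \<subseteq> {..<n} \<and>
    4 * reg \<tau> rnl \<le> 3 * l \<and> cnt (graph_of \<tau>) \<le> 9 * m + l \<and>
    np (graph_of \<tau>) \<le> np g + 8 * m + l \<and> card (active E2 (graph_of \<tau>)) \<le> m)"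
    (is "runs _ _ _ ?Q")
proof -
  have G: "graph_ok Z N n ls E2 base R ({..<n} - L) ({..<n} - L) g"
    using M by (simp add: main_ok_def g_def)
  define Q1 where "Q1 \<tau> \<longleftrightarrow> main_frame \<sigma> \<tau> \<and>
    istore \<tau> 7 = istore \<sigma> 7 \<and> reg \<tau> rnl = l \<and> reg \<tau> rcnt = cnt g \<and>
    istore \<tau> 19 = al g \<and> same_network g (graph_of \<tau>) \<and>
    (\<forall>v \<in> L. oh (graph_of \<tau>) v = 0 \<and> ih (graph_of \<tau>) v = 0 \<and> est (graph_of \<tau>) v = 0)" for \<tau>
  define Q2 where "Q2 \<tau> \<longleftrightarrow> main_frame \<sigma> \<tau> \<and>
    istore \<tau> 7 = istore \<sigma> 7 \<and> reg \<tau> rnl = l \<and> reg \<tau> rcnt = m \<and>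
    active E2 (graph_of \<tau>) = active E2 g \<and> np (graph_of \<tau>) = np g \<and>
    main_ok Z N n ls E2 base sd L L \<tau>" for \<tau>
  define Q3 where "Q3 \<tau> \<longleftrightarrow> Q2 \<tau> \<and> 8 * m \<le> reg \<tau> rD * l \<and> reg \<tau> rD * l \<le> 8 * m + l" for \<tau>
  have 1: "runs clear_code \<sigma> (30 * (real l + 1)) Q1"
    using runs_clear[of \<sigma>]
    by (rule runs_mono) (auto simp: Q1_def l_def g_def L_def graph_of_def)
  have 2: "runs relink_code \<rho> (100 * (real (cnt g) + 1)) Q2" if Q: "Q1 \<rho>" for \<rho>
  proof (rule runs_mono)
    show "runs relink_code \<rho> (100 * (real (cnt g) + 1)) (\<lambda>\<tau>. main_frame \<rho> \<tau> \<and>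
      istore \<tau> 7 = istore \<rho> 7 \<and> reg \<tau> rnl = reg \<rho> rnl \<and>
      same_network g (graph_of \<tau>) \<and> links_ok L (graph_of \<tau>) \<and> linked (graph_of \<tau>) = active E2 g)"
      (is "runs _ _ _ ?P") by (rule runs_relink[OF G]) (use Q in \<open>auto simp: Q1_def\<close>)
    fix \<tau> assume *: "?P \<tau>"
    have fr: "main_frame \<sigma> \<tau>"
      using * Q main_frame_trans by (auto simp: Q1_def)
    have "graph_ok Z N n ls E2 base L ({..<n} - L) ({..<n} - L) (graph_of \<tau>)"
      using graph_ok_relinked[OF G] * by blast
    then have "main_ok Z N n ls E2 base sd L L \<tau>"
      using M * rows_ok_main_frame[OF fr] by (auto simp: main_ok_def same_network_def g_def)
    moreover have "m = cnt (graph_of \<tau>)"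
    proof -
      have "inj_on (al (graph_of \<tau>)) {..<cnt (graph_of \<tau>)}"
        using * by (auto simp: links_ok_def)
      then have "card (linked (graph_of \<tau>)) = cnt (graph_of \<tau>)"
        by (simp add: linked_def card_image)
      then show ?thesis using * by (simp add: m_def)
    qed
    ultimately show "Q2 \<tau>"
      using * Q fr by (auto simp: Q1_def Q2_def active_def same_network_def) (simp_all add: graph_of_def)
  qed simp
  have 3: "runs threshold_code \<rho> (50 * (8 * real m + 2)) Q3" if Q: "Q2 \<rho>" for \<rho>
  proof (rule runs_mono)
    show "runs threshold_code \<rho> (50 * (8 * real m + 2)) (\<lambda>\<tau>. main_frame \<rho> \<tau> \<and>
      istore \<tau> 7 = istore \<rho> 7 \<and> reg \<tau> rnl = l \<and> graph_of \<tau> = graph_of \<rho> \<and>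
      8 * m \<le> reg \<tau> rD * l \<and> reg \<tau> rD * l \<le> 8 * m + l)"
      (is "runs _ _ _ ?P") using runs_threshold[of \<rho>] \<open>0 < l\<close> Q by (simp add: Q2_def)
    fix \<tau> assume *: "?P \<tau>"
    then have "reg \<tau> rcnt = reg \<rho> rcnt"
      by (simp add: graph_of_def)
    moreover have "main_ok Z N n ls E2 base sd L L \<tau>"
      using * Q rows_ok_main_frame[of \<rho> \<tau> N] by (auto simp: main_ok_def Q2_def)
    ultimately show "Q3 \<tau>"
      using * Q main_frame_trans[of \<sigma> \<rho> \<tau>] by (auto simp: Q3_def Q2_def)
  qed simp
  have 4: "runs scan_code \<rho> (400 * (8 * real m + 2 * real l) + 100) ?Q" if Q: "Q3 \<rho>" for \<rho>
  proof -
    define D where "D = reg \<rho> rD"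
    define h where "h = graph_of \<rho>"
    have D: "8 * m \<le> D * l" "D * l \<le> 8 * m + l"
      using Q by (auto simp: Q3_def D_def)
    have h: "cnt h = m" "np h = np g" "active E2 h = active E2 g"
      using Q by (auto simp: Q3_def Q2_def h_def) (simp add: graph_of_def)
    have "runs scan_code \<rho> (400 * (real l * (real D + 1)) + 100) (\<lambda>\<tau>. main_frame \<rho> \<tau> \<and>
      main_ok Z N n ls E2 base sd L (istore \<tau> 7 ` {..<reg \<tau> rnl}) \<tau> \<and>
      inj_on (istore \<tau> 7) {..<reg \<tau> rnl} \<and> istore \<tau> 7 ` {..<reg \<tau> rnl} \<subseteq> L \<and>
      reg \<tau> rnl \<le> l \<and> progress E2 (D * (l - reg \<tau> rnl)) h (graph_of \<tau>) \<and>
      (\<forall>j<reg \<tau> rnl. D < est (graph_of \<tau>) (istore \<tau> 7 j)))"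
      (is "runs _ _ _ ?P") using runs_scan[of Z N n ls E2 base sd \<rho>] Q Z base LV
      by (simp add: Q3_def Q2_def L_def D_def h_def)
    then show ?thesis
    proof (rule runs_mono)
      have "real l * (real D + 1) = real (D * l + l)"
        by (simp add: algebra_simps)
      also have "\<dots> \<le> real (8 * m + 2 * l)"
        using D(2) by (intro of_nat_mono) simp
      finally show "400 * (real l * (real D + 1)) + 100 \<le> 400 * (8 * real m + 2 * real l) + 100"
        by simp
      fix \<tau> assume *: "?P \<tau>"
      define l' where "l' = reg \<tau> rnl"
      define e where "e = l - l'"
      have l: "l = l' + e"
        using * by (simp add: e_def l'_def)
      have cnt: "cnt (graph_of \<tau>) \<le> m + D * e" "np (graph_of \<tau>) \<le> np g + D * e"
        "card (active E2 (graph_of \<tau>)) \<le> m"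
        using * h by (auto simp: progress_def e_def l'_def m_def)
      \<comment> \<open>At most \<open>D\<close> links and pieces arise for each of the
        \<open>e \<le> l\<close> eliminated vertices; this yields the bounds
        \<open>9 * m + l\<close> for the links and \<open>8 * m + l\<close> for the new
        pieces.\<close>
      have De: "D * e \<le> 8 * m + l"
        using D(2) l by (simp add: distrib_left)
      have "(D + 1) * l' = (\<Sum>j<l'. D + 1)"
        by simp
      also have "\<dots> \<le> (\<Sum>j<l'. est (graph_of \<tau>) (istore \<tau> 7 j))"
        using * by (intro sum_mono) (simp add: l'_def Suc_leI)
      also have "\<dots> = (\<Sum>v\<in>istore \<tau> 7 ` {..<l'}. est (graph_of \<tau>) v)"
        using * by (simp add: sum.reindex l'_def)
      also have "\<dots> \<le> 2 * cnt (graph_of \<tau>)"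
        using * by (intro est_sum_le[of L]) (auto simp: main_ok_def graph_ok_def l'_def)
      finally have "(D + 1) * l' \<le> 2 * (m + D * e)"
        by (rule order_trans) (use cnt(1) in simp)
      \<comment> \<open>This decides the factor 8. Suppose \<open>3 * e < l'\<close>. The kept
        vertices have degree above \<open>D\<close>, so
        \<open>D * l' + l' \<le> 2 * m + 2 * (D * e)\<close>. Here \<open>2 * m\<close> is at most a
        third of \<open>D * l'\<close> by the choice of \<open>D\<close>, and
        \<open>2 * (D * e)\<close> at most two thirds. Hence
        \<open>D * l' + l' \<le> D * l'\<close>, although \<open>l'\<close> is positive.\<close>
      have "4 * l' \<le> 3 * l"
      proof (rule ccontr)
        assume "\<not> 4 * l' \<le> 3 * l"
        then have "3 * e + 1 \<le> l'"
          using l by simp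
        then have "D * (3 * e) \<le> D * l'"
          by (intro mult_le_mono2) simp
        then have "3 * (D * e) \<le> D * l'"
          by (simp only: mult.left_commute)
        moreover have "8 * m \<le> D * l' + D * e"
          using D(1) l by (simp add: distrib_left)
        moreover have "D * l' + l' \<le> 2 * m + 2 * (D * e)"
          using \<open>(D + 1) * l' \<le> 2 * (m + D * e)\<close> by (simp add: algebra_simps)
        ultimately show False
          using \<open>3 * e + 1 \<le> l'\<close> by linarith
      qed
      then show "?Q \<tau>"
        using * cnt De LV(2) main_frame_trans[of \<sigma> \<rho> \<tau>] Q
        by (auto simp: Q3_def Q2_def l'_def)
    qed
  qed
  have "runs round_code \<sigma> (30 * (real l + 1) + (100 * (real (cnt g) + 1) +
      (50 * (8 * real m + 2) + (400 * (8 * real m + 2 * real l) + 100)))) ?Q"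
    unfolding round_code_def
    by (rule runs_Seq[OF 1], rule runs_Seq[OF 2], assumption, rule runs_Seq[OF 3], assumption,
        rule 4)
  then show ?thesis
    by (rule runs_mono) (use \<open>0 < l\<close> in auto)
qed

section \<open>Amortised analysis of the rounds\<close>

lemma card_active_le:
  assumes G: "graph_ok Z N n ls E2 base R ({..<n} - L) ({..<n} - L) g" and L: "L \<subseteq> {..<n}"
  shows "card (active E2 g) \<le> (card L + (N - n))\<^sup>2"
proof -
  note G' = graph_okD[OF G]
  \<comment> \<open>Arcs with flow have their ends among the surviving and the \<open>N - n\<close>
    new vertices, and the matrix rules out parallel arcs.\<close>
  define U where "U = L \<union> {n..<N}"
  have U: "finite U" "card U \<le> card L + (N - n)"
    using L finite_subset[OF L] card_Un_le[of L "{n..<N}"] by (auto simp: U_def)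
  have "(\<lambda>c. (src g c, dst g c)) ` active E2 g \<subseteq> U \<times> U"
  proof
    fix p assume "p \<in> (\<lambda>c. (src g c, dst g c)) ` active E2 g"
    then obtain c where c: "p = (src g c, dst g c)" "E2 \<le> c" "c < nx g" "0 < vl g c"
      by (auto simp: active_def)
    have "src g c < N" "dst g c < N"
      using arcs_okD(1)[OF G'(4), of c] c pieces_okD(1)[OF G'(1)] by auto
    moreover have "src g c \<notin> {..<n} - L" "dst g c \<notin> {..<n} - L"
      using live_okD(3,4)[OF G'(5) c(2,3)] c(4) by auto
    ultimately show "p \<in> U \<times> U"
      by (auto simp: c(1) U_def)
  qed
  moreover have "inj_on (\<lambda>c. (src g c, dst g c)) (active E2 g)"
  proof (rule inj_onI)
    fix c c' assume c: "c \<in> active E2 g" "c' \<in> active E2 g"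
      and eq: "(src g c, dst g c) = (src g c', dst g c')"
    have *: "mat g (src g e * N + dst g e) = e" if "e \<in> active E2 g" for e
      using arcs_okD(2)[OF G'(4), of e] that unfolding active_def by blast
    have "mat g (src g c * N + dst g c) = mat g (src g c' * N + dst g c')"
      using eq by simp
    then show "c = c'"
      unfolding *[OF c(1)] *[OF c(2)] .
  qed
  ultimately have "card (active E2 g) \<le> card (U \<times> U)"
    using U(1) by (metis card_image card_mono finite_cartesian_product)
  also have "\<dots> \<le> (card L + (N - n))\<^sup>2"
    using U(2) by (simp add: card_cartesian_product power2_eq_square mult_le_mono)
  finally show ?thesis .
qed

text \<open>With \<open>y = q * l\<^sup>2 / E\<close>, shrinking \<open>l\<close> to three quarters
  takes \<open>y\<close> to at most \<open>9 / 16 * y\<close>. By \<open>ln z \<le> z - 1\<close>,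
  the value \<open>ln (1 + y)\<close> falls by at least \<open>7 / 16 * y / (1 + y)\<close>, which
  is at least \<open>7 / 32 * min 1 y\<close>; and \<open>m \<le> E * min 1 y\<close>.\<close>

lemma ln_drop:
  fixes E q l l' m :: real
  assumes "0 < E" "0 \<le> q" "0 \<le> l'" "4 * l' \<le> 3 * l" "0 \<le> m" "m \<le> E" "m \<le> q * l\<^sup>2"
  shows "7 * m / 32 \<le> E * ln (1 + q * l\<^sup>2 / E) - E * ln (1 + q * l'\<^sup>2 / E)"
proof -
  define y where "y = q * l\<^sup>2 / E"
  define y' where "y' = q * l'\<^sup>2 / E"
  have y: "0 \<le> y" "0 \<le> y'"
    using assms by (auto simp: y_def y'_def)
  have "l'\<^sup>2 \<le> (3 / 4 * l)\<^sup>2"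
    using assms by (intro power_mono) auto
  then have "q * l'\<^sup>2 / E \<le> q * (3 / 4 * l)\<^sup>2 / E"
    using assms by (intro divide_right_mono mult_left_mono) auto
  then have y': "y' \<le> 9 / 16 * y"
    by (simp add: y_def y'_def power_mult_distrib power_divide)
  have "min 1 y * (1 + y) \<le> 2 * y"
    using y by (cases "y \<le> 1") (auto simp: min_def algebra_simps mult_left_le)
  then have "7 / 32 * min 1 y * (1 + y) \<le> 1 + y - (1 + 9 / 16 * y)"
    by (simp add: algebra_simps)
  also have "\<dots> \<le> 1 + y - (1 + y')"
    using y' by simp
  finally have "7 / 32 * min 1 y \<le> 1 - (1 + y') / (1 + y)"
    using y by (simp add: field_simps)
  also have "\<dots> \<le> - ln ((1 + y') / (1 + y))"
    using ln_le_minus_one[of "(1 + y') / (1 + y)"] y by simp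
  also have "\<dots> = ln (1 + y) - ln (1 + y')"
    using y by (subst ln_div) auto
  finally have 1: "7 / 32 * min 1 y \<le> ln (1 + y) - ln (1 + y')" .
  have "m \<le> E * y"
    using assms(1,7) by (simp add: y_def)
  then have "m \<le> E * min 1 y"
    using assms(6) by (simp add: min_def)
  then have "7 * m / 32 \<le> E * (7 / 32 * min 1 y)"
    by simp
  also have "\<dots> \<le> E * (ln (1 + y) - ln (1 + y'))"
    using 1 assms(1) by (intro mult_left_mono) auto
  finally show ?thesis
    by (simp add: y_def y'_def right_diff_distrib)
qed

definition main_code :: com where
  "main_code = While (ILess (INum 0) (Reg rnl)) round_code"

text \<open>A round spends at most \<open>5000 * (l + c + m) + 10\<close>. The share of
  \<open>c\<close> is paid by the first term. The second term releases \<open>10020 * l\<close>,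
  which covers \<open>5000 * l\<close>, the 10, and \<open>5010 * l\<close> of renewed credit for
  links. The third releases more than \<open>54700 * m\<close>, which covers \<open>5000 * m\<close>
  and the remaining \<open>9 * 5010 * m\<close> of renewed credit.\<close>

definition potential :: "nat \<Rightarrow> nat \<Rightarrow> nat \<Rightarrow> nat \<Rightarrow> real" where
  "potential E k c l = 5010 * real c + 40080 * real l +
    250500 * (real E * ln (1 + (real k + 1)\<^sup>2 * (real l)\<^sup>2 / real E))"

lemma potential_nonneg: "0 \<le> potential E k c l"
  unfolding potential_def by (cases "E = 0") (auto intro!: add_nonneg_nonneg mult_nonneg_nonneg)

lemma potential_drop:
  assumes "0 < E" "0 < l" "4 * l' \<le> 3 * l" "c' \<le> 9 * m + l" "m \<le> E" "m \<le> (l + k)\<^sup>2"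
  shows "potential E k c' l' + 5000 * (real l + real c + real m) + 10 \<le> potential E k c l"
proof -
  \<comment> \<open>The bound has to be a multiple of \<open>l\<^sup>2\<close> for
    \<open>ln_drop\<close>; \<open>l + k \<le> (k + 1) * l\<close> because \<open>l\<close> is
    positive.\<close>
  have "m \<le> ((k + 1) * l)\<^sup>2"
  proof -
    have "k \<le> k * l"
      using assms(2) by simp
    then have "l + k \<le> (k + 1) * l" by simp
    then show ?thesis
      using assms(6) power_mono[of "l + k" "(k + 1) * l" 2] by linarith
  qed
  then have "real m \<le> real (((k + 1) * l)\<^sup>2)"
    by (rule of_nat_mono)
  then have "real m \<le> (real k + 1)\<^sup>2 * (real l)\<^sup>2"
    by (simp only: of_nat_power of_nat_mult power_mult_distrib of_nat_add of_nat_1)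
  moreover have "4 * real l' \<le> 3 * real l" "real m \<le> real E" "real c' \<le> 9 * real m + real l"
    using assms by linarith+
  ultimately have "7 * real m / 32 \<le> real E * ln (1 + (real k + 1)\<^sup>2 * (real l)\<^sup>2 / real E) -
      real E * ln (1 + (real k + 1)\<^sup>2 * (real l')\<^sup>2 / real E)"
    (is "_ \<le> ?A - ?A'") using assms(1) by (intro ln_drop) auto
  then have "250500 * ?A' + 54700 * real m \<le> 250500 * ?A"
    by simp
  moreover have "5010 * real c' \<le> 45090 * real m + 5010 * real l"
    "40080 * real l' \<le> 30060 * real l" "1 \<le> real l"
    using \<open>4 * real l' \<le> 3 * real l\<close> \<open>real c' \<le> 9 * real m + real l\<close> assms(2) by simp_all
  moreover have "5000 * (real l + real c + real m) = 5000 * real l + 5000 * real c + 5000 * real m"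
    by simp
  ultimately show ?thesis
    unfolding potential_def by linarith
qed

text \<open>The invariant adds the number of pieces to the credit: a round adds at most
  \<open>8 * m + l\<close> pieces and spends more than that. So the potential also bounds the number
  of pieces that have to be undone later.\<close>

lemma runs_main:
  fixes \<sigma> :: store and E N n :: nat
  defines "L \<equiv> istore \<sigma> 7 ` {..<reg \<sigma> rnl}" and "g \<equiv> graph_of \<sigma>"
  defines "B \<equiv> potential E (N - n) (cnt g) (reg \<sigma> rnl)"
  assumes M: "main_ok Z N n ls E2 base sd R L \<sigma>"
    and Z: "add_closed Z" and base: "\<forall>c\<ge>E2. base c = 0"
    and LV: "inj_on (istore \<sigma> 7) {..<reg \<sigma> rnl}" "L \<subseteq> {..<n}"
    and E: "0 < E" "card (active E2 g) \<le> E"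
  shows "runs main_code \<sigma> (B + 5) (\<lambda>\<tau>. main_frame \<sigma> \<tau> \<and>
    (\<exists>R. main_ok Z N n ls E2 base sd R {} \<tau>) \<and> real (np (graph_of \<tau>)) \<le> real (np g) + B)"
    (is "runs _ _ _ ?Q")
proof -
  define I where "I r \<tau> \<longleftrightarrow> main_frame \<sigma> \<tau> \<and>
    (\<exists>R. main_ok Z N n ls E2 base sd R (istore \<tau> 7 ` {..<reg \<tau> rnl}) \<tau>) \<and>
    inj_on (istore \<tau> 7) {..<reg \<tau> rnl} \<and> istore \<tau> 7 ` {..<reg \<tau> rnl} \<subseteq> {..<n} \<and>
    card (active E2 (graph_of \<tau>)) \<le> E \<and>
    r = potential E (N - n) (cnt (graph_of \<tau>)) (reg \<tau> rnl) \<and>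
    real (np (graph_of \<tau>)) + r \<le> real (np g) + B" for r \<tau>
  have "runs main_code \<sigma> (B + bcost (ILess (INum 0) (Reg rnl)) + 1)
    (\<lambda>\<tau>. \<not> bval (ILess (INum 0) (Reg rnl)) \<tau> \<and> (\<exists>r'. I r' \<tau>))"
    unfolding main_code_def
  proof (rule runs_While)
    show "I B \<sigma>"
      using M LV E unfolding I_def L_def B_def g_def by auto
    show "0 \<le> r" if "I r \<tau>" for r \<tau>
      using that potential_nonneg by (auto simp: I_def)
    fix r \<rho> assume I: "I r \<rho>" and "bval (ILess (INum 0) (Reg rnl)) \<rho>"
    then have pos: "0 < reg \<rho> rnl" by simp
    obtain R where M: "main_ok Z N n ls E2 base sd R (istore \<rho> 7 ` {..<reg \<rho> rnl}) \<rho>"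
      using I by (auto simp: I_def)
    define l where "l = reg \<rho> rnl"
    define h where "h = graph_of \<rho>"
    define m where "m = card (active E2 h)"
    have "card (istore \<rho> 7 ` {..<l}) = l"
      using I by (simp add: I_def card_image l_def)
    then have m2: "m \<le> (l + (N - n))\<^sup>2"
      using card_active_le[of Z N n ls E2 base R "istore \<rho> 7 ` {..<l}" h] M I
      by (auto simp: main_ok_def I_def m_def h_def l_def)
    have "runs round_code \<rho> (5000 * (real l + real (cnt h) + real m))
      (\<lambda>\<tau>. \<exists>r'. I r' \<tau> \<and> r' + 5000 * (real l + real (cnt h) + real m) +
        bcost (ILess (INum 0) (Reg rnl)) + 1 \<le> r)"
    proof (rule runs_mono[OF runs_round[OF M Z base]])
      show "inj_on (istore \<rho> 7) {..<reg \<rho> rnl}" "istore \<rho> 7 ` {..<reg \<rho> rnl} \<subseteq> {..<n}"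
        using I by (auto simp: I_def)
      show "0 < reg \<rho> rnl" by (rule pos)
      show "5000 * (real (reg \<rho> rnl) + real (cnt (graph_of \<rho>)) + real (card (active E2 (graph_of \<rho>))))
        \<le> 5000 * (real l + real (cnt h) + real m)"
        by (simp add: l_def h_def m_def)
      fix \<tau>
      assume *: "main_frame \<rho> \<tau> \<and>
        main_ok Z N n ls E2 base sd (istore \<rho> 7 ` {..<reg \<rho> rnl}) (istore \<tau> 7 ` {..<reg \<tau> rnl}) \<tau> \<and>
        inj_on (istore \<tau> 7) {..<reg \<tau> rnl} \<and> istore \<tau> 7 ` {..<reg \<tau> rnl} \<subseteq> {..<n} \<and>
        4 * reg \<tau> rnl \<le> 3 * reg \<rho> rnl \<and>
        cnt (graph_of \<tau>) \<le> 9 * card (active E2 (graph_of \<rho>)) + reg \<rho> rnl \<and>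
        np (graph_of \<tau>) \<le> np (graph_of \<rho>) + 8 * card (active E2 (graph_of \<rho>)) + reg \<rho> rnl \<and>
        card (active E2 (graph_of \<tau>)) \<le> card (active E2 (graph_of \<rho>))"
      define r' where "r' = potential E (N - n) (cnt (graph_of \<tau>)) (reg \<tau> rnl)"
      have r: "r = potential E (N - n) (cnt h) l" "m \<le> E"
        using I by (auto simp: I_def h_def l_def m_def)
      have drop: "r' + 5000 * (real l + real (cnt h) + real m) + 10 \<le> r"
        unfolding r r'_def using * pos m2 r(2) E(1)
        by (intro potential_drop) (auto simp: l_def h_def m_def)
      moreover have "real (np (graph_of \<tau>)) \<le> real (np h) + 8 * real m + real l"
        using * unfolding h_def m_def l_def by linarith
      moreover have "real (np h) + r \<le> real (np g) + B"
        using I by (simp add: I_def h_def)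
      moreover have "8 * real m + real l \<le> 5000 * (real l + real (cnt h) + real m) + 10"
        by simp
      ultimately have "real (np (graph_of \<tau>)) + r' \<le> real (np g) + B"
        by linarith
      moreover have "main_frame \<sigma> \<tau>"
        using I * main_frame_trans by (auto simp: I_def)
      ultimately have "I r' \<tau>"
        using * r(2) by (auto simp: I_def r'_def m_def h_def)
      then show "\<exists>r'. I r' \<tau> \<and> r' + 5000 * (real l + real (cnt h) + real m) +
        bcost (ILess (INum 0) (Reg rnl)) + 1 \<le> r"
        using drop by (intro exI[of _ r']) simp
    qed
    then show "\<exists>d. runs round_code \<rho> d
      (\<lambda>\<tau>. \<exists>r'. I r' \<tau> \<and> r' + d + bcost (ILess (INum 0) (Reg rnl)) + 1 \<le> r)" by blast
  qed
  then show ?thesis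
  proof (rule runs_mono)
    fix \<tau> assume "\<not> bval (ILess (INum 0) (Reg rnl)) \<tau> \<and> (\<exists>r'. I r' \<tau>)"
    then obtain r where "reg \<tau> rnl = 0" "I r \<tau>" by auto
    moreover from this have "0 \<le> r"
      using potential_nonneg by (auto simp: I_def)
    ultimately show "?Q \<tau>"
      by (auto simp: I_def)
  qed simp
qed

section \<open>Undoing the splittings for one pair of terminals\<close>

section \<open>Unwinding\<close>

text \<open>\<open>F\<close> is the flow under extraction, \<open>w\<close> its divergence, and the
  pieces from \<open>q\<close> on have been dealt with. On a created arc or the pool,
  \<open>F\<close> is covered by what the pieces below \<open>q\<close> put there beyond what they
  took; at \<open>q = 0\<close> this leaves nothing there. In the ledger, \<open>F\<close> counts
  along with the remaining amounts.\<close>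

definition unwind_ok :: "real set \<Rightarrow> nat \<Rightarrow> nat \<Rightarrow> (nat \<Rightarrow> nat) \<Rightarrow> (nat \<Rightarrow> nat) \<Rightarrow> nat \<Rightarrow>
    (nat \<Rightarrow> nat) \<Rightarrow> (nat \<Rightarrow> nat) \<Rightarrow> (nat \<Rightarrow> nat) \<Rightarrow> (nat \<Rightarrow> real) \<Rightarrow> (nat \<Rightarrow> real) \<Rightarrow> (nat \<Rightarrow> real) \<Rightarrow>
    nat \<Rightarrow> (nat \<Rightarrow> real) \<Rightarrow> (nat \<Rightarrow> real) \<Rightarrow> bool" where
  "unwind_ok Z E2 m s d k p1 p2 p3 b V w q F X \<longleftrightarrow>
    (\<forall>c. F c \<in> Z \<and> X c \<in> Z) \<and> (\<forall>c. c \<noteq> 1 \<longrightarrow> 0 \<le> F c) \<and> (\<forall>p<k. 0 \<le> X p) \<and>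
    (\<forall>c. c \<noteq> 1 \<and> (c = 0 \<or> E2 \<le> c) \<longrightarrow> F c + used q p1 p2 X c \<le> recv q p3 X c) \<and>
    (\<forall>c. c \<noteq> 1 \<longrightarrow> b c + recv k p3 X c = V c + F c + used k p1 p2 X c) \<and>
    (\<forall>v. (\<Sum>c<m. F c * inc s d c v) = w v)"

lemma unwind_okD:
  assumes "unwind_ok Z E2 m s d k p1 p2 p3 b V w q F X"
  shows "F c \<in> Z" "X c \<in> Z" "c \<noteq> 1 \<Longrightarrow> 0 \<le> F c" "p < k \<Longrightarrow> 0 \<le> X p"
    "c \<noteq> 1 \<Longrightarrow> c = 0 \<or> E2 \<le> c \<Longrightarrow> F c + used q p1 p2 X c \<le> recv q p3 X c"
    "c \<noteq> 1 \<Longrightarrow> b c + recv k p3 X c = V c + F c + used k p1 p2 X c"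
    "(\<Sum>c<m. F c * inc s d c v) = w v"
  using assms by (simp_all add: unwind_ok_def)

definition push :: "nat \<Rightarrow> nat \<Rightarrow> nat \<Rightarrow> real \<Rightarrow> (nat \<Rightarrow> real) \<Rightarrow> (nat \<Rightarrow> real)" where
  "push c a b y F =
    (let F = F(c := F c - y); F = F(a := F a + y) in F(b := F b + y))"

lemma push_eq:
  "push c a b y F e = F e - (if c = e then y else 0) + (if a = e then y else 0) + (if b = e then y else 0)"
  by (simp add: push_def Let_def)

text \<open>Arc \<open>p3 q\<close> passes on as much of \<open>F\<close> as piece \<open>q\<close>
  allows. Either nothing of \<open>F\<close> is left on it, or the piece is used up and the rest is
  covered by earlier pieces into the arc. By the order of the pieces no earlier piece draws on this
  arc, so the cover is not spent elsewhere.\<close>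

lemma unwind_step:
  assumes P: "pieces_ok E2 m s d k p1 p2 p3" and Z: "add_closed Z" and "q < k"
    and U: "unwind_ok Z E2 m s d k p1 p2 p3 b V w (Suc q) F X"
  defines "y \<equiv> if F (p3 q) < X q then F (p3 q) else X q"
  shows "unwind_ok Z E2 m s d k p1 p2 p3 b V w q (push (p3 q) (p1 q) (p2 q) y F) (X(q := X q - y))"
proof -
  note P' = pieces_okD[OF P]
  note U' = unwind_okD[OF U]
  have E2: "2 \<le> E2" "E2 \<le> m" by (rule P'(1), rule P'(2))
  have c: "p3 q \<noteq> 1" "p3 q = 0 \<or> E2 \<le> p3 q"
    using P'(8)[OF \<open>q < k\<close>] E2 by auto
  have y: "y \<in> Z" "0 \<le> y" "y \<le> X q" "y \<le> F (p3 q)"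
    using U'(1,2) U'(3)[OF c(1)] U'(4)[OF \<open>q < k\<close>] by (auto simp: y_def)
  have ne: "p3 q \<noteq> p1 q" "p3 q \<noteq> p2 q"
    using P'(11)[OF \<open>q < k\<close> \<open>q < k\<close>] by auto
  let ?F = "push (p3 q) (p1 q) (p2 q) y F"
  have low: "recv q h (X(q := X q - y)) e = recv q h X e" for h e
    using recv_upd[of q q h "h q" X "X q - y" e] by simp
  have r2: "?F e + used q p1 p2 (X(q := X q - y)) e \<le> recv q p3 (X(q := X q - y)) e"
    if e: "e \<noteq> 1" "e = 0 \<or> E2 \<le> e" for e
  proof (cases "e = p3 q")
    case False
    have "F e + (recv q p1 X e + (if p1 q = e then X q else 0) +
        (recv q p2 X e + (if p2 q = e then X q else 0))) \<le> recv q p3 X e"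
      using U'(5)[OF e] False by (auto simp: used_def recv_Suc)
    then show ?thesis
      using False y(3) unfolding used_def low push_eq by (auto split: if_splits)
  next
    case True
    have Fe: "?F e = F e - y"
      using True ne by (auto simp: push_eq)
    have "p1 p \<noteq> e \<and> p2 p \<noteq> e" if "p < q" for p
      using P'(11)[OF \<open>q < k\<close>, of p] \<open>q < k\<close> True that by auto
    then have u0: "recv q p1 X e = 0" "recv q p2 X e = 0"
      by (simp_all add: recv_eq_0)
    show ?thesis
    proof (cases "F (p3 q) < X q")
      case lt: True
      have "0 \<le> recv q p3 X e"
        using U'(4) \<open>q < k\<close> by (intro recv_nonneg) auto
      then show ?thesis
        using lt True u0 unfolding Fe used_def low by (simp add: y_def)
    next
      case False
      have "F e \<le> recv q p3 X e + X q"
        using U'(5)[OF e] True u0 ne by (auto simp: used_def recv_Suc)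
      then show ?thesis
        using False True u0 unfolding Fe used_def low by (simp add: y_def)
    qed
  qed
  have r3: "b e + recv k p3 (X(q := X q - y)) e = V e + ?F e + used k p1 p2 (X(q := X q - y)) e"
    if "e \<noteq> 1" for e
    using U'(6)[OF that] unfolding used_def recv_upd_value[OF \<open>q < k\<close>] push_eq by simp
  have r4: "(\<Sum>e<m. ?F e * inc s d e v) = w v" for v
  proof -
    have *: "(\<Sum>e<m. (if a = e then y else 0) * inc s d e v) = y * inc s d a v" if "a < m" for a
      using that by (simp add: if_distrib[of "\<lambda>x. x * _"] cong: if_cong)
    have "(\<Sum>e<m. ?F e * inc s d e v) = w v - y * inc s d (p3 q) v +
        y * inc s d (p1 q) v + y * inc s d (p2 q) v"
      unfolding push_eq distrib_right left_diff_distrib sum.distrib sum_subtractf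
      using * P'(4,6,9)[OF \<open>q < k\<close>] U'(7)[of v] by simp
    then show ?thesis
      unfolding P'(10)[OF \<open>q < k\<close>] by (simp add: distrib_left)
  qed
  have r1: "?F e \<in> Z" "e \<noteq> 1 \<Longrightarrow> 0 \<le> ?F e" for e
  proof -
    have plus: "(G(a := G a + y)) e \<in> Z" and minus: "(G(a := G a - y)) e \<in> Z"
      if "\<forall>e. G e \<in> Z" for G a e
      using that y(1) Z by (auto intro: add_closedD)
    show "?F e \<in> Z"
      unfolding push_def Let_def
      by (intro plus minus allI) (rule U'(1))
    show "0 \<le> ?F e" if "e \<noteq> 1"
      using U'(3)[OF that] y(2,4) ne unfolding push_eq by auto
  qed
  show ?thesis
    unfolding unwind_ok_def
    using r1 r2 r3 r4 U'(2,4) y(1,3) Z by (auto simp: add_closedD)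
qed

text \<open>The extraction starts with everything on the arc \<open>c\<close> of the pair and on the
  pool. \<open>c = 0\<close> stands for a pair without an arc; the pool is then still moved only
  once, because \<open>V'\<close> has already lost it. The dummy alone may hold leftovers in
  \<open>F\<close>.\<close>

lemma unwind_start:
  assumes P: "pieces_ok E2 m s d k p1 p2 p3" and Z: "add_closed Z"
    and A: "accounts_ok Z b V k p1 p2 p3 X"
    and b: "\<And>c. c = 0 \<or> E2 \<le> c \<Longrightarrow> b c = 0"
    and F: "\<And>e. F e \<in> Z" "\<And>e. e \<noteq> 1 \<Longrightarrow> F e = 0" and c: "c \<noteq> 1" "c < m"
  defines "V' \<equiv> V(c := 0)" and "F' \<equiv> F(c := F c + V c)"
  shows "unwind_ok Z E2 m s d k p1 p2 p3 b (V'(0 := 0)) (\<lambda>v. V c * inc s d c v) k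
    (F'(0 := F' 0 + V' 0)) X"
proof -
  note A' = accounts_okD[OF A]
  note E2 = pieces_okD(1,2)[OF P]
  let ?F = "F'(0 := F' 0 + V' 0)"
  have F1: "?F e = (if e = 0 \<or> e = c then V e else 0)" if "e \<noteq> 1" for e
    using F(2)[OF that] F(2)[of 0] F(2)[of c] c(1) by (auto simp: F'_def V'_def)
  have sum: "(V'(0 := 0)) e + ?F e = V e" if "e \<noteq> 1" for e
    using F1[OF that] by (auto simp: V'_def)
  have FZ: "?F e \<in> Z" for e
    using F(1) A'(1) Z by (auto simp: F'_def V'_def add_closedD)
  have w: "(\<Sum>e<m. ?F e * inc s d e v) = V c * inc s d c v" for v
  proof -
    have "?F e * inc s d e v = (if e = c then V c * inc s d c v else 0)" for e
      using F1[of e] by (cases "e = 1"; cases "e = 0") auto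
    then show ?thesis
      using c(2) by simp
  qed
  show ?thesis
    unfolding unwind_ok_def
  proof (intro conjI allI impI)
    fix e assume e: "e \<noteq> 1 \<and> (e = 0 \<or> E2 \<le> e)"
    then have "?F e \<le> V e"
      using F1[of e] A'(3)[of e] by auto
    then show "?F e + used k p1 p2 X e \<le> recv k p3 X e"
      using A'(5)[of e] b[of e] e by auto
  next
    show "b e + recv k p3 X e = (V'(0 := 0)) e + ?F e + used k p1 p2 X e" if "e \<noteq> 1" for e
      using sum[OF that] A'(5)[OF that] by simp
    show "0 \<le> ?F e" if "e \<noteq> 1" for e
      using F1[OF that] A'(3)[OF that] by auto
  qed (use A' FZ w in auto)
qed

text \<open>With no piece left, nothing covers \<open>F\<close> on created arcs, so apart from the
  dummy \<open>F\<close> lives on the given arcs. Subtracting it from the initial amounts restores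
  the ledger for the next pair.\<close>

lemma unwind_finish:
  assumes P: "pieces_ok E2 m s d k p1 p2 p3" and V: "\<And>c. V c \<in> Z" "\<And>c. c \<noteq> 1 \<Longrightarrow> 0 \<le> V c"
    and U: "unwind_ok Z E2 m s d k p1 p2 p3 b V w 0 F X"
  shows "\<And>c. c \<noteq> 1 \<Longrightarrow> c = 0 \<or> E2 \<le> c \<Longrightarrow> F c = 0"
    and "accounts_ok Z (\<lambda>c. b c - F c) V k p1 p2 p3 X"
    and "(\<Sum>c<E2. F c * inc s d c v) = w v"
proof -
  note U' = unwind_okD[OF U]
  note E2 = pieces_okD(1,2)[OF P]
  show F0: "F c = 0" if "c \<noteq> 1" "c = 0 \<or> E2 \<le> c" for c
    using U'(5)[OF that] U'(3)[OF that(1)] by (simp add: recv_def used_def)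
  show "accounts_ok Z (\<lambda>c. b c - F c) V k p1 p2 p3 X"
    unfolding accounts_ok_def using U'(2,4,6) V by (auto simp: algebra_simps)
  have "(\<Sum>c<E2. F c * inc s d c v) = (\<Sum>c<m. F c * inc s d c v)"
    using E2 F0 by (intro sum.mono_neutral_left) auto
  then show "(\<Sum>c<E2. F c * inc s d c v) = w v"
    using U'(7) by simp
qed

text \<open>Backward induction over the pieces: those out of arc \<open>p3 p\<close> come after
  \<open>p\<close> and are empty, so the arc has received nothing and piece \<open>p\<close> is
  empty too. With nothing remaining and nothing taken, the initial amounts vanish, which means that
  the whole flow has been distributed.\<close>

lemma accounts_exhausted:
  assumes P: "pieces_ok E2 m s d k p1 p2 p3"
    and A: "accounts_ok Z b V k p1 p2 p3 X"
    and b: "\<And>c. c = 0 \<or> E2 \<le> c \<Longrightarrow> b c = 0"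
    and V: "\<And>c. c \<noteq> 1 \<Longrightarrow> V c = 0" and "c \<noteq> 1"
  shows "b c = 0"
proof -
  note P' = pieces_okD[OF P]
  note A' = accounts_okD[OF A]
  have X: "X p = 0" if "p < k" for p
    using that
  proof (induction "k - p" arbitrary: p rule: less_induct)
    case less
    have c: "p3 p \<noteq> 1" "p3 p = 0 \<or> E2 \<le> p3 p"
      using P'(8)[OF less.prems] P'(1) by auto
    have zero: "recv k h X (p3 p) = 0" if h: "\<And>q. q < k \<Longrightarrow> h q = p3 p \<Longrightarrow> p < q" for h
      unfolding recv_def using less.hyps h less.prems by (intro sum.neutral) force
    have "recv k p1 X (p3 p) = 0" "recv k p2 X (p3 p) = 0"
      using zero P'(11)[OF less.prems] by blast+
    then have "recv k p3 X (p3 p) = 0"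
      using A'(5)[OF c(1)] b[OF c(2)] V[OF c(1)] by (simp add: used_def)
    moreover have "0 \<le> (if p3 q = p3 p then X q else 0)" if "q < k" for q
      using A'(4)[OF that] by simp
    ultimately have "\<forall>q\<in>{..<k}. (if p3 q = p3 p then X q else 0) = 0"
      unfolding recv_def by (subst (asm) sum_nonneg_eq_0_iff) auto
    from bspec[OF this, of p] show ?case
      using less.prems by simp
  qed
  then have "recv k h X e = 0" for h e
    unfolding recv_def by (intro sum.neutral) auto
  then show ?thesis
    using A'(5)[OF \<open>c \<noteq> 1\<close>] V[OF \<open>c \<noteq> 1\<close>] by (simp add: used_def)
qed

section \<open>Arcs from new sources and to new sinks\<close>

section \<open>The extended network\<close>

text \<open>The arcs of the digraph are shifted by 2 to make room for the pool and the dummy. The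
  arcs out of the new sources follow, then those into the new sinks.\<close>

definition slots_ok :: "nat \<Rightarrow> nat \<Rightarrow> nat list \<Rightarrow> nat list \<Rightarrow> (nat \<Rightarrow> nat) \<Rightarrow> (nat \<Rightarrow> nat) \<Rightarrow> bool" where
  "slots_ok n m ss ts s d \<longleftrightarrow>
    (\<forall>e<m. s (e + 2) < n \<and> d (e + 2) < n) \<and>
    (\<forall>i<length ss. s (m + 2 + i) = n + i \<and> d (m + 2 + i) = ss ! i \<and> ss ! i < n) \<and>
    (\<forall>j<length ts. s (m + 2 + length ss + j) = ts ! j \<and>
      d (m + 2 + length ss + j) = n + length ss + j \<and> ts ! j < n)"

lemma sum_lessThan_add: "(\<Sum>c<a + (b::nat). h c) = (\<Sum>c<a. h c) + (\<Sum>c<b. h (a + c))"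
  for h :: "nat \<Rightarrow> real"
  by (induction b) (auto simp: add.assoc)

lemma sum_slots:
  fixes h :: "nat \<Rightarrow> real"
  assumes "h 0 = 0" "h 1 = 0"
  shows "(\<Sum>c<m + 2 + p + q. h c) =
    (\<Sum>e<m. h (e + 2)) + (\<Sum>i<p. h (m + 2 + i)) + (\<Sum>j<q. h (m + 2 + p + j))"
proof -
  have "(\<Sum>c<m + 2. h c) = (\<Sum>c<2 + m. h c)"
    by (simp add: add.commute)
  also have "\<dots> = (\<Sum>e<m. h (e + 2))"
    unfolding sum_lessThan_add using assms by (simp add: numeral_2_eq_2 add.commute)
  finally show ?thesis
    unfolding sum_lessThan_add by simp
qed

text \<open>Conservation at the new vertices determines the flow on the new arcs.\<close>

lemma slots_divergence:
  assumes S: "slots_ok n m ss ts s d" and i: "i < length ss" and j: "j < length ts"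
    and bal: "\<And>v. (\<Sum>c<m + 2 + length ss + length ts. F c * inc s d c v) =
      val * (of_bool (v = n + i) - of_bool (v = n + length ss + j))"
    and "v < n"
  shows "(\<Sum>e<m. F (e + 2) * inc s d (e + 2) v) =
    val * (of_bool (v = ss ! i) - of_bool (v = ts ! j))"
proof -
  let ?ls = "length ss" and ?lt = "length ts"
  define p where "p i = m + 2 + i" for i
  define q where "q j = m + 2 + ?ls + j" for j
  note S' = S[unfolded slots_ok_def]
  have split: "(\<Sum>c<m + 2 + ?ls + ?lt. F c * inc s d c u) =
      (\<Sum>e<m. F (e + 2) * inc s d (e + 2) u) +
      (\<Sum>i<?ls. F (p i) * inc s d (p i) u) +
      (\<Sum>j<?lt. F (q j) * inc s d (q j) u)" for u
    unfolding p_def q_def by (rule sum_slots) auto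
  have inc_i: "inc s d (p i') u = of_bool (u = n + i') - of_bool (u = ss ! i')"
    if "i' < ?ls" for i' u
    using S' that by (auto simp: inc_def p_def)
  have inc_j: "inc s d (q j') u = of_bool (u = ts ! j') - of_bool (u = n + ?ls + j')"
    if "j' < ?lt" for j' u
    using S' that by (auto simp: inc_def q_def)
  have orig0: "(\<Sum>e<m. F (e + 2) * inc s d (e + 2) u) = 0" if "n \<le> u" for u
    using S' that by (intro sum.neutral) (auto simp: inc_def)
  have Fi: "F (p i') = (if i' = i then val else 0)" if i': "i' < ?ls" for i'
  proof -
    have "(\<Sum>a<?ls. F (p a) * inc s d (p a) (n + i')) =
        (\<Sum>a<?ls. if a = i' then F (p i') else 0)"
    proof (rule sum.cong[OF refl])
      fix a assume "a \<in> {..<?ls}"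
      then have "a < ?ls" "ss ! a < n" using S' by auto
      then show "F (p a) * inc s d (p a) (n + i') = (if a = i' then F (p i') else 0)"
        by (auto simp: inc_i)
    qed
    moreover have "(\<Sum>a<?lt. F (q a) * inc s d (q a) (n + i')) = 0"
    proof (rule sum.neutral, rule ballI)
      fix a assume "a \<in> {..<?lt}"
      then have "a < ?lt" "ts ! a < n" using S' by auto
      then show "F (q a) * inc s d (q a) (n + i') = 0"
        using i' by (auto simp: inc_j)
    qed
    ultimately show ?thesis
      using bal[of "n + i'"] i' orig0[of "n + i'"] unfolding split by auto
  qed
  have Fj: "F (q j') = (if j' = j then val else 0)" if j': "j' < ?lt" for j'
  proof -
    have "(\<Sum>a<?lt. F (q a) * inc s d (q a) (n + ?ls + j')) =
        (\<Sum>a<?lt. if a = j' then - F (q j') else 0)"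
    proof (rule sum.cong[OF refl])
      fix a assume "a \<in> {..<?lt}"
      then have "a < ?lt" "ts ! a < n" using S' by auto
      then show "F (q a) * inc s d (q a) (n + ?ls + j') =
          (if a = j' then - F (q j') else 0)"
        by (auto simp: inc_j)
    qed
    moreover have "(\<Sum>a<?ls. F (p a) * inc s d (p a) (n + ?ls + j')) = 0"
    proof (rule sum.neutral, rule ballI)
      fix a assume "a \<in> {..<?ls}"
      then have "a < ?ls" "ss ! a < n" using S' by auto
      then show "F (p a) * inc s d (p a) (n + ?ls + j') = 0"
        by (auto simp: inc_i)
    qed
    ultimately show ?thesis
      using bal[of "n + ?ls + j'"] i j' orig0[of "n + ?ls + j'"] unfolding split by auto
  qed
  have "(\<Sum>a<?ls. F (p a) * inc s d (p a) v) =
      (\<Sum>a<?ls. if a = i then - val * of_bool (v = ss ! i) else 0)"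
    using \<open>v < n\<close> by (intro sum.cong) (auto simp: Fi inc_i)
  moreover have "(\<Sum>a<?lt. F (q a) * inc s d (q a) v) =
      (\<Sum>a<?lt. if a = j then val * of_bool (v = ts ! j) else 0)"
    using \<open>v < n\<close> by (intro sum.cong) (auto simp: Fj inc_j)
  ultimately show ?thesis
    using bal[of v] \<open>v < n\<close> i j unfolding split by (simp add: right_diff_distrib)
qed

section \<open>One pass over all pieces for each pair of terminals\<close>

section \<open>The unwinding program\<close>

definition unwind_body :: com where
  "unwind_body =
    SetReg rq (ISub (Reg rq) (INum 1)) ;;
    SetReg rC (IRead 13 (Reg rq)) ;;
    Cond (RLess (RRead 4 (Reg rC)) (RRead 3 (Reg rq)))
      (RWrite 6 (INum 2) (RRead 4 (Reg rC))) (RWrite 6 (INum 2) (RRead 3 (Reg rq))) ;;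
    RWrite 4 (Reg rC) (RSub (RRead 4 (Reg rC)) Xreg) ;;
    RWrite 4 (IRead 11 (Reg rq)) (RAdd (RRead 4 (IRead 11 (Reg rq))) Xreg) ;;
    RWrite 4 (IRead 12 (Reg rq)) (RAdd (RRead 4 (IRead 12 (Reg rq))) Xreg) ;;
    RWrite 3 (Reg rq) (RSub (RRead 3 (Reg rq)) Xreg)"

text \<open>A cell is cleared after it has been copied, so that the extracted flow is 0 again when
  the next pair starts.\<close>

definition output_body :: com where
  "output_body =
    RWrite 1 (IAdd (Reg ro) (Reg re)) (RRead 4 (IAdd (Reg re) (INum 2))) ;;
    RWrite 4 (IAdd (Reg re) (INum 2)) RZero ;;
    incr re"

text \<open>The loop also visits the arcs at the new vertices, in order to clear them, and so writes
  beyond the block of the pair. Later passes overwrite these cells, and those written by the last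
  pass lie behind the output.\<close>

definition output_guard :: bexp where
  "output_guard = ILess (IAdd (Reg re) (INum 2)) (Reg rE2)"

definition start_pass :: com where
  "start_pass =
    SetReg rC (IRead 10 (IAdd (IRead 6 (IAdd (IRead 0 (INum 0)) (Reg ri)))
      (IAdd (IAdd (IRead 0 (INum 0)) (IRead 0 (INum 2))) (Reg rj)))) ;;
    RWrite 4 (Reg rC) (RAdd (RRead 4 (Reg rC)) (RRead 2 (Reg rC))) ;;
    RWrite 2 (Reg rC) RZero ;;
    RWrite 4 (INum 0) (RAdd (RRead 4 (INum 0)) (RRead 2 (INum 0))) ;;
    RWrite 2 (INum 0) RZero ;;
    SetReg rq (Reg rnp)"

text \<open>\<open>ro\<close> advances by \<open>|E|\<close> for each pair, which yields the offsets
  of the output blocks by addition alone.\<close>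

definition next_pair :: com where
  "next_pair =
    SetReg ro (IAdd (Reg ro) (IRead 0 (INum 1))) ;;
    incr rj ;;
    Cond (ILess (Reg rj) (IRead 0 (INum 3))) Skip (SetReg rj (INum 0) ;; incr ri)"

definition pass_code :: com where
  "pass_code =
    start_pass ;;
    While (ILess (INum 0) (Reg rq)) unwind_body ;;
    SetReg re (INum 0) ;;
    While output_guard output_body ;;
    next_pair"

definition final_code :: com where
  "final_code =
    (SetReg ri (INum 0) ;; SetReg rj (INum 0) ;; SetReg ro (INum 0)) ;;
    While (ILess (Reg ri) (IRead 0 (INum 2))) pass_code"

definition final_frame :: "store \<Rightarrow> store \<Rightarrow> bool" where
  "final_frame \<sigma> \<tau> \<longleftrightarrow> (\<forall>k. k \<noteq> 5 \<longrightarrow> istore \<tau> k = istore \<sigma> k) \<and>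
    (\<forall>r. r \<notin> {rC, ri, rj, ro, rq, re} \<longrightarrow> reg \<tau> r = reg \<sigma> r)"

lemma final_frame_refl [simp]: "final_frame \<sigma> \<sigma>"
  by (simp add: final_frame_def)

lemma final_frame_trans: "final_frame \<sigma> \<rho> \<Longrightarrow> final_frame \<rho> \<tau> \<Longrightarrow> final_frame \<sigma> \<tau>"
  by (simp add: final_frame_def)

lemma sem_unwind_body:
  fixes \<sigma> :: store
  defines "q \<equiv> reg \<sigma> rq - 1" and "\<tau> \<equiv> sem unwind_body \<sigma>"
  defines "y \<equiv> if rstore \<sigma> 4 (istore \<sigma> 13 q) < rstore \<sigma> 3 q then rstore \<sigma> 4 (istore \<sigma> 13 q)
    else rstore \<sigma> 3 q"
  shows "final_frame \<sigma> \<tau>"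
    and "reg \<tau> ri = reg \<sigma> ri \<and> reg \<tau> rj = reg \<sigma> rj \<and> reg \<tau> ro = reg \<sigma> ro \<and> reg \<tau> rq = q"
    and "rstore \<tau> 4 = push (istore \<sigma> 13 q) (istore \<sigma> 11 q) (istore \<sigma> 12 q) y (rstore \<sigma> 4)"
    and "rstore \<tau> 3 = (rstore \<sigma> 3)(q := rstore \<sigma> 3 q - y)"
    and "rstore \<tau> 1 = rstore \<sigma> 1" "rstore \<tau> 2 = rstore \<sigma> 2"
  by (auto simp: \<tau>_def unwind_body_def final_frame_def push_def Let_def q_def y_def)

definition final_keep :: "store \<Rightarrow> store \<Rightarrow> bool" where
  "final_keep \<sigma> \<tau> \<longleftrightarrow> final_frame \<sigma> \<tau> \<and>
    reg \<tau> ri = reg \<sigma> ri \<and> reg \<tau> rj = reg \<sigma> rj \<and> reg \<tau> ro = reg \<sigma> ro \<and> rstore \<tau> 2 = rstore \<sigma> 2"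

lemma final_keep_trans: "final_keep \<sigma> \<rho> \<Longrightarrow> final_keep \<rho> \<tau> \<Longrightarrow> final_keep \<sigma> \<tau>"
  using final_frame_trans by (auto simp: final_keep_def)

lemma runs_unwind:
  fixes \<sigma> :: store
  defines "p1 \<equiv> istore \<sigma> 11" and "p2 \<equiv> istore \<sigma> 12" and "p3 \<equiv> istore \<sigma> 13" and "k \<equiv> reg \<sigma> rq"
  assumes P: "pieces_ok E2 m s d k p1 p2 p3" and Z: "add_closed Z"
    and U: "unwind_ok Z E2 m s d k p1 p2 p3 b V w k (rstore \<sigma> 4) (rstore \<sigma> 3)"
  shows "runs (While (ILess (INum 0) (Reg rq)) unwind_body) \<sigma> (100 * (real k + 1)) (\<lambda>\<tau>.
    final_keep \<sigma> \<tau> \<and> rstore \<tau> 1 = rstore \<sigma> 1 \<and>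
    unwind_ok Z E2 m s d k p1 p2 p3 b V w 0 (rstore \<tau> 4) (rstore \<tau> 3))"
proof -
  define J where "J i \<tau> \<longleftrightarrow> final_keep \<sigma> \<tau> \<and> rstore \<tau> 1 = rstore \<sigma> 1 \<and> i \<le> k \<and> reg \<tau> rq = k - i \<and>
    unwind_ok Z E2 m s d k p1 p2 p3 b V w (k - i) (rstore \<tau> 4) (rstore \<tau> 3)" for i \<tau>
  have step: "runs unwind_body \<tau> 80 (J (Suc i))" if J: "J i \<tau>" "i < k" for i \<tau>
  proof (rule runs_loop_free)
    show "loop_free unwind_body" "real (max_cost unwind_body) \<le> 80"
      by (simp_all add: unwind_body_def)
    have arr: "istore \<tau> 11 = p1" "istore \<tau> 12 = p2" "istore \<tau> 13 = p3"
      using J by (auto simp: J_def final_keep_def final_frame_def p1_def p2_def p3_def)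
    have q: "reg \<tau> rq - 1 = k - Suc i" "k - i = Suc (k - Suc i)" "k - Suc i < k"
      using J by (auto simp: J_def)
    note S = sem_unwind_body[of \<tau>, unfolded q(1) arr]
    have "unwind_ok Z E2 m s d k p1 p2 p3 b V w (k - Suc i)
        (rstore (sem unwind_body \<tau>) 4) (rstore (sem unwind_body \<tau>) 3)"
      unfolding S(3,4) using J(1) unwind_step[OF P Z q(3)] unfolding J_def q(2) by blast
    moreover have "final_keep \<tau> (sem unwind_body \<tau>)"
      using S by (simp add: final_keep_def)
    ultimately show "J (Suc i) (sem unwind_body \<tau>)"
      using S J final_keep_trans unfolding J_def by auto
  qed
  have "runs (While (ILess (INum 0) (Reg rq)) unwind_body) \<sigma>
    (real k * (80 + real (bcost (ILess (INum 0) (Reg rq))) + 1) +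
      real (bcost (ILess (INum 0) (Reg rq))) + 1) (J k)"
  proof (rule runs_While_count)
    show "J 0 \<sigma>"
      using U by (simp add: J_def final_keep_def k_def)
    show "runs unwind_body \<tau> 80 (J (Suc i))" if "J i \<tau>" "i < k" for i \<tau>
      by (rule step[OF that])
  qed (auto simp: J_def)
  then show ?thesis
    by (rule runs_mono) (auto simp: J_def)
qed

lemma runs_output:
  fixes \<sigma> :: store
  defines "F \<equiv> rstore \<sigma> 4" and "o0 \<equiv> reg \<sigma> ro"
  assumes E2: "reg \<sigma> rE2 = E + 2" and re: "reg \<sigma> re = 0"
  shows "runs (While output_guard output_body) \<sigma> (40 * (real E + 1)) (\<lambda>\<tau>.
    final_keep \<sigma> \<tau> \<and> rstore \<tau> 3 = rstore \<sigma> 3 \<and>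
    (\<forall>e<E. rstore \<tau> 1 (o0 + e) = F (e + 2)) \<and> (\<forall>a<o0. rstore \<tau> 1 a = rstore \<sigma> 1 a) \<and>
    (\<forall>c. rstore \<tau> 4 c = (if 2 \<le> c \<and> c < E + 2 then 0 else F c)))"
proof -
  define J where "J i \<tau> \<longleftrightarrow> final_keep \<sigma> \<tau> \<and> rstore \<tau> 3 = rstore \<sigma> 3 \<and> reg \<tau> re = i \<and>
    (\<forall>e<i. rstore \<tau> 1 (o0 + e) = F (e + 2)) \<and> (\<forall>a<o0. rstore \<tau> 1 a = rstore \<sigma> 1 a) \<and>
    (\<forall>c. rstore \<tau> 4 c = (if 2 \<le> c \<and> c < i + 2 then 0 else F c))" for i \<tau>
  have step: "runs output_body \<tau> 30 (J (Suc i))" if J: "J i \<tau>" for i \<tau>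
  proof (rule runs_loop_free)
    have "reg \<tau> ro = o0" "rstore \<tau> 4 (i + 2) = F (i + 2)" "reg \<tau> re = i"
      using J by (auto simp: J_def final_keep_def o0_def)
    then have "rstore (sem output_body \<tau>) 1 = (rstore \<tau> 1)(o0 + i := F (i + 2))"
      "rstore (sem output_body \<tau>) 4 = (rstore \<tau> 4)(i + 2 := 0)"
      "rstore (sem output_body \<tau>) 3 = rstore \<tau> 3" "reg (sem output_body \<tau>) re = Suc i"
      "final_keep \<tau> (sem output_body \<tau>)"
      by (auto simp: output_body_def final_keep_def final_frame_def)
    then show "J (Suc i) (sem output_body \<tau>)"
      using J final_keep_trans[of \<sigma> \<tau>] unfolding J_def by (auto simp: less_Suc_eq)
  qed (simp_all add: output_body_def)
  have "runs (While output_guard output_body) \<sigma>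
    (real E * (30 + real (bcost output_guard) + 1) + real (bcost output_guard) + 1) (J E)"
  proof (rule runs_While_count)
    show "J 0 \<sigma>"
      using re by (simp add: J_def final_keep_def F_def)
    show "runs output_body \<tau> 30 (J (Suc i))" if "J i \<tau>" for i \<tau>
      by (rule step[OF that])
    show "bval output_guard \<tau> \<longleftrightarrow> i < E" if "J i \<tau>" for i \<tau>
      using that E2 by (auto simp: output_guard_def J_def final_keep_def final_frame_def)
  qed auto
  then show ?thesis
    by (rule runs_mono) (auto simp: J_def output_guard_def)
qed

text \<open>\<open>t\<close> numbers the pairs lexicographically; the value is 0 if no arc joins the
  pair.\<close>

definition pair_arc :: "nat \<Rightarrow> nat \<Rightarrow> nat \<Rightarrow> nat \<Rightarrow> graph_state \<Rightarrow> nat \<Rightarrow> nat" where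
  "pair_arc N n ls lt g t = mat g ((n + t div lt) * N + (n + ls + t mod lt))"

text \<open>The state after \<open>t\<close> passes: \<open>b\<close> is the part of the circulation
  not yet distributed, and amounts remain only on arcs of later pairs. The pool can be nonempty only
  before the first pass, so all circulations from loops go to the first pair.\<close>

definition final_ok ::
  "real set \<Rightarrow> nat \<Rightarrow> nat list \<Rightarrow> nat list \<Rightarrow> nat \<Rightarrow> (nat \<Rightarrow> real) \<Rightarrow> graph_state \<Rightarrow> nat \<Rightarrow>
    (nat \<Rightarrow> real) \<Rightarrow> (nat \<Rightarrow> real) \<Rightarrow> (nat \<Rightarrow> real) \<Rightarrow> bool" where
  "final_ok Z n ss ts m f g t out V X \<longleftrightarrow>
    (\<exists>b. accounts_ok Z b V (np g) (pa g) (pb g) (pc g) X \<and>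
      (\<forall>c. c = 0 \<or> m + 2 + length ss + length ts \<le> c \<longrightarrow> b c = 0) \<and>
      (\<forall>e<m. b (e + 2) + (\<Sum>t'<t. out (t' * m + e)) = f e)) \<and>
    (\<forall>c. c \<noteq> 1 \<and> V c \<noteq> 0 \<longrightarrow> (c = 0 \<and> t = 0) \<or> (\<exists>t'. t \<le> t' \<and> t' < length ss * length ts \<and>
      c = pair_arc (n + length ss + length ts) n (length ss) (length ts) g t')) \<and>
    (\<forall>t'<t. \<forall>e<m. 0 \<le> out (t' * m + e) \<and> out (t' * m + e) \<in> Z) \<and>
    (\<forall>t'<t. \<exists>val\<ge>0. \<forall>v<n. (\<Sum>e<m. out (t' * m + e) * inc (src g) (dst g) (e + 2) v) =
      val * (of_bool (v = ss ! (t' div length ts)) - of_bool (v = ts ! (t' mod length ts))))"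

text \<open>The pass has turned the amount on the arc of pair \<open>t\<close> into a flow
  \<open>F\<close> on the given arcs, and \<open>slots_divergence\<close> yields its divergence at
  the original vertices. Earlier blocks lie below \<open>t * m\<close> and are untouched.\<close>

lemma final_ok_step:
  assumes P: "pieces_ok E2 (nx g) (src g) (dst g) (np g) (pa g) (pb g) (pc g)"
    and E2: "E2 = m + 2 + length ss + length ts"
    and A: "accounts_ok Z b V (np g) (pa g) (pb g) (pc g) X"
    and b: "\<forall>c. c = 0 \<or> E2 \<le> c \<longrightarrow> b c = 0" "\<forall>e<m. b (e + 2) + (\<Sum>t'<t. out (t' * m + e)) = f e"
    and O: "final_ok Z n ss ts m f g t out V X"
    and S: "slots_ok n m ss ts (src g) (dst g)" and t: "t < length ss * length ts"
    and c: "c = pair_arc (n + length ss + length ts) n (length ss) (length ts) g t"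
      "c = 0 \<or> E2 \<le> c \<and> src g c = n + t div length ts \<and> dst g c = n + length ss + t mod length ts"
    and Z: "add_closed Z"
    and V': "V' = V(c := 0, 0 := 0)"
    and U: "unwind_ok Z E2 (nx g) (src g) (dst g) (np g) (pa g) (pb g) (pc g) b V'
      (\<lambda>v. V c * inc (src g) (dst g) c v) 0 F X'"
    and out: "\<forall>e<m. out' (t * m + e) = F (e + 2)" "\<forall>a<t * m. out' a = out a"
  shows "final_ok Z n ss ts m f g (Suc t) out' V' X'"
    and "\<And>c. c \<noteq> 1 \<Longrightarrow> c < 2 \<or> E2 \<le> c \<Longrightarrow> F c = 0"
proof -
  note A' = accounts_okD[OF A]
  have VV: "V' e \<in> Z" "e \<noteq> 1 \<Longrightarrow> 0 \<le> V' e" for e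
    using A'(1,3) add_closedD(1)[OF Z] by (auto simp: V')
  note fin = unwind_finish[OF P VV U]
  show F0: "F c = 0" if "c \<noteq> 1" "c < 2 \<or> E2 \<le> c" for c
    using fin(1)[of c] that by (auto simp: less_2_cases_iff)
  have old: "out' (t' * m + e) = out (t' * m + e)" if "t' < t" "e < m" for t' e
  proof -
    have "t' * m + e < Suc t' * m" using that by simp
    also have "\<dots> \<le> t * m" using that by (intro mult_le_mono1) simp
    finally show ?thesis using out(2) by blast
  qed
  have lt: "0 < length ts" using t by (cases "length ts") auto
  have ij: "t div length ts < length ss" "t mod length ts < length ts"
    using t lt by (auto simp: less_mult_imp_div_less)
  \<comment> \<open>For a pair without an arc, \<open>c\<close> is the pool; its amount belongs to
    circulations and contributes nothing to the value.\<close>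
  define val where "val = (if c = 0 then 0 else V c)"
  have val: "0 \<le> val"
    using A'(3)[of c] c(2) E2 by (auto simp: val_def)
  have bal: "(\<Sum>e<m + 2 + length ss + length ts. F e * inc (src g) (dst g) e v) =
      val * (of_bool (v = n + t div length ts) - of_bool (v = n + length ss + t mod length ts))" for v
    using fin(3)[of v] c(2) E2 by (auto simp: val_def inc_def)
  have div: "(\<Sum>e<m. out' (t * m + e) * inc (src g) (dst g) (e + 2) v) =
      val * (of_bool (v = ss ! (t div length ts)) - of_bool (v = ts ! (t mod length ts)))"
    if "v < n" for v
    using slots_divergence[OF S ij bal that] out(1) by simp
  show "final_ok Z n ss ts m f g (Suc t) out' V' X'"
    unfolding final_ok_def
  proof (intro conjI allI impI)
    show "\<exists>b. accounts_ok Z b V' (np g) (pa g) (pb g) (pc g) X' \<and>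
      (\<forall>c. c = 0 \<or> m + 2 + length ss + length ts \<le> c \<longrightarrow> b c = 0) \<and>
      (\<forall>e<m. b (e + 2) + (\<Sum>t'<Suc t. out' (t' * m + e)) = f e)"
    proof (intro exI[of _ "\<lambda>c. b c - F c"] conjI allI impI)
      show "b c - F c = 0" if "c = 0 \<or> m + 2 + length ss + length ts \<le> c" for c
        using that b(1)[rule_format, of c] F0[of c] E2 by auto
      show "b (e + 2) - F (e + 2) + (\<Sum>t'<Suc t. out' (t' * m + e)) = f e" if "e < m" for e
      proof -
        have "(\<Sum>t'<t. out' (t' * m + e)) = (\<Sum>t'<t. out (t' * m + e))"
          using that old by (intro sum.cong) auto
        moreover have "b (e + 2) + (\<Sum>t'<t. out (t' * m + e)) = f e"
          using b(2) that by blast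
        moreover have "out' (t * m + e) = F (e + 2)"
          using out(1) that by blast
        ultimately show ?thesis
          by (simp only: sum.lessThan_Suc)
      qed
    qed (rule fin(2))
  next
    fix e assume e: "e \<noteq> 1 \<and> V' e \<noteq> 0"
    then have "e \<noteq> c" "e \<noteq> 0" "V e \<noteq> 0" by (auto simp: V' split: if_splits)
    then obtain t' where t': "t \<le> t'" "t' < length ss * length ts"
      "e = pair_arc (n + length ss + length ts) n (length ss) (length ts) g t'"
      using O e unfolding final_ok_def by blast
    moreover have "t' \<noteq> t" using t'(3) c(1) \<open>e \<noteq> c\<close> by auto
    ultimately show "(e = 0 \<and> Suc t = 0) \<or> (\<exists>t'\<ge>Suc t. t' < length ss * length ts \<and>
        e = pair_arc (n + length ss + length ts) n (length ss) (length ts) g t')"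
      by (intro disjI2 exI[of _ t']) auto
  next
    fix t' e assume *: "t' < Suc t" "e < m"
    have "0 \<le> F (e + 2)" "F (e + 2) \<in> Z"
      using unwind_okD(1,3)[OF U] by auto
    then show "0 \<le> out' (t' * m + e)" "out' (t' * m + e) \<in> Z"
      using * out(1) old O unfolding final_ok_def by (cases "t' = t"; auto)+
  next
    fix t' assume "t' < Suc t"
    show "\<exists>val\<ge>0. \<forall>v<n. (\<Sum>e<m. out' (t' * m + e) * inc (src g) (dst g) (e + 2) v) =
      val * (of_bool (v = ss ! (t' div length ts)) - of_bool (v = ts ! (t' mod length ts)))"
    proof (cases "t' = t")
      case True
      then show ?thesis using val div by blast
    next
      case False
      then have "t' < t" using \<open>t' < Suc t\<close> by simp
      then have "(\<Sum>e<m. out' (t' * m + e) * inc (src g) (dst g) (e + 2) v) =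
          (\<Sum>e<m. out (t' * m + e) * inc (src g) (dst g) (e + 2) v)" for v
        using old by (intro sum.cong) auto
      then show ?thesis
        using O \<open>t' < t\<close> unfolding final_ok_def by simp
    qed
  qed
qed

lemma runs_final:
  fixes \<sigma> :: store and n m :: nat and ss ts :: "nat list"
  defines "g \<equiv> graph_of \<sigma>" and "ls \<equiv> length ss" and "lt \<equiv> length ts"
  defines "N \<equiv> n + ls + lt" and "E2 \<equiv> m + 2 + ls + lt"
  assumes P: "pieces_ok E2 (nx g) (src g) (dst g) (np g) (pa g) (pb g) (pc g)"
    and Z: "add_closed Z"
    and O: "final_ok Z n ss ts m f g 0 (rstore \<sigma> 1) (rstore \<sigma> 2) (rstore \<sigma> 3)"
    and S: "slots_ok n m ss ts (src g) (dst g)"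
    and F: "rstore \<sigma> 4 = (\<lambda>_. 0)"
    and par: "istore \<sigma> 0 0 = n" "istore \<sigma> 0 1 = m" "istore \<sigma> 0 2 = ls" "istore \<sigma> 0 3 = lt"
      "reg \<sigma> rE2 = E2" "rows_ok N \<sigma>" "0 < lt"
    and mat: "\<And>u w. u < N \<Longrightarrow> w < N \<Longrightarrow> mat g (u * N + w) \<noteq> 0 \<Longrightarrow>
      E2 \<le> mat g (u * N + w) \<and> mat g (u * N + w) < nx g \<and>
      src g (mat g (u * N + w)) = u \<and> dst g (mat g (u * N + w)) = w"
  shows "runs final_code \<sigma> (real (ls * lt) * (200 * (real (np g) + real E2)) + 30) (\<lambda>\<tau>.
    \<exists>V X. final_ok Z n ss ts m f g (ls * lt) (rstore \<tau> 1) V X)"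
proof -
  define J where "J t \<tau> \<longleftrightarrow> final_frame \<sigma> \<tau> \<and> reg \<tau> ri = t div lt \<and> reg \<tau> rj = t mod lt \<and>
    reg \<tau> ro = t * m \<and> (\<forall>c. rstore \<tau> 4 c \<in> Z) \<and> (\<forall>c. c \<noteq> 1 \<longrightarrow> rstore \<tau> 4 c = 0) \<and>
    final_ok Z n ss ts m f g t (rstore \<tau> 1) (rstore \<tau> 2) (rstore \<tau> 3)" for t \<tau>
  note PE = pieces_okD(1,2)[OF P]
  have step: "runs pass_code \<tau> (180 * (real (np g) + real E2)) (J (Suc t))"
    if J: "J t \<tau>" "t < ls * lt" for t \<tau>
  proof -
    obtain b where b: "accounts_ok Z b (rstore \<tau> 2) (np g) (pa g) (pb g) (pc g) (rstore \<tau> 3)"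
      "\<And>c. c = 0 \<or> E2 \<le> c \<Longrightarrow> b c = 0"
      "\<forall>e<m. b (e + 2) + (\<Sum>t'<t. rstore \<tau> 1 (t' * m + e)) = f e"
      using J(1) unfolding J_def final_ok_def E2_def ls_def lt_def by blast
    define c where "c = pair_arc N n ls lt g t"
    define V where "V = rstore \<tau> 2"
    define V' where "V' = V(c := 0, 0 := 0)"
    have ij: "t div lt < ls" "t mod lt < lt"
      using J(2) par(7) by (auto simp: less_mult_imp_div_less)
    have c: "c = 0 \<or> E2 \<le> c \<and> c < nx g \<and> src g c = n + t div lt \<and> dst g c = n + ls + t mod lt"
      using mat[of "n + t div lt" "n + ls + t mod lt"] ij by (auto simp: c_def pair_arc_def N_def)
    then have c1: "c \<noteq> 1" "c < nx g"
      using PE by auto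
    have fr: "final_frame \<sigma> \<tau>"
      using J(1) by (simp add: J_def)
    have regs: "reg \<tau> rnp = np g" "reg \<tau> rE2 = E2" "istore \<tau> 11 = pa g" "istore \<tau> 12 = pb g"
      "istore \<tau> 13 = pc g" "istore \<tau> 10 = mat g" "istore \<tau> 0 = istore \<sigma> 0" "istore \<tau> 6 = istore \<sigma> 6"
      using fr par(5) by (auto simp: final_frame_def g_def graph_of_def)
    define \<tau>1 where "\<tau>1 = sem start_pass \<tau>"
    have row: "istore \<sigma> 6 (n + t div lt) = (n + t div lt) * N"
      using par(6) ij by (simp add: rows_ok_def N_def)
    have rC: "istore \<tau> 10 (istore \<tau> 6 (istore \<tau> 0 0 + reg \<tau> ri) + (istore \<tau> 0 0 + istore \<tau> 0 2 + reg \<tau> rj)) = c"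
      using J(1) row unfolding regs par by (simp add: J_def c_def pair_arc_def)
    have 1: "final_frame \<tau> \<tau>1" "reg \<tau>1 ri = reg \<tau> ri" "reg \<tau>1 rj = reg \<tau> rj" "reg \<tau>1 ro = reg \<tau> ro"
      "rstore \<tau>1 1 = rstore \<tau> 1" "rstore \<tau>1 3 = rstore \<tau> 3" "reg \<tau>1 rq = np g"
      using regs(1) by (auto simp: \<tau>1_def start_pass_def final_frame_def)
    have V1: "rstore \<tau>1 2 = V'"
      "rstore \<tau>1 4 = (let F = (rstore \<tau> 4)(c := rstore \<tau> 4 c + V c) in F(0 := F 0 + (V(c := 0)) 0))"
      using rC by (auto simp: \<tau>1_def start_pass_def V'_def V_def Let_def)
    have arr1: "istore \<tau>1 11 = pa g" "istore \<tau>1 12 = pb g" "istore \<tau>1 13 = pc g"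
      "reg \<tau>1 rE2 = E2"
      using 1(1) regs by (auto simp: final_frame_def)
    have U: "unwind_ok Z E2 (nx g) (src g) (dst g) (np g) (pa g) (pb g) (pc g) b V'
        (\<lambda>v. V c * inc (src g) (dst g) c v) (np g) (rstore \<tau>1 4) (rstore \<tau>1 3)"
      unfolding V1 1(6) V'_def Let_def
      by (rule unwind_start[OF P Z b(1)[folded V_def] b(2) _ _ c1]) (use J(1) in \<open>auto simp: J_def\<close>)
    define Q2 where "Q2 \<rho> \<longleftrightarrow> final_keep \<tau>1 \<rho> \<and> rstore \<rho> 1 = rstore \<tau>1 1 \<and>
      unwind_ok Z E2 (nx g) (src g) (dst g) (np g) (pa g) (pb g) (pc g) b V'
        (\<lambda>v. V c * inc (src g) (dst g) c v) 0 (rstore \<rho> 4) (rstore \<rho> 3)" for \<rho>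
    define Q3 where "Q3 \<rho> \<longleftrightarrow> Q2 \<rho> \<and> reg \<rho> re = 0" for \<rho>
    define Q4 where "Q4 \<rho> \<longleftrightarrow> final_keep \<tau>1 \<rho> \<and>
      final_ok Z n ss ts m f g (Suc t) (rstore \<rho> 1) V' (rstore \<rho> 3) \<and>
      (\<forall>c. rstore \<rho> 4 c \<in> Z) \<and> (\<forall>c. c \<noteq> 1 \<longrightarrow> rstore \<rho> 4 c = 0)" for \<rho>
    have r1: "runs start_pass \<tau> 60 (\<lambda>\<rho>. \<rho> = \<tau>1)"
      by (rule runs_loop_free) (auto simp: \<tau>1_def start_pass_def)
    have r2: "runs (While (ILess (INum 0) (Reg rq)) unwind_body) \<tau>1 (100 * (real (np g) + 1)) Q2"
      using runs_unwind[of E2 "nx g" "src g" "dst g" \<tau>1 Z b V'] P Z U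
      unfolding arr1 1(7) Q2_def by blast
    have r3: "runs (SetReg re (INum 0)) \<rho> 5 Q3" if "Q2 \<rho>" for \<rho>
      by (rule runs_loop_free)
        (use that in \<open>auto simp: Q3_def Q2_def final_keep_def final_frame_def\<close>)
    have r4: "runs (While output_guard output_body) \<rho> (40 * (real E2 - 1)) Q4" if Q: "Q3 \<rho>" for \<rho>
    proof (rule runs_mono)
      have U2: "unwind_ok Z E2 (nx g) (src g) (dst g) (np g) (pa g) (pb g) (pc g) b V'
          (\<lambda>v. V c * inc (src g) (dst g) c v) 0 (rstore \<rho> 4) (rstore \<rho> 3)"
        and keep: "final_keep \<tau>1 \<rho>" and out1: "rstore \<rho> 1 = rstore \<tau> 1"
        using Q 1(5) by (auto simp: Q3_def Q2_def)
      have "reg \<rho> rE2 = (E2 - 2) + 2" "reg \<rho> re = 0" "reg \<rho> ro = t * m"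
        using Q keep arr1 PE J(1) 1(4) by (auto simp: Q3_def final_keep_def final_frame_def J_def)
      from runs_output[OF this(1,2), unfolded this(3)]
      show "runs (While output_guard output_body) \<rho> (40 * (real (E2 - 2) + 1)) (\<lambda>\<tau>.
        final_keep \<rho> \<tau> \<and> rstore \<tau> 3 = rstore \<rho> 3 \<and>
        (\<forall>e<E2 - 2. rstore \<tau> 1 (t * m + e) = rstore \<rho> 4 (e + 2)) \<and>
        (\<forall>a<t * m. rstore \<tau> 1 a = rstore \<rho> 1 a) \<and>
        (\<forall>c. rstore \<tau> 4 c = (if 2 \<le> c \<and> c < (E2 - 2) + 2 then 0 else rstore \<rho> 4 c)))"
        (is "runs _ _ _ ?P") .
      fix \<tau>' assume *: "?P \<tau>'"
      have out: "\<forall>e<m. rstore \<tau>' 1 (t * m + e) = rstore \<rho> 4 (e + 2)"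
        "\<forall>a<t * m. rstore \<tau>' 1 a = rstore \<tau> 1 a"
        using * out1 by (auto simp: E2_def)
      have Ot: "final_ok Z n ss ts m f g t (rstore \<tau> 1) V (rstore \<tau> 3)"
        using J(1) by (simp add: J_def V_def)
      have c': "c = pair_arc (n + length ss + length ts) n (length ss) (length ts) g t"
        "c = 0 \<or> E2 \<le> c \<and> src g c = n + t div length ts \<and> dst g c = n + length ss + t mod length ts"
        using c by (auto simp: c_def N_def ls_def lt_def)
      have b2: "\<forall>c. c = 0 \<or> E2 \<le> c \<longrightarrow> b c = 0"
        using b(2) by blast
      note fin = final_ok_step[OF P _ b(1)[folded V_def] b2 b(3) Ot S _ c' Z V'_def U2 out]
      have E2': "E2 = m + 2 + length ss + length ts" "t < length ss * length ts"
        using J(2) by (auto simp: E2_def ls_def lt_def)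
      have "final_ok Z n ss ts m f g (Suc t) (rstore \<tau>' 1) V' (rstore \<rho> 3)"
        by (rule fin(1)[OF E2'])
      moreover have "rstore \<tau>' 4 e = 0" if "e \<noteq> 1" for e
        using * fin(2)[OF E2' that] PE by auto
      moreover have "rstore \<tau>' 4 e \<in> Z" for e
        using * unwind_okD(1)[OF U2] add_closedD(1)[OF Z] by auto
      ultimately show "Q4 \<tau>'"
        using * final_keep_trans[OF keep] by (simp add: Q4_def)
    qed (use PE in \<open>simp add: of_nat_diff\<close>)
    have r5: "runs next_pair \<rho> 40 (J (Suc t))" if Q: "Q4 \<rho>" for \<rho>
    proof (rule runs_loop_free)
      have k: "final_frame \<tau> \<rho>" "reg \<rho> ri = t div lt" "reg \<rho> rj = t mod lt" "reg \<rho> ro = t * m"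
        "rstore \<rho> 2 = V'"
        using Q J(1) 1 V1(1) final_frame_trans[OF 1(1)]
        by (auto simp: Q4_def final_keep_def J_def)
      then have fr2: "final_frame \<sigma> \<rho>"
        using fr final_frame_trans by blast
      then have par': "istore \<rho> 0 1 = m" "istore \<rho> 0 3 = lt"
        using par by (auto simp: final_frame_def)
      have "final_frame \<rho> (sem next_pair \<rho>)"
        "rstore (sem next_pair \<rho>) = rstore \<rho>" "reg (sem next_pair \<rho>) ro = Suc t * m"
        using k par' by (auto simp: next_pair_def final_frame_def)
      moreover have "reg (sem next_pair \<rho>) ri = Suc t div lt" "reg (sem next_pair \<rho>) rj = Suc t mod lt"
        using k par' ij(2) by (auto simp: next_pair_def div_Suc mod_Suc)
      ultimately show "J (Suc t) (sem next_pair \<rho>)"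
        using Q k fr2 final_frame_trans by (auto simp: J_def Q4_def)
    qed (auto simp: next_pair_def)
    have "runs pass_code \<tau> (60 + (100 * (real (np g) + 1) + (5 + (40 * (real E2 - 1) + 40)))) (J (Suc t))"
      unfolding pass_code_def
      by (rule runs_Seq[OF r1], erule ssubst, rule runs_Seq[OF r2], rule runs_Seq[OF r3], assumption,
          rule runs_Seq[OF r4], assumption, rule r5)
    then show ?thesis
      by (rule runs_mono) (use PE in auto)
  qed
  define gd where "gd = ILess (Reg ri) (IRead 0 (INum 2))"
  have "runs final_code \<sigma> (15 + (real (ls * lt) * (180 * (real (np g) + real E2) + real (bcost gd) + 1) +
      real (bcost gd) + 1)) (J (ls * lt))"
    unfolding final_code_def gd_def[symmetric]
  proof (rule runs_Seq)
    show "runs (SetReg ri (INum 0) ;; SetReg rj (INum 0) ;; SetReg ro (INum 0)) \<sigma> 15 (J 0)"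
      by (rule runs_loop_free) (use O F add_closedD(1)[OF Z] in \<open>auto simp: J_def final_frame_def\<close>)
    show "runs (While gd pass_code) \<rho> (real (ls * lt) * (180 * (real (np g) + real E2) + real (bcost gd) + 1) +
      real (bcost gd) + 1) (J (ls * lt))" if "J 0 \<rho>" for \<rho>
      using that
    proof (rule runs_While_count)
      show "runs pass_code \<tau> (180 * (real (np g) + real E2)) (J (Suc t))"
        if "J t \<tau>" "t < ls * lt" for t \<tau>
        by (rule step[OF that])
      show "bval gd \<tau> \<longleftrightarrow> t < ls * lt" if "J t \<tau>" for t \<tau>
      proof -
        have "istore \<tau> 0 2 = ls" "reg \<tau> ri = t div lt"
          using that par(3) by (auto simp: J_def final_frame_def)
        then show ?thesis
          using par(7) by (simp add: gd_def div_less_iff_less_mult)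
      qed
    qed auto
  qed
  then show ?thesis
  proof (rule runs_mono)
    have "180 * (real (np g) + real E2) + real (bcost gd) + 1 \<le> 200 * (real (np g) + real E2)"
      using PE by (simp add: gd_def)
    then have "real (ls * lt) * (180 * (real (np g) + real E2) + real (bcost gd) + 1)
        \<le> real (ls * lt) * (200 * (real (np g) + real E2))"
      by (intro mult_left_mono) auto
    then show "15 + (real (ls * lt) * (180 * (real (np g) + real E2) + real (bcost gd) + 1) +
      real (bcost gd) + 1) \<le> real (ls * lt) * (200 * (real (np g) + real E2)) + 30"
      by (simp add: gd_def)
  qed (auto simp: J_def)
qed

section \<open>Building the extended network and making it simple\<close>

section \<open>The initialisation program\<close>

definition setup_code :: com where
  "setup_code =
    SetReg rN (IAdd (IAdd (IRead 0 (INum 0)) (IRead 0 (INum 2))) (IRead 0 (INum 3))) ;;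
    SetReg rnl (IRead 0 (INum 0)) ;;
    SetReg rE2 (IAdd (IAdd (IAdd (IRead 0 (INum 1)) (INum 2)) (IRead 0 (INum 2))) (IRead 0 (INum 3))) ;;
    SetReg rnx (Reg rE2) ;;
    SetReg ri (INum 0) ;; SetReg racc (INum 0)"

definition rows_body :: com where
  "rows_body =
    IWrite 6 (Reg ri) (Reg racc) ;; SetReg racc (IAdd (Reg racc) (Reg rN)) ;;
    IWrite 7 (Reg ri) (Reg ri) ;; incr ri"

definition arcs_body :: com where
  "arcs_body =
    IWrite 8 (IAdd (Reg ri) (INum 2)) (IRead 1 (Reg ri)) ;;
    IWrite 9 (IAdd (Reg ri) (INum 2)) (IRead 2 (Reg ri)) ;;
    RWrite 2 (IAdd (Reg ri) (INum 2)) (RRead 0 (Reg ri)) ;;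
    RWrite 5 (IRead 1 (Reg ri)) (RAdd (RRead 5 (IRead 1 (Reg ri))) (RRead 0 (Reg ri))) ;;
    RWrite 5 (IRead 2 (Reg ri)) (RSub (RRead 5 (IRead 2 (Reg ri))) (RRead 0 (Reg ri))) ;;
    incr ri"

definition sources_body :: com where
  "sources_body =
    (let c = IAdd (IAdd (IRead 0 (INum 1)) (INum 2)) (Reg ri) in
    IWrite 8 c (IAdd (IRead 0 (INum 0)) (Reg ri)) ;;
    IWrite 9 c (IRead 3 (Reg ri)) ;;
    RWrite 2 c (RRead 5 (IRead 3 (Reg ri))) ;;
    incr ri)"

definition sinks_body :: com where
  "sinks_body =
    (let c = IAdd (IAdd (IAdd (IRead 0 (INum 1)) (INum 2)) (IRead 0 (INum 2))) (Reg ri) in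
    IWrite 8 c (IRead 4 (Reg ri)) ;;
    IWrite 9 c (IAdd (IAdd (IRead 0 (INum 0)) (IRead 0 (INum 2))) (Reg ri)) ;;
    RWrite 2 c (RSub RZero (RRead 5 (IRead 4 (Reg ri)))) ;;
    incr ri)"

text \<open>With the dummy as second arc, a piece merely moves an arc: parallel arcs meet in one
  matrix entry and loops end in the pool. Arcs without flow are left out, because a created arc
  between surviving vertices has to carry flow.\<close>

definition slot_body :: com where
  "slot_body =
    Cond (RLess RZero (RRead 2 (Reg re)))
      ((SetReg rA (Reg re) ;; SetReg rB (INum 1) ;; SetReg rU (IRead 8 (Reg re)) ;;
        SetReg rW (IRead 9 (Reg re)) ;; RWrite 6 (INum 2) (RRead 2 (Reg re))) ;;
       insert_code)
      Skip ;;
    incr re"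

definition network_code :: com where
  "network_code =
    setup_code ;;
    While (ILess (Reg ri) (Reg rN)) rows_body ;;
    SetReg ri (INum 0) ;;
    While (ILess (Reg ri) (IRead 0 (INum 1))) arcs_body ;;
    SetReg ri (INum 0) ;;
    While (ILess (Reg ri) (IRead 0 (INum 2))) sources_body ;;
    SetReg ri (INum 0) ;;
    While (ILess (Reg ri) (IRead 0 (INum 3))) sinks_body ;;
    SetReg re (INum 2)"

definition init_code :: com where
  "init_code = network_code ;; While (ILess (Reg re) (Reg rE2)) slot_body"

text \<open>The given flow, extended by arcs that turn it into a circulation on the original vertices.\<close>

definition excess :: "nat \<Rightarrow> (nat \<Rightarrow> nat) \<Rightarrow> (nat \<Rightarrow> nat) \<Rightarrow> (nat \<Rightarrow> real) \<Rightarrow> nat \<Rightarrow> real" where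
  "excess m tp hp f v = (\<Sum>e<m. f e * (of_bool (tp e = v) - of_bool (hp e = v)))"

definition network_flow ::
  "nat \<Rightarrow> (nat \<Rightarrow> nat) \<Rightarrow> (nat \<Rightarrow> nat) \<Rightarrow> nat list \<Rightarrow> nat list \<Rightarrow> (nat \<Rightarrow> real) \<Rightarrow> nat \<Rightarrow> real" where
  "network_flow m tp hp ss ts f c =
    (if c < 2 then 0
     else if c < m + 2 then f (c - 2)
     else if c < m + 2 + length ss then excess m tp hp f (ss ! (c - (m + 2)))
     else if c < m + 2 + length ss + length ts then
       - excess m tp hp f (ts ! (c - (m + 2 + length ss)))
     else 0)"

definition network_arc ::
  "nat \<Rightarrow> nat \<Rightarrow> (nat \<Rightarrow> nat) \<Rightarrow> (nat \<Rightarrow> nat) \<Rightarrow> nat list \<Rightarrow> nat list \<Rightarrow> nat \<Rightarrow> nat \<times> nat" where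
  "network_arc n m tp hp ss ts c =
    (if c < 2 then (0, 0)
     else if c < m + 2 then (tp (c - 2), hp (c - 2))
     else if c < m + 2 + length ss then (n + (c - (m + 2)), ss ! (c - (m + 2)))
     else if c < m + 2 + length ss + length ts then
       (ts ! (c - (m + 2 + length ss)), n + (c - (m + 2)))
     else (0, 0))"

definition network_loaded ::
  "nat \<Rightarrow> nat \<Rightarrow> (nat \<Rightarrow> nat) \<Rightarrow> (nat \<Rightarrow> nat) \<Rightarrow> nat list \<Rightarrow> nat list \<Rightarrow> (nat \<Rightarrow> real) \<Rightarrow> store \<Rightarrow> bool" where
  "network_loaded n m tp hp ss ts f \<sigma> \<longleftrightarrow>
    istore \<sigma> 0 0 = n \<and> istore \<sigma> 0 1 = m \<and> istore \<sigma> 0 2 = length ss \<and> istore \<sigma> 0 3 = length ts \<and>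
    reg \<sigma> rN = n + length ss + length ts \<and> reg \<sigma> rnl = n \<and>
    reg \<sigma> rE2 = m + 2 + length ss + length ts \<and> reg \<sigma> rnx = m + 2 + length ss + length ts \<and>
    reg \<sigma> rnp = 0 \<and> reg \<sigma> rcnt = 0 \<and> istore \<sigma> 10 = (\<lambda>_. 0) \<and> reg \<sigma> re = 2 \<and>
    rows_ok (n + length ss + length ts) \<sigma> \<and> (\<forall>v<n. istore \<sigma> 7 v = v) \<and>
    (\<forall>c. (istore \<sigma> 8 c, istore \<sigma> 9 c) = network_arc n m tp hp ss ts c) \<and>
    rstore \<sigma> 2 = network_flow m tp hp ss ts f \<and>
    rstore \<sigma> 1 = (\<lambda>_. 0) \<and> rstore \<sigma> 3 = (\<lambda>_. 0) \<and> rstore \<sigma> 4 = (\<lambda>_. 0)"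

definition input_loaded ::
  "nat \<Rightarrow> nat \<Rightarrow> (nat \<Rightarrow> nat) \<Rightarrow> (nat \<Rightarrow> nat) \<Rightarrow> nat list \<Rightarrow> nat list \<Rightarrow> (nat \<Rightarrow> real) \<Rightarrow> store \<Rightarrow> bool" where
  "input_loaded n m tp hp ss ts f \<sigma> \<longleftrightarrow>
    istore \<sigma> 0 0 = n \<and> istore \<sigma> 0 1 = m \<and> istore \<sigma> 0 2 = length ss \<and> istore \<sigma> 0 3 = length ts \<and>
    (\<forall>e<m. istore \<sigma> 1 e = tp e \<and> istore \<sigma> 2 e = hp e \<and> rstore \<sigma> 0 e = f e) \<and>
    (\<forall>i<length ss. istore \<sigma> 3 i = ss ! i) \<and> (\<forall>j<length ts. istore \<sigma> 4 j = ts ! j)"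

definition setup_done :: "nat \<Rightarrow> nat \<Rightarrow> nat list \<Rightarrow> nat list \<Rightarrow> store \<Rightarrow> bool" where
  "setup_done n m ss ts \<sigma> \<longleftrightarrow>
    reg \<sigma> rN = n + length ss + length ts \<and> reg \<sigma> rnl = n \<and>
    reg \<sigma> rE2 = m + 2 + length ss + length ts \<and> reg \<sigma> rnx = m + 2 + length ss + length ts \<and>
    reg \<sigma> rnp = 0 \<and> reg \<sigma> rcnt = 0 \<and> istore \<sigma> 10 = (\<lambda>_. 0) \<and>
    rstore \<sigma> 1 = (\<lambda>_. 0) \<and> rstore \<sigma> 3 = (\<lambda>_. 0) \<and> rstore \<sigma> 4 = (\<lambda>_. 0)"

lemma runs_count_reg:
  assumes J: "J 0 \<sigma>" and step: "\<And>i \<tau>. J i \<tau> \<Longrightarrow> i < n \<Longrightarrow> J (Suc i) (sem P \<tau>)"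
    and P: "loop_free P" "max_cost P \<le> c"
    and guard: "\<And>i \<tau>. J i \<tau> \<Longrightarrow> reg \<tau> ri = i \<and> ival e \<tau> = n"
  shows "runs (While (ILess (Reg ri) e) P) \<sigma> (real n * (real c + real (icost e) + 4) + icost e + 4) (J n)"
proof -
  have "runs (While (ILess (Reg ri) e) P) \<sigma>
    (real n * (real c + real (bcost (ILess (Reg ri) e)) + 1) + real (bcost (ILess (Reg ri) e)) + 1) (J n)"
  proof (rule runs_While_count[of J, OF J])
    show "runs P \<tau> (real c) (J (Suc i))" if "J i \<tau>" "i < n" for i \<tau>
      using step[OF that] P by (intro runs_loop_free) auto
  qed (use guard in auto)
  then show ?thesis by (rule runs_mono) (auto simp: algebra_simps)
qed

lemma runs_network:
  assumes L: "input_loaded n m tp hp ss ts f \<sigma>"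
    and zero: "\<And>k. 5 \<le> k \<Longrightarrow> istore \<sigma> k = (\<lambda>_. 0)" "\<And>k. 1 \<le> k \<Longrightarrow> rstore \<sigma> k = (\<lambda>_. 0)"
  shows "runs network_code \<sigma> (200 * (real n + real m + real (length ss) + real (length ts) + 1))
    (network_loaded n m tp hp ss ts f)"
proof -
  define ls where "ls = length ss"
  define lt where "lt = length ts"
  define N where "N = n + ls + lt"
  define arc where "arc = network_arc n m tp hp ss ts"
  define flow where "flow = network_flow m tp hp ss ts f"
  define base where "base \<tau> \<longleftrightarrow> input_loaded n m tp hp ss ts f \<tau> \<and> setup_done n m ss ts \<tau>" for \<tau>
  define rows where "rows i \<tau> \<longleftrightarrow> (\<forall>v<i. istore \<tau> 6 v = v * N \<and> istore \<tau> 7 v = v)" for i and \<tau> :: store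
  \<comment> \<open>The table of arcs is filled below \<open>c0\<close> and blank from there on; the
    last three loops raise \<open>c0\<close> from 2 to \<open>m + 2 + ls + lt\<close>.\<close>
  define slots where "slots c0 \<tau> \<longleftrightarrow>
    (\<forall>c. (istore \<tau> 8 c, istore \<tau> 9 c) = (if c < c0 then arc c else (0, 0)) \<and>
      rstore \<tau> 2 c = (if c < c0 then flow c else 0))" for c0 and \<tau> :: store
  define J1 where "J1 i \<tau> \<longleftrightarrow> base \<tau> \<and> reg \<tau> ri = i \<and> reg \<tau> racc = i * N \<and> rows i \<tau> \<and> slots 2 \<tau> \<and>
    rstore \<tau> 5 = (\<lambda>_. 0)" for i \<tau>
  define J2 where "J2 i \<tau> \<longleftrightarrow> base \<tau> \<and> reg \<tau> ri = i \<and> rows N \<tau> \<and> slots (i + 2) \<tau> \<and>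
    rstore \<tau> 5 = excess i tp hp f" for i \<tau>
  define J3 where "J3 i \<tau> \<longleftrightarrow> base \<tau> \<and> reg \<tau> ri = i \<and> rows N \<tau> \<and> slots (m + 2 + i) \<tau> \<and>
    rstore \<tau> 5 = excess m tp hp f" for i \<tau>
  define J4 where "J4 i \<tau> \<longleftrightarrow> base \<tau> \<and> reg \<tau> ri = i \<and> rows N \<tau> \<and> slots (m + 2 + ls + i) \<tau> \<and>
    rstore \<tau> 5 = excess m tp hp f" for i \<tau>
  have r0: "runs setup_code \<sigma> 60 (J1 0)"
  proof (rule runs_loop_free)
    show "J1 0 (sem setup_code \<sigma>)"
      using L zero by (auto simp: setup_code_def J1_def base_def input_loaded_def setup_done_def
        rows_def slots_def arc_def flow_def network_arc_def network_flow_def)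
  qed (auto simp: setup_code_def)
  have r1: "runs (While (ILess (Reg ri) (Reg rN)) rows_body) \<rho>
      (real N * (real 40 + real (icost (Reg rN)) + 4) + icost (Reg rN) + 4) (J1 N)" if "J1 0 \<rho>" for \<rho>
    using that
  proof (rule runs_count_reg)
    show "J1 (Suc i) (sem rows_body \<tau>)" if "J1 i \<tau>" "i < N" for i \<tau>
      using that by (auto simp: rows_body_def J1_def base_def input_loaded_def setup_done_def
        rows_def slots_def N_def ls_def lt_def less_Suc_eq)
    show "reg \<tau> ri = i \<and> ival (Reg rN) \<tau> = N" if "J1 i \<tau>" for i \<tau>
      using that by (auto simp: J1_def base_def setup_done_def N_def ls_def lt_def)
  qed (auto simp: rows_body_def)
  have s1: "runs (SetReg ri (INum 0)) \<rho> 4 (J2 0)" if "J1 N \<rho>" for \<rho>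
    by (rule runs_loop_free)
      (use that in \<open>auto simp: J1_def J2_def base_def input_loaded_def setup_done_def
        rows_def slots_def excess_def\<close>)
  have r2: "runs (While (ILess (Reg ri) (IRead 0 (INum 1))) arcs_body) \<rho>
      (real m * (real 90 + real (icost (IRead 0 (INum 1))) + 4) + icost (IRead 0 (INum 1)) + 4) (J2 m)"
    if "J2 0 \<rho>" for \<rho>
    using that
  proof (rule runs_count_reg)
    fix i \<tau> assume J: "J2 i \<tau>" and "i < m"
    then have in_i: "istore \<tau> 1 i = tp i" "istore \<tau> 2 i = hp i" "rstore \<tau> 0 i = f i" "reg \<tau> ri = i"
      by (auto simp: J2_def base_def input_loaded_def)
    have arc: "arc (i + 2) = (tp i, hp i)" "flow (i + 2) = f i"
      using \<open>i < m\<close> by (auto simp: arc_def network_arc_def flow_def network_flow_def)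
    define \<tau>' where "\<tau>' = sem arcs_body \<tau>"
    have new: "istore \<tau>' 8 = (istore \<tau> 8)(i + 2 := tp i)" "istore \<tau>' 9 = (istore \<tau> 9)(i + 2 := hp i)"
      "rstore \<tau>' 2 = (rstore \<tau> 2)(i + 2 := f i)" "reg \<tau>' ri = Suc i"
      "rstore \<tau>' 5 = (\<lambda>v. rstore \<tau> 5 v + f i * (of_bool (tp i = v) - of_bool (hp i = v)))"
      using in_i by (auto simp: \<tau>'_def arcs_body_def fun_eq_iff)
    have keep: "base \<tau>'" "rows N \<tau>'"
      using J by (auto simp: \<tau>'_def arcs_body_def J2_def base_def input_loaded_def setup_done_def rows_def)
    have "slots (Suc i + 2) \<tau>'"
      using J arc new by (auto simp: J2_def slots_def less_Suc_eq)
    moreover have "rstore \<tau>' 5 = excess (Suc i) tp hp f"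
      using J unfolding new by (simp add: J2_def excess_def fun_eq_iff)
    ultimately show "J2 (Suc i) (sem arcs_body \<tau>)"
      using keep new(4) by (simp add: J2_def \<tau>'_def)
  next
    show "reg \<tau> ri = i \<and> ival (IRead 0 (INum 1)) \<tau> = m" if "J2 i \<tau>" for i \<tau>
      using that by (auto simp: J2_def base_def input_loaded_def)
  qed (auto simp: arcs_body_def)
  have s2: "runs (SetReg ri (INum 0)) \<rho> 4 (J3 0)" if "J2 m \<rho>" for \<rho>
    by (rule runs_loop_free)
      (use that in \<open>auto simp: J2_def J3_def base_def input_loaded_def setup_done_def rows_def slots_def\<close>)
  have r3: "runs (While (ILess (Reg ri) (IRead 0 (INum 2))) sources_body) \<rho>
      (real ls * (real 90 + real (icost (IRead 0 (INum 2))) + 4) + icost (IRead 0 (INum 2)) + 4) (J3 ls)"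
    if "J3 0 \<rho>" for \<rho>
    using that
  proof (rule runs_count_reg)
    fix i \<tau> assume J: "J3 i \<tau>" and "i < ls"
    then have in_i: "istore \<tau> 3 i = ss ! i" "istore \<tau> 0 0 = n" "istore \<tau> 0 1 = m" "reg \<tau> ri = i"
      "rstore \<tau> 5 = excess m tp hp f"
      by (auto simp: J3_def base_def input_loaded_def ls_def)
    have arc: "arc (m + 2 + i) = (n + i, ss ! i)" "flow (m + 2 + i) = excess m tp hp f (ss ! i)"
      using \<open>i < ls\<close> by (auto simp: arc_def network_arc_def flow_def network_flow_def ls_def)
    define \<tau>' where "\<tau>' = sem sources_body \<tau>"
    have new: "istore \<tau>' 8 = (istore \<tau> 8)(m + 2 + i := n + i)"
      "istore \<tau>' 9 = (istore \<tau> 9)(m + 2 + i := ss ! i)"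
      "rstore \<tau>' 2 = (rstore \<tau> 2)(m + 2 + i := excess m tp hp f (ss ! i))" "reg \<tau>' ri = Suc i"
      "rstore \<tau>' 5 = excess m tp hp f"
      using in_i by (auto simp: \<tau>'_def sources_body_def Let_def)
    have keep: "base \<tau>'" "rows N \<tau>'"
      using J by (auto simp: \<tau>'_def sources_body_def Let_def J3_def base_def input_loaded_def
        setup_done_def rows_def)
    have "slots (m + 2 + Suc i) \<tau>'"
      using J arc new by (auto simp: J3_def slots_def less_Suc_eq)
    then show "J3 (Suc i) (sem sources_body \<tau>)"
      using keep new(4,5) by (simp add: J3_def \<tau>'_def)
  next
    show "reg \<tau> ri = i \<and> ival (IRead 0 (INum 2)) \<tau> = ls" if "J3 i \<tau>" for i \<tau>
      using that by (auto simp: J3_def base_def input_loaded_def ls_def)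
  qed (auto simp: sources_body_def Let_def)
  have s3: "runs (SetReg ri (INum 0)) \<rho> 4 (J4 0)" if "J3 ls \<rho>" for \<rho>
    by (rule runs_loop_free)
      (use that in \<open>auto simp: J3_def J4_def base_def input_loaded_def setup_done_def rows_def slots_def\<close>)
  have r4: "runs (While (ILess (Reg ri) (IRead 0 (INum 3))) sinks_body) \<rho>
      (real lt * (real 90 + real (icost (IRead 0 (INum 3))) + 4) + icost (IRead 0 (INum 3)) + 4) (J4 lt)"
    if "J4 0 \<rho>" for \<rho>
    using that
  proof (rule runs_count_reg)
    fix i \<tau> assume J: "J4 i \<tau>" and "i < lt"
    then have in_i: "istore \<tau> 4 i = ts ! i" "istore \<tau> 0 0 = n" "istore \<tau> 0 1 = m" "istore \<tau> 0 2 = ls"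
      "reg \<tau> ri = i" "rstore \<tau> 5 = excess m tp hp f"
      by (auto simp: J4_def base_def input_loaded_def ls_def lt_def)
    have arc: "arc (m + 2 + ls + i) = (ts ! i, n + ls + i)"
      "flow (m + 2 + ls + i) = - excess m tp hp f (ts ! i)"
      using \<open>i < lt\<close> by (auto simp: arc_def network_arc_def flow_def network_flow_def ls_def lt_def)
    define \<tau>' where "\<tau>' = sem sinks_body \<tau>"
    have new: "istore \<tau>' 8 = (istore \<tau> 8)(m + 2 + ls + i := ts ! i)"
      "istore \<tau>' 9 = (istore \<tau> 9)(m + 2 + ls + i := n + ls + i)"
      "rstore \<tau>' 2 = (rstore \<tau> 2)(m + 2 + ls + i := - excess m tp hp f (ts ! i))" "reg \<tau>' ri = Suc i"
      "rstore \<tau>' 5 = excess m tp hp f"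
      using in_i by (auto simp: \<tau>'_def sinks_body_def Let_def)
    have keep: "base \<tau>'" "rows N \<tau>'"
      using J by (auto simp: \<tau>'_def sinks_body_def Let_def J4_def base_def input_loaded_def
        setup_done_def rows_def)
    have "slots (m + 2 + ls + Suc i) \<tau>'"
      using J arc new by (auto simp: J4_def slots_def less_Suc_eq)
    then show "J4 (Suc i) (sem sinks_body \<tau>)"
      using keep new(4,5) by (simp add: J4_def \<tau>'_def)
  next
    show "reg \<tau> ri = i \<and> ival (IRead 0 (INum 3)) \<tau> = lt" if "J4 i \<tau>" for i \<tau>
      using that by (auto simp: J4_def base_def input_loaded_def lt_def)
  qed (auto simp: sinks_body_def Let_def)
  have s4: "runs (SetReg re (INum 2)) \<rho> 4 (network_loaded n m tp hp ss ts f)" if J: "J4 lt \<rho>" for \<rho>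
  proof (rule runs_loop_free)
    have a: "(istore \<rho> 8 c, istore \<rho> 9 c) = arc c \<and> rstore \<rho> 2 c = flow c" for c
    proof (cases "c < m + 2 + ls + lt")
      case True
      then show ?thesis using J by (auto simp: J4_def slots_def)
    next
      case False
      then have "arc c = (0, 0)" "flow c = 0"
        by (auto simp: arc_def network_arc_def flow_def network_flow_def ls_def lt_def)
      then show ?thesis using J False by (auto simp: J4_def slots_def)
    qed
    have b: "base \<rho>" "rows N \<rho>"
      using J by (auto simp: J4_def)
    show "network_loaded n m tp hp ss ts f (sem (SetReg re (INum 2)) \<rho>)"
      using a b unfolding network_loaded_def base_def input_loaded_def setup_done_def rows_def
        rows_ok_def arc_def flow_def N_def ls_def lt_def
      by (auto simp: fun_eq_iff)
  qed auto
  have "runs network_code \<sigma> (60 +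
      ((real N * (real 40 + real (icost (Reg rN)) + 4) + icost (Reg rN) + 4) + (4 +
      ((real m * (real 90 + real (icost (IRead 0 (INum 1))) + 4) + icost (IRead 0 (INum 1)) + 4) + (4 +
      ((real ls * (real 90 + real (icost (IRead 0 (INum 2))) + 4) + icost (IRead 0 (INum 2)) + 4) + (4 +
      ((real lt * (real 90 + real (icost (IRead 0 (INum 3))) + 4) + icost (IRead 0 (INum 3)) + 4) + 4))))))))
    (network_loaded n m tp hp ss ts f)"
    unfolding network_code_def
    by (rule runs_Seq[OF r0], rule runs_Seq[OF r1], assumption, rule runs_Seq[OF s1], assumption,
        rule runs_Seq[OF r2], assumption, rule runs_Seq[OF s2], assumption,
        rule runs_Seq[OF r3], assumption, rule runs_Seq[OF s3], assumption,
        rule runs_Seq[OF r4], assumption, rule s4)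
  then show ?thesis
    by (rule runs_mono) (auto simp: N_def ls_def lt_def)
qed

section \<open>A fixed input: its circulation and the move into the simple graph\<close>

definition slots_kept :: "store \<Rightarrow> store \<Rightarrow> bool" where
  "slots_kept \<sigma> \<tau> \<longleftrightarrow> (\<forall>k<8. k \<noteq> 5 \<longrightarrow> istore \<tau> k = istore \<sigma> k) \<and>
    reg \<tau> rnl = reg \<sigma> rnl \<and> reg \<tau> rE2 = reg \<sigma> rE2 \<and> rstore \<tau> 1 = rstore \<sigma> 1 \<and> rstore \<tau> 4 = rstore \<sigma> 4"

lemma slots_kept_trans: "slots_kept \<sigma> \<rho> \<Longrightarrow> slots_kept \<rho> \<tau> \<Longrightarrow> slots_kept \<sigma> \<tau>"
  by (simp add: slots_kept_def)

lemma frame_slots_kept: "frame \<sigma> \<tau> \<Longrightarrow> slots_kept \<sigma> \<tau>"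
  by (auto simp: frame_def slots_kept_def)

text \<open>The digraph is reduced to arrays of tails and heads; \<open>excess\<close> plays the
  part of the divergence, and \<open>Z\<close> is the set of admissible values.\<close>

locale network =
  fixes n m :: nat and tp hp :: "nat \<Rightarrow> nat" and ss ts :: "nat list" and f :: "nat \<Rightarrow> real"
    and Z :: "real set"
  assumes arcs: "e < m \<Longrightarrow> tp e < n" "e < m \<Longrightarrow> hp e < n"
    and terminals: "i < length ss \<Longrightarrow> ss ! i < n" "j < length ts \<Longrightarrow> ts ! j < n"
    and flow_nonneg: "e < m \<Longrightarrow> 0 \<le> f e" and flow_Z: "e < m \<Longrightarrow> f e \<in> Z"
    and sources: "i < length ss \<Longrightarrow> 0 \<le> excess m tp hp f (ss ! i)"
    and sinks: "j < length ts \<Longrightarrow> excess m tp hp f (ts ! j) \<le> 0"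
    and inner: "v < n \<Longrightarrow> v \<notin> set ss \<Longrightarrow> v \<notin> set ts \<Longrightarrow> excess m tp hp f v = 0"
    and distinct: "distinct ss" "distinct ts" "set ss \<inter> set ts = {}"
    and nonempty: "ss \<noteq> []" "ts \<noteq> []"
    and Z: "add_closed Z"
begin

definition "ls = length ss"
definition "lt = length ts"
definition "N = n + ls + lt"
definition "E = m + ls + lt"
definition "E2 = m + 2 + ls + lt"
definition "base = network_flow m tp hp ss ts f"
definition "sd = network_arc n m tp hp ss ts"

lemma base_zero: "\<forall>c\<ge>E2. base c = 0" "base 0 = 0" "base (Suc 0) = 0"
  by (auto simp: base_def network_flow_def E2_def ls_def lt_def)

lemma base_arc: "e < m \<Longrightarrow> base (e + 2) = f e"
  by (simp add: base_def network_flow_def)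

lemma base_source: "i < ls \<Longrightarrow> base (m + 2 + i) = excess m tp hp f (ss ! i)"
  by (auto simp: base_def network_flow_def ls_def)

lemma base_sink: "j < lt \<Longrightarrow> base (m + 2 + ls + j) = - excess m tp hp f (ts ! j)"
  by (auto simp: base_def network_flow_def ls_def lt_def)

lemma excess_Z: "excess m tp hp f v \<in> Z"
  unfolding excess_def using flow_Z Z
  by (intro add_closed_sum) (auto simp: add_closedD add_closedD(3)[OF Z add_closedD(1)[OF Z], simplified])

lemma minus_Z: "x \<in> Z \<Longrightarrow> - x \<in> Z"
  using add_closedD(3)[OF Z add_closedD(1)[OF Z], of x] by simp

lemma base_ok: "base c \<in> Z" "0 \<le> base c"
proof -
  have "c < 2 \<or> (\<exists>e<m. c = e + 2) \<or> (\<exists>i<ls. c = m + 2 + i) \<or> (\<exists>j<lt. c = m + 2 + ls + j) \<or> E2 \<le> c"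
    unfolding E2_def by presburger
  then have "base c \<in> Z \<and> 0 \<le> base c"
  proof (elim disjE exE conjE)
    fix e assume "e < m" "c = e + 2"
    then show "base c \<in> Z \<and> 0 \<le> base c"
      using base_arc flow_Z flow_nonneg by auto
  next
    fix i assume "i < ls" "c = m + 2 + i"
    then show "base c \<in> Z \<and> 0 \<le> base c"
      using base_source excess_Z sources by (auto simp: ls_def)
  next
    fix j assume "j < lt" "c = m + 2 + ls + j"
    then show "base c \<in> Z \<and> 0 \<le> base c"
      using base_sink minus_Z[OF excess_Z] sinks by (auto simp: lt_def)
  qed (use base_zero add_closedD(1)[OF Z] in \<open>auto simp: less_2_cases_iff\<close>)
  then show "base c \<in> Z" "0 \<le> base c" by auto
qed

lemma slots_ok_sd: "slots_ok n m ss ts (\<lambda>c. fst (sd c)) (\<lambda>c. snd (sd c))"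
  unfolding slots_ok_def using arcs terminals by (auto simp: sd_def network_arc_def)

lemma slots_ok_eq:
  assumes "\<And>c. c < E2 \<Longrightarrow> s c = fst (sd c) \<and> d c = snd (sd c)"
  shows "slots_ok n m ss ts s d"
  using slots_ok_sd assms unfolding slots_ok_def by (simp add: E2_def ls_def lt_def)

text \<open>A source receives its excess over its new arc, and a sink sends off what it absorbs over
  its own. As the lists of terminals are distinct and disjoint, every terminal is balanced exactly
  once.\<close>

lemma circulation:
  assumes sd: "\<And>c. c < E2 \<Longrightarrow> s c = fst (sd c) \<and> d c = snd (sd c)" and "v < n"
  shows "(\<Sum>c<E2. base c * inc s d c v) = 0"
proof -
  note S = slots_ok_eq[OF sd, unfolded slots_ok_def]
  have sources: "(\<Sum>i<ls. base (m + 2 + i) * inc s d (m + 2 + i) v) =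
      (if v \<in> set ss then - excess m tp hp f v else 0)"
  proof -
    have "(\<Sum>i<ls. base (m + 2 + i) * inc s d (m + 2 + i) v) =
        (\<Sum>i<ls. if ss ! i = v then - excess m tp hp f v else 0)"
    proof (rule sum.cong[OF refl])
      fix i assume "i \<in> {..<ls}"
      then have "i < ls" by simp
      then have "inc s d (m + 2 + i) v = - of_bool (ss ! i = v)"
        using S \<open>v < n\<close> by (auto simp: inc_def ls_def)
      then show "base (m + 2 + i) * inc s d (m + 2 + i) v = (if ss ! i = v then - excess m tp hp f v else 0)"
        unfolding base_source[OF \<open>i < ls\<close>] by auto
    qed
    also have "\<dots> = (\<Sum>u\<in>set ss. if u = v then - excess m tp hp f v else 0)"
      unfolding ls_def
      by (rule sum.reindex_bij_betw[OF bij_betw_nth[OF distinct(1)]]) auto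
    finally show ?thesis by simp
  qed
  have sinks: "(\<Sum>j<lt. base (m + 2 + ls + j) * inc s d (m + 2 + ls + j) v) =
      (if v \<in> set ts then - excess m tp hp f v else 0)"
  proof -
    have "(\<Sum>j<lt. base (m + 2 + ls + j) * inc s d (m + 2 + ls + j) v) =
        (\<Sum>j<lt. if ts ! j = v then - excess m tp hp f v else 0)"
    proof (rule sum.cong[OF refl])
      fix j assume "j \<in> {..<lt}"
      then have "j < lt" by simp
      then have "inc s d (m + 2 + ls + j) v = of_bool (ts ! j = v)"
        using S \<open>v < n\<close> by (auto simp: inc_def ls_def lt_def)
      then show "base (m + 2 + ls + j) * inc s d (m + 2 + ls + j) v =
          (if ts ! j = v then - excess m tp hp f v else 0)"
        unfolding base_sink[OF \<open>j < lt\<close>] by auto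
    qed
    also have "\<dots> = (\<Sum>u\<in>set ts. if u = v then - excess m tp hp f v else 0)"
      unfolding lt_def
      by (rule sum.reindex_bij_betw[OF bij_betw_nth[OF distinct(2)]]) auto
    finally show ?thesis by simp
  qed
  have "base (e + 2) * inc s d (e + 2) v = f e * (of_bool (tp e = v) - of_bool (hp e = v))"
    if "e < m" for e
    using that sd[of "e + 2"] unfolding base_arc[OF that]
    by (simp add: inc_def E2_def sd_def network_arc_def)
  then have "(\<Sum>e<m. base (e + 2) * inc s d (e + 2) v) = excess m tp hp f v"
    by (simp add: excess_def)
  moreover have "(\<Sum>c<E2. base c * inc s d c v) =
      (\<Sum>e<m. base (e + 2) * inc s d (e + 2) v) +
      (\<Sum>i<ls. base (m + 2 + i) * inc s d (m + 2 + i) v) +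
      (\<Sum>j<lt. base (m + 2 + ls + j) * inc s d (m + 2 + ls + j) v)"
    unfolding E2_def by (rule sum_slots) auto
  ultimately show ?thesis
    using sources sinks inner[OF \<open>v < n\<close>] distinct(3) by auto
qed

text \<open>\<open>R\<close> is empty, so nothing is claimed about adjacency lists; the first
  relinking builds them. As no vertex is dead yet, no created arc has been drawn on.\<close>

definition slots_done :: "nat \<Rightarrow> store \<Rightarrow> bool" where
  "slots_done i \<tau> \<longleftrightarrow> graph_ok Z N n ls E2 base {} {} {} (graph_of \<tau>) \<and>
    (\<forall>c<E2. src (graph_of \<tau>) c = fst (sd c) \<and> dst (graph_of \<tau>) c = snd (sd c)) \<and>
    (\<forall>c. 2 \<le> c \<and> c < i + 2 \<longrightarrow> vl (graph_of \<tau>) c = 0) \<and>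
    (\<forall>c. i + 2 \<le> c \<and> c < E2 \<longrightarrow> vl (graph_of \<tau>) c = base c) \<and>
    np (graph_of \<tau>) \<le> i \<and> cnt (graph_of \<tau>) \<le> i \<and> card (active E2 (graph_of \<tau>)) \<le> i"

lemma slots_start:
  assumes L: "network_loaded n m tp hp ss ts f \<sigma>"
  shows "slots_done 0 \<sigma>"
proof -
  let ?g = "graph_of \<sigma>"
  have g: "nx ?g = E2" "np ?g = 0" "cnt ?g = 0" "mat ?g = (\<lambda>_. 0)" "vl ?g = base" "px ?g = (\<lambda>_. 0)"
    "src ?g c = fst (sd c)" "dst ?g c = snd (sd c)" for c
    using L unfolding network_loaded_def E2_def ls_def lt_def base_def sd_def graph_of_def
    by (simp_all, metis fst_conv, metis snd_conv)
  have "pieces_ok E2 (nx ?g) (src ?g) (dst ?g) (np ?g) (pa ?g) (pb ?g) (pc ?g)"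
    by (simp add: pieces_ok_def g) (simp add: E2_def)
  moreover have "accounts_ok Z base (vl ?g) (np ?g) (pa ?g) (pb ?g) (pc ?g) (px ?g)"
    using base_ok add_closedD(1)[OF Z] by (simp add: accounts_ok_def g recv_def used_def)
  moreover have "links_ok {} ?g" "linked ?g = {}"
    by (simp_all add: links_ok_def linked_def lists_ok_def g)
  moreover have "arcs_ok N n ls E2 ?g"
  proof -
    have "fst (sd c) < N \<and> snd (sd c) < N \<and> fst (sd c) < n + ls \<and> (snd (sd c) < n \<or> n + ls \<le> snd (sd c))"
      if c: "2 \<le> c" "c < E2" for c
    proof -
      have "(\<exists>e<m. c = e + 2) \<or> (\<exists>i<ls. c = m + 2 + i) \<or> (\<exists>j<lt. c = m + 2 + ls + j)"
        using c unfolding E2_def by presburger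
      then show ?thesis
        using slots_ok_sd[unfolded slots_ok_def] unfolding N_def ls_def lt_def
        by (elim disjE exE conjE) (simp_all add: trans_less_add1)
    qed
    then show ?thesis
      using \<open>linked ?g = {}\<close> by (simp add: arcs_ok_def g)
  qed
  moreover have "live_ok E2 {} {} ?g" "used_dead E2 {} ?g" "active E2 ?g = {}"
    by (auto simp: live_ok_def used_dead_def active_def g)
  ultimately show ?thesis
    by (simp add: slots_done_def graph_ok_def g)
qed

lemma slots_step:
  assumes I: "slots_done i \<tau>" and "i < E" and re: "reg \<tau> re = i + 2" and rows: "rows_ok N \<tau>"
  defines "\<rho> \<equiv> sem slot_body \<tau>"
  shows "slots_done (Suc i) \<rho>" "slots_kept \<tau> \<rho>" "reg \<rho> re = Suc i + 2"
proof -
  define g where "g = graph_of \<tau>"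
  define a where "a = i + 2"
  have a: "2 \<le> a" "a < E2" "a < E + 2"
    using \<open>i < E\<close> by (auto simp: a_def E_def E2_def)
  have G: "graph_ok Z N n ls E2 base {} {} {} g"
    using I by (simp add: slots_done_def g_def)
  note G' = graph_okD[OF G]
  have nx: "E2 \<le> nx g" by (rule pieces_okD(2)[OF G'(1)])
  define \<tau>1 where "\<tau>1 = sem (SetReg rA (Reg re) ;; SetReg rB (INum 1) ;; SetReg rU (IRead 8 (Reg re)) ;;
    SetReg rW (IRead 9 (Reg re)) ;; RWrite 6 (INum 2) (RRead 2 (Reg re))) \<tau>"
  have 1: "frame \<tau> \<tau>1" "graph_of \<tau>1 = g" "reg \<tau>1 rA = a" "reg \<tau>1 rB = 1"
    "reg \<tau>1 rU = src g a" "reg \<tau>1 rW = dst g a" "xreg \<tau>1 = vl g a"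
    using re by (auto simp: \<tau>1_def frame_def g_def graph_of_def a_def)
  define \<tau>2 where "\<tau>2 = (if 0 < vl g a then sem insert_code \<tau>1 else \<tau>)"
  have body: "\<rho> = sem (incr re) \<tau>2"
    using re by (auto simp: \<rho>_def slot_body_def \<tau>2_def \<tau>1_def g_def graph_of_def a_def)
  have u: "src g a < N"
    using arcs_okD(1)[OF G'(4), of a] a nx by auto
  note ins = sem_insert[of N \<tau>1, unfolded 1, OF _ u]
  have rows1: "rows_ok N \<tau>1"
    using rows rows_ok_frame[OF 1(1)] by simp
  have fr: "frame \<tau> \<tau>2"
    using ins(2)[OF rows1] 1(1) frame_trans by (auto simp: \<tau>2_def)
  have done2: "slots_done (Suc i) \<tau>2"
  proof (cases "0 < vl g a")
    case False
    moreover have "vl g a = 0"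
      using False accounts_okD(3)[OF G'(2), of a] a by auto
    ultimately show ?thesis
      using I unfolding \<tau>2_def slots_done_def a_def g_def by (auto simp: less_Suc_eq)
  next
    case True
    let ?h = "insert_piece N a 1 (src g a) (dst g a) (vl g a) g"
    have h: "graph_of \<tau>2 = ?h"
      using True ins(1)[OF rows1] by (simp add: \<tau>2_def)
    have vZ: "vl g a \<in> Z"
      using accounts_okD(1)[OF G'(2)] .
    note P = insert_piece_ok[OF G Z base_zero(1) subset_refl a(1) _ refl _ _ _ _ vZ True order_refl,
        of 1 "dst g a"]
    have P1: "graph_ok Z N n ls E2 base {} {} {} ?h"
      and P2: "vl ?h a = vl g a - vl g a"
      and P4: "\<And>c. 2 \<le> c \<Longrightarrow> c \<noteq> a \<Longrightarrow> c < E2 \<Longrightarrow> vl ?h c = vl g c"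
      and P5: "card (active E2 ?h) \<le> Suc (card (active E2 g))"
      using P(1,2,5) P(4) a nx by auto
    note F = add_arc_frame[OF G'(4), where u = "src g a" and w = "dst g a"]
    have "vl ?h c = 0" if "2 \<le> c" "c < Suc i + 2" for c
      using that P2 P4[of c] I a by (cases "c = a") (auto simp: slots_done_def g_def a_def)
    moreover have "vl ?h c = base c" if "Suc i + 2 \<le> c" "c < E2" for c
      using that P4[of c] I by (auto simp: slots_done_def g_def a_def)
    moreover have "src ?h c = fst (sd c) \<and> dst ?h c = snd (sd c)" if "c < E2" for c
      using F(2)[of c] that nx I by (auto simp: insert_piece_simps slots_done_def g_def)
    moreover have "np ?h \<le> Suc i" "cnt ?h \<le> Suc i" "card (active E2 ?h) \<le> Suc i"
      using P5 F(5) I by (auto simp: insert_piece_simps slots_done_def g_def)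
    ultimately show ?thesis
      using P1 by (simp add: slots_done_def h)
  qed
  have "graph_of \<rho> = graph_of \<tau>2"
    by (simp add: body graph_of_def)
  then show "slots_done (Suc i) \<rho>"
    using done2 by (simp add: slots_done_def)
  have "slots_kept \<tau>2 \<rho>" by (simp add: body slots_kept_def)
  then show "slots_kept \<tau> \<rho>"
    using frame_slots_kept[OF fr] slots_kept_trans by blast
  show "reg \<rho> re = Suc i + 2"
    using frameD(2)[OF fr, of re] re by (simp add: body)
qed

lemma runs_slots:
  assumes L: "network_loaded n m tp hp ss ts f \<sigma>"
  shows "runs (While (ILess (Reg re) (Reg rE2)) slot_body) \<sigma> (300 * (real E + 1))
    (\<lambda>\<tau>. slots_done E \<tau> \<and> slots_kept \<sigma> \<tau>)"
proof -
  define J where "J i \<tau> \<longleftrightarrow> slots_done i \<tau> \<and> slots_kept \<sigma> \<tau> \<and> reg \<tau> re = i + 2" for i \<tau>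
  have rows: "rows_ok N \<sigma>" and r: "reg \<sigma> rE2 = E + 2" "reg \<sigma> re = 2"
    using L by (auto simp: network_loaded_def N_def E_def ls_def lt_def)
  define gd where "gd = ILess (Reg re) (Reg rE2)"
  have "runs (While gd slot_body) \<sigma>
    (real E * (250 + real (bcost gd) + 1) + real (bcost gd) + 1) (J E)"
  proof (rule runs_While_count)
    show "J 0 \<sigma>"
      using slots_start[OF L] r by (simp add: J_def slots_kept_def)
    show "bval gd \<tau> \<longleftrightarrow> i < E" if "J i \<tau>" for i \<tau>
      using that r by (auto simp: J_def gd_def slots_kept_def)
    show "runs slot_body \<tau> 250 (J (Suc i))" if J: "J i \<tau>" "i < E" for i \<tau>
    proof (rule runs_loop_free)
      show "loop_free slot_body"
        by (simp add: slot_body_def loop_free_insert)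
      show "real (max_cost slot_body) \<le> 250"
        by (simp add: slot_body_def insert_code_def link_code_def)
      have "rows_ok N \<tau>"
        using J(1) rows by (auto simp: J_def slots_kept_def rows_ok_def)
      then show "J (Suc i) (sem slot_body \<tau>)"
        using slots_step[of i \<tau>] J slots_kept_trans by (auto simp: J_def)
    qed
  qed simp
  then show ?thesis
    unfolding gd_def by (rule runs_mono) (auto simp: J_def)
qed

end

definition decompose_code :: com where
  "decompose_code = init_code ;; main_code ;; final_code"

lemma potential_mono: "c \<le> c' \<Longrightarrow> potential E k c l \<le> potential E k c' l"
  by (simp add: potential_def)

context network
begin

text \<open>Once all original vertices are eliminated, an arc with flow must lead from a new source
  to a new sink, and the matrix identifies it with its pair.\<close>

lemma final_start:
  assumes M: "main_ok Z N n ls E2 base sd R {} \<tau>"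
  shows "final_ok Z n ss ts m f (graph_of \<tau>) 0 out (rstore \<tau> 2) (rstore \<tau> 3)"
proof -
  define g where "g = graph_of \<tau>"
  have G: "graph_ok Z N n ls E2 base R {..<n} {..<n} g"
    and slots: "\<And>c. 2 \<le> c \<Longrightarrow> c < E2 \<Longrightarrow> vl g c = 0"
    using M by (auto simp: main_ok_def g_def)
  note G' = graph_okD[OF G]
  have V: "rstore \<tau> 2 = vl g" "rstore \<tau> 3 = px g"
    by (simp_all add: g_def graph_of_def)
  have pair: "(c = 0 \<and> (0::nat) = 0) \<or> (\<exists>t'. 0 \<le> t' \<and> t' < length ss * length ts \<and>
      c = pair_arc (n + length ss + length ts) n (length ss) (length ts) g t')"
    if c: "c \<noteq> 1" "vl g c \<noteq> 0" for c
  proof (cases "c = 0")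
    case False
    then have "2 \<le> c" using c(1) by simp
    then have "E2 \<le> c" using slots[of c] c(2) by (meson not_le)
    moreover have "c < nx g"
      using accounts_beyond[OF G'(1,2) base_zero(1), of c] c(2) by (meson not_le)
    ultimately have sd: "src g c \<notin> {..<n}" "dst g c \<notin> {..<n}"
      "mat g (src g c * N + dst g c) = c"
      using live_okD(3,4)[OF G'(5), of c] arcs_okD(2)[OF G'(4), of c] c(2) by blast+
    define i where "i = src g c - n"
    define j where "j = dst g c - (n + ls)"
    have i: "src g c = n + i" "i < ls" and j: "dst g c = n + ls + j" "j < lt"
      using sd arcs_okD(1)[OF G'(4) \<open>2 \<le> c\<close> \<open>c < nx g\<close>] by (auto simp: i_def j_def N_def)
    define t where "t = i * lt + j"
    have t: "t div lt = i" "t mod lt = j"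
      using j(2) by (auto simp: t_def)
    have "t < Suc i * lt" using j(2) by (simp add: t_def)
    also have "\<dots> \<le> ls * lt" using i(2) by (intro mult_le_mono1) simp
    finally have "t < ls * lt" .
    moreover have "pair_arc N n ls lt g t = c"
      using sd(3) by (simp add: pair_arc_def t i(1) j(1))
    ultimately show ?thesis
      unfolding N_def ls_def lt_def by (intro disjI2 exI[of _ t]) simp
  qed simp
  have "\<exists>b. accounts_ok Z b (vl g) (np g) (pa g) (pb g) (pc g) (px g) \<and>
      (\<forall>c. c = 0 \<or> m + 2 + length ss + length ts \<le> c \<longrightarrow> b c = 0) \<and>
      (\<forall>e<m. b (e + 2) + (\<Sum>t'<0. out (t' * m + e)) = f e)"
  proof (intro exI[of _ base] conjI allI impI)
    show "accounts_ok Z base (vl g) (np g) (pa g) (pb g) (pc g) (px g)" by (rule G'(2))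
    show "base c = 0" if "c = 0 \<or> m + 2 + length ss + length ts \<le> c" for c
      using that base_zero by (auto simp: E2_def ls_def lt_def)
  qed (use base_arc in simp)
  then show ?thesis
    unfolding final_ok_def V g_def[symmetric] using pair by simp
qed

definition "splits_flow out \<longleftrightarrow>
  (\<forall>e<m. (\<Sum>t<ls * lt. out (t * m + e)) = f e) \<and>
  (\<forall>t<ls * lt. (\<forall>e<m. 0 \<le> out (t * m + e) \<and> out (t * m + e) \<in> Z) \<and>
    (\<exists>val\<ge>0. \<forall>v<n. excess m tp hp (\<lambda>e. out (t * m + e)) v =
      val * (of_bool (v = ss ! (t div lt)) - of_bool (v = ts ! (t mod lt)))))"

text \<open>After the last pass no amount is left on any arc but the dummy, so
  \<open>accounts_exhausted\<close> applies and the extracted flows add up to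
  \<open>f\<close>.\<close>

lemma splits_flow_final:
  assumes M: "main_ok Z N n ls E2 base sd R {} \<tau>"
    and O: "final_ok Z n ss ts m f (graph_of \<tau>) (ls * lt) out V X"
  shows "splits_flow out"
proof -
  define g where "g = graph_of \<tau>"
  note O = O[unfolded final_ok_def, folded ls_def lt_def g_def]
  have P: "pieces_ok E2 (nx g) (src g) (dst g) (np g) (pa g) (pb g) (pc g)"
    and sd: "\<And>c. c < E2 \<Longrightarrow> src g c = fst (sd c) \<and> dst g c = snd (sd c)"
    using M by (auto simp: main_ok_def graph_ok_def g_def)
  obtain b where b: "accounts_ok Z b V (np g) (pa g) (pb g) (pc g) X"
    "\<forall>c. c = 0 \<or> m + 2 + ls + lt \<le> c \<longrightarrow> b c = 0"
    "\<forall>e<m. b (e + 2) + (\<Sum>t<ls * lt. out (t * m + e)) = f e"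
    using O by blast
  \<comment> \<open>There is at least one pass, hence the pool has been emptied as well.\<close>
  have "0 < ls * lt"
    using nonempty by (simp add: ls_def lt_def)
  then have V: "V c = 0" if "c \<noteq> 1" for c
    using O that by (metis less_numeral_extra(3) not_le)
  have "b (e + 2) = 0" for e
    by (rule accounts_exhausted[OF P b(1) _ V]) (use b(2) in \<open>auto simp: E2_def\<close>)
  then have sum: "(\<Sum>t<ls * lt. out (t * m + e)) = f e" if "e < m" for e
    using b(3) that by simp
  have inc: "inc (src g) (dst g) (e + 2) v = of_bool (tp e = v) - of_bool (hp e = v)" if "e < m" for e v
    using sd[of "e + 2"] that by (simp add: inc_def E2_def sd_def network_arc_def)
  have "(\<Sum>e<m. out (t * m + e) * inc (src g) (dst g) (e + 2) v) = excess m tp hp (\<lambda>e. out (t * m + e)) v"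
    for t v
    unfolding excess_def by (rule sum.cong[OF refl]) (simp only: inc lessThan_iff)
  then show ?thesis
    unfolding splits_flow_def using O sum by simp
qed

text \<open>There are at most \<open>E\<close> pieces from the initial moves and \<open>B\<close>
  from the rounds, and each of the \<open>ls * lt\<close> passes goes through all of them.\<close>

lemma runs_decompose:
  assumes L: "input_loaded n m tp hp ss ts f \<sigma>"
    and zero: "\<And>k. 5 \<le> k \<Longrightarrow> istore \<sigma> k = (\<lambda>_. 0)" "\<And>k. 1 \<le> k \<Longrightarrow> rstore \<sigma> k = (\<lambda>_. 0)"
  defines "B \<equiv> potential E (ls + lt) E n"
  shows "runs decompose_code \<sigma> (200 * (real n + real m + real ls + real lt + 1) + 300 * (real E + 1) +
      (B + 5 + (real (ls * lt) * (200 * (real E + B + real E2)) + 30)))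
    (\<lambda>\<tau>. splits_flow (rstore \<tau> 1))"
proof -
  define Q where "Q \<tau> \<longleftrightarrow> istore \<tau> 0 0 = n \<and> istore \<tau> 0 1 = m \<and> istore \<tau> 0 2 = ls \<and> istore \<tau> 0 3 = lt \<and>
    reg \<tau> rE2 = E2 \<and> rows_ok N \<tau> \<and> rstore \<tau> 4 = (\<lambda>_. 0)" for \<tau>
  define Q1 where "Q1 \<tau> \<longleftrightarrow> Q \<tau> \<and> slots_done E \<tau> \<and> reg \<tau> rnl = n \<and> (\<forall>v<n. istore \<tau> 7 v = v)" for \<tau>
  define Q2 where "Q2 \<tau> \<longleftrightarrow> Q \<tau> \<and> (\<exists>R. main_ok Z N n ls E2 base sd R {} \<tau>) \<and>
    real (np (graph_of \<tau>)) \<le> real E + B" for \<tau>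
  have r1: "runs init_code \<sigma> (200 * (real n + real m + real ls + real lt + 1) + 300 * (real E + 1)) Q1"
    unfolding init_code_def
  proof (rule runs_Seq)
    show "runs network_code \<sigma> (200 * (real n + real m + real ls + real lt + 1))
      (network_loaded n m tp hp ss ts f)"
      unfolding ls_def lt_def by (rule runs_network[OF L zero])
    fix \<rho> assume N: "network_loaded n m tp hp ss ts f \<rho>"
    show "runs (While (ILess (Reg re) (Reg rE2)) slot_body) \<rho> (300 * (real E + 1)) Q1"
      by (rule runs_mono[OF runs_slots[OF N] order_refl])
        (use N in \<open>auto simp: Q1_def Q_def slots_kept_def network_loaded_def rows_ok_def
          N_def E2_def ls_def lt_def\<close>)
  qed
  have r2: "runs main_code \<rho> (B + 5) Q2" if Q: "Q1 \<rho>" for \<rho>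
  proof -
    have im: "istore \<rho> 7 ` {..<reg \<rho> rnl} = {..<n}"
      using Q by (auto simp: Q1_def)
    have D: "slots_done E \<rho>" using Q by (simp add: Q1_def)
    have "main_ok Z N n ls E2 base sd {} (istore \<rho> 7 ` {..<reg \<rho> rnl}) \<rho>"
      unfolding im main_ok_def
    proof (intro conjI allI impI)
      show "graph_ok Z N n ls E2 base {} ({..<n} - {..<n}) ({..<n} - {..<n}) (graph_of \<rho>)"
        using D by (simp add: slots_done_def)
      show "vl (graph_of \<rho>) c = 0" if "2 \<le> c \<and> c < E2" for c
        using D that by (simp add: slots_done_def E_def E2_def)
      show sd: "src (graph_of \<rho>) c = fst (sd c)" "dst (graph_of \<rho>) c = snd (sd c)" if "c < E2" for c
        using D that by (simp_all add: slots_done_def)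
      show "(\<Sum>c<E2. base c * inc (src (graph_of \<rho>)) (dst (graph_of \<rho>)) c v) = 0" if "v < n" for v
        using that sd by (intro circulation) auto
    qed (use Q in \<open>simp add: Q1_def Q_def\<close>)
    then have "runs main_code \<rho> (potential E (N - n) (cnt (graph_of \<rho>)) (reg \<rho> rnl) + 5) (\<lambda>\<tau>.
      main_frame \<rho> \<tau> \<and> (\<exists>R. main_ok Z N n ls E2 base sd R {} \<tau>) \<and>
      real (np (graph_of \<tau>)) \<le> real (np (graph_of \<rho>)) + potential E (N - n) (cnt (graph_of \<rho>)) (reg \<rho> rnl))"
    proof (rule runs_main[OF _ Z base_zero(1)])
      show "inj_on (istore \<rho> 7) {..<reg \<rho> rnl}"
        using Q by (simp add: Q1_def inj_on_def)
      show "0 < E" using nonempty by (simp add: E_def ls_def)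
    qed (use im D in \<open>auto simp: slots_done_def\<close>)
    then show ?thesis
    proof (rule runs_mono)
      have le: "potential E (N - n) (cnt (graph_of \<rho>)) (reg \<rho> rnl) \<le> B"
        using Q D unfolding B_def by (simp add: N_def Q1_def slots_done_def potential_mono)
      then show "potential E (N - n) (cnt (graph_of \<rho>)) (reg \<rho> rnl) + 5 \<le> B + 5"
        by simp
      fix \<tau> assume *: "main_frame \<rho> \<tau> \<and> (\<exists>R. main_ok Z N n ls E2 base sd R {} \<tau>) \<and>
        real (np (graph_of \<tau>)) \<le> real (np (graph_of \<rho>)) + potential E (N - n) (cnt (graph_of \<rho>)) (reg \<rho> rnl)"
      have "real (np (graph_of \<rho>)) \<le> real E"
        using D by (simp add: slots_done_def)
      then have "real (np (graph_of \<tau>)) \<le> real E + B"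
        using * le by linarith
      then show "Q2 \<tau>"
        using * Q by (auto simp: Q2_def Q1_def Q_def main_frame_def rows_ok_def)
    qed
  qed
  have r3: "runs final_code \<rho> (real (ls * lt) * (200 * (real E + B + real E2)) + 30)
    (\<lambda>\<tau>. splits_flow (rstore \<tau> 1))" if Q: "Q2 \<rho>" for \<rho>
  proof -
    obtain R where M: "main_ok Z N n ls E2 base sd R {} \<rho>"
      using Q by (auto simp: Q2_def)
    have G: "graph_ok Z N n ls E2 base R {..<n} {..<n} (graph_of \<rho>)"
      using M by (simp add: main_ok_def)
    note G' = graph_okD[OF G]
    have "runs final_code \<rho> (real (ls * lt) * (200 * (real (np (graph_of \<rho>)) + real E2)) + 30) (\<lambda>\<tau>.
      \<exists>V X. final_ok Z n ss ts m f (graph_of \<rho>) (ls * lt) (rstore \<tau> 1) V X)"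
      unfolding ls_def lt_def E2_def
    proof (rule runs_final[OF _ Z])
      show "pieces_ok (m + 2 + length ss + length ts) (nx (graph_of \<rho>)) (src (graph_of \<rho>))
        (dst (graph_of \<rho>)) (np (graph_of \<rho>)) (pa (graph_of \<rho>)) (pb (graph_of \<rho>)) (pc (graph_of \<rho>))"
        using G'(1) by (simp add: E2_def ls_def lt_def)
      show "final_ok Z n ss ts m f (graph_of \<rho>) 0 (rstore \<rho> 1) (rstore \<rho> 2) (rstore \<rho> 3)"
        by (rule final_start[OF M])
      show "slots_ok n m ss ts (src (graph_of \<rho>)) (dst (graph_of \<rho>))"
        using M by (intro slots_ok_eq) (simp add: main_ok_def)
      fix u w assume "u < n + length ss + length ts" "w < n + length ss + length ts"
        "mat (graph_of \<rho>) (u * (n + length ss + length ts) + w) \<noteq> 0"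
      then show "m + 2 + length ss + length ts \<le> mat (graph_of \<rho>) (u * (n + length ss + length ts) + w) \<and>
        mat (graph_of \<rho>) (u * (n + length ss + length ts) + w) < nx (graph_of \<rho>) \<and>
        src (graph_of \<rho>) (mat (graph_of \<rho>) (u * (n + length ss + length ts) + w)) = u \<and>
        dst (graph_of \<rho>) (mat (graph_of \<rho>) (u * (n + length ss + length ts) + w)) = w"
        using G'(4) unfolding arcs_ok_def N_def E2_def ls_def lt_def by blast
    qed (use Q nonempty in \<open>auto simp: Q2_def Q_def N_def E2_def ls_def lt_def\<close>)
    then show ?thesis
    proof (rule runs_mono)
      show "real (ls * lt) * (200 * (real (np (graph_of \<rho>)) + real E2)) + 30
        \<le> real (ls * lt) * (200 * (real E + B + real E2)) + 30"
        using Q by (auto simp: Q2_def intro!: mult_left_mono)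
    qed (use splits_flow_final[OF M] in blast)
  qed
  show ?thesis
    unfolding decompose_code_def
    by (rule runs_Seq[OF r1], rule runs_Seq[OF r2], assumption, rule r3)
qed

end

section \<open>Back to digraphs, and the asymptotic bound\<close>

section \<open>Correctness and running time\<close>

lemma divergence_excess:
  assumes "arcs G = {..<m}"
  shows "divergence G h v = excess m (tail G) (head G) h v"
proof -
  have "(\<Sum>e\<in>out_arcs G v. h e) = (\<Sum>e<m. if tail G e = v then h e else 0)"
    unfolding out_arcs_def assms by (rule sum.inter_filter) simp
  moreover have "(\<Sum>e\<in>in_arcs G v. h e) = (\<Sum>e<m. if head G e = v then h e else 0)"
    unfolding in_arcs_def assms by (rule sum.inter_filter) simp
  ultimately show ?thesis
    unfolding divergence_def excess_def by (simp only: sum_subtractf[symmetric]) (rule sum.cong, auto)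
qed

lemma network_instance:
  assumes I: "decomposition_instance flow k G ss ts f"
    and flow: "\<And>S T f. flow G S T f \<longleftrightarrow> is_flow G S T f \<and> (\<forall>e\<in>arcs G. f e \<in> Z)"
    and Z: "add_closed Z"
  shows "network (card (verts G)) (card (arcs G)) (tail G) (head G) ss ts f Z"
proof -
  interpret fin_digraph G
    using I by (simp add: decomposition_instance_def)
  have V: "verts G = {..<card (verts G)}" and A: "arcs G = {..<card (arcs G)}"
    and F: "is_flow G (set ss) (set ts) f" "\<forall>e\<in>arcs G. f e \<in> Z"
    using I flow by (auto simp: decomposition_instance_def)
  have v: "x < card (verts G) \<longleftrightarrow> x \<in> verts G" for x
    using V by (metis lessThan_iff)
  have a: "x < card (arcs G) \<longleftrightarrow> x \<in> arcs G" for x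
    using A by (metis lessThan_iff)
  note D = divergence_excess[OF A, symmetric]
  show ?thesis
  proof
    show "ss \<noteq> []" "ts \<noteq> []" "distinct ss" "distinct ts" "set ss \<inter> set ts = {}"
      using I by (auto simp: decomposition_instance_def)
    show "ss ! i < card (verts G)" if "i < length ss" for i
      using I that v nth_mem[OF that] by (auto simp: decomposition_instance_def)
    show "ts ! i < card (verts G)" if "i < length ts" for i
      using I that v nth_mem[OF that] by (auto simp: decomposition_instance_def)
  qed (use F Z in \<open>auto simp: v a D is_flow_def\<close>)
qed

lemma input_loaded_input_store:
  "input_loaded (card (verts G)) (card (arcs G)) (tail G) (head G) ss ts f (input_store G ss ts f)"
  by (auto simp: input_loaded_def input_store_def zero_padded_def nth_Cons')

lemma sum_pairs:
  fixes h :: "nat \<Rightarrow> real"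
  shows "(\<Sum>i<a. \<Sum>j<b. h (i * b + j)) = (\<Sum>t<a * b. h t)"
proof (induction a)
  case (Suc a)
  have "(\<Sum>t<Suc a * b. h t) = (\<Sum>t<a * b + b. h t)"
    by (simp add: add.commute)
  then show ?case
    using Suc by (simp only: sum.lessThan_Suc sum_lessThan_add)
qed simp

lemma (in network) splits_flow_decomposition:
  assumes G: "arcs G = {..<m}" "verts G = {..<n}" "tail G = tp" "head G = hp"
    and flow: "\<And>S T f. flow G S T f \<longleftrightarrow> is_flow G S T f \<and> (\<forall>e\<in>arcs G. f e \<in> Z)"
    and S: "splits_flow out"
  shows "\<exists>F. (\<forall>i<ls. \<forall>j<lt. \<forall>e<m. F (ss ! i) (ts ! j) e = out ((i * lt + j) * m + e)) \<and>
    flow_decomposition flow G (set ss) (set ts) f F"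
proof -
  \<comment> \<open>The flows are indexed by vertices but the output blocks by positions; since the
    lists are distinct, a terminal determines its position.\<close>
  define ix where "ix xs x = (THE i. i < length xs \<and> xs ! i = x)" for xs :: "nat list" and x
  have ix: "ix xs (xs ! i) = i" if "distinct xs" "i < length xs" for xs i
    unfolding ix_def using that by (auto simp: nth_eq_iff_index_eq)
  define F where "F s t e = out ((ix ss s * lt + ix ts t) * m + e)" for s t e
  have F: "F (ss ! i) (ts ! j) e = out ((i * lt + j) * m + e)" if "i < ls" "j < lt" for i j e
    using that ix distinct by (simp add: F_def ls_def lt_def)
  have "f e = (\<Sum>s\<in>set ss. \<Sum>t\<in>set ts. F s t e)" if "e < m" for e
  proof -
    have ts: "(\<Sum>t\<in>set ts. h t) = (\<Sum>j<lt. h (ts ! j))" for h :: "nat \<Rightarrow> real"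
      unfolding lt_def by (rule sum.reindex_bij_betw[OF bij_betw_nth[OF distinct(2)], symmetric]) auto
    have "(\<Sum>s\<in>set ss. \<Sum>t\<in>set ts. F s t e) = (\<Sum>i<ls. \<Sum>t\<in>set ts. F (ss ! i) t e)"
      unfolding ls_def by (rule sum.reindex_bij_betw[OF bij_betw_nth[OF distinct(1)], symmetric]) auto
    also have "\<dots> = (\<Sum>i<ls. \<Sum>j<lt. out ((i * lt + j) * m + e))"
      unfolding ts by (simp add: F)
    also have "\<dots> = (\<Sum>t<ls * lt. out (t * m + e))"
      by (rule sum_pairs)
    finally show ?thesis
      using S that by (simp add: splits_flow_def)
  qed
  moreover have "flow G {s} {t} (F s t)" if st: "s \<in> set ss" "t \<in> set ts" for s t
  proof -
    obtain i j where i: "i < ls" "s = ss ! i" and j: "j < lt" "t = ts ! j"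
      using st by (auto simp: in_set_conv_nth ls_def lt_def)
    have "i * lt + j < Suc i * lt" using j by simp
    also have "\<dots> \<le> ls * lt" using i(1) by (intro mult_le_mono1) simp
    finally have p: "i * lt + j < ls * lt" .
    have Fst: "F s t = (\<lambda>e. out ((i * lt + j) * m + e))"
      using F[OF i(1) j(1)] i j by auto
    have q: "(i * lt + j) div lt = i" "(i * lt + j) mod lt = j"
      using j(1) by auto
    have ne: "s \<noteq> t" using st distinct(3) by auto
    obtain val where val: "0 \<le> val" "\<And>v. v < n \<Longrightarrow> excess m tp hp (F s t) v =
        val * (of_bool (v = s) - of_bool (v = t))"
      and e: "\<And>e. e < m \<Longrightarrow> 0 \<le> F s t e \<and> F s t e \<in> Z"
      using S p unfolding splits_flow_def Fst by (metis i(2) j(2) q)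
    have "s < n" "t < n"
      using terminals i j by (auto simp: ls_def lt_def)
    then have "is_flow G {s} {t} (F s t)"
      unfolding is_flow_def divergence_excess[OF G(1)] G(3,4)
      using val e ne G(1,2) by auto
    then show ?thesis
      using flow e G(1) by auto
  qed
  ultimately show ?thesis
    using F G(1) by (intro exI[of _ F]) (auto simp: flow_decomposition_def)
qed

lemma ln_le_log2: "1 \<le> x \<Longrightarrow> ln x \<le> log 2 x"
proof -
  assume "1 \<le> x"
  have "ln (2::real) \<le> 1"
    using ln_le_minus_one[of 2] by simp
  then have "ln x * ln 2 \<le> ln x"
    using \<open>1 \<le> x\<close> by (simp add: mult_left_le)
  then show ?thesis
    by (simp add: log_def pos_le_divide_eq)
qed

text \<open>Every term is absorbed by \<open>m * log 2 (2 + n\<^sup>2 / m)\<close>, which is at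
  least \<open>m\<close> and at least 1, at the price of factors that depend only on
  \<open>k\<close> and \<open>c\<close>.\<close>

lemma time_bound:
  fixes c :: real and k :: nat
  shows "\<exists>C. \<forall>n m p q :: nat. 0 < m \<and> real n \<le> c * real m \<and> p + q = k \<longrightarrow>
    (let E = m + p + q; B = potential E (p + q) E n in
      200 * (real n + real m + real p + real q + 1) + 300 * (real E + 1) +
      (B + 5 + (real (p * q) * (200 * (real E + B + real (m + 2 + p + q))) + 30)))
    \<le> C * (real m * log 2 (2 + (real n)\<^sup>2 / real m))"
proof -
  define K where "K = real k + 1"
  define C1 where "C1 = 5010 * K + 40080 * \<bar>c\<bar> + 250500 * (K * (2 * ln K + 1))"
  define C where "C = 200 * (\<bar>c\<bar> + K + 1) + 300 * (K + 1) +
    (C1 + 5 + (K\<^sup>2 * (200 * (K + C1 + (K + 2))) + 30))"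
  have K: "1 \<le> K" by (simp add: K_def)
  show ?thesis
  proof (intro exI[of _ C] allI impI)
    fix n m p q :: nat
    assume *: "0 < m \<and> real n \<le> c * real m \<and> p + q = k"
    define E where "E = m + p + q"
    define B where "B = potential E (p + q) E n"
    define l where "l = log 2 (2 + (real n)\<^sup>2 / real m)"
    define L where "L = real m * l"
    have m: "1 \<le> real m" using * by simp
    have l: "1 \<le> l"
    proof -
      have "0 \<le> (real n)\<^sup>2 / real m" by simp
      then have "log 2 2 \<le> l" unfolding l_def by (subst log_le_cancel_iff) linarith+
      then show ?thesis by simp
    qed
    have mL: "real m \<le> L"
      using l m by (simp add: L_def)
    have L1: "1 \<le> L" using mL m by linarith
    have kL: "real k * real m \<le> real k * L" "\<bar>c\<bar> * real m \<le> \<bar>c\<bar> * L" "K * real m \<le> K * L"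
      using mL K by (auto intro!: mult_left_mono)
    have nL: "real n \<le> \<bar>c\<bar> * L"
    proof -
      have "c * real m \<le> \<bar>c\<bar> * real m" using m by (intro mult_right_mono) auto
      then show ?thesis using * kL(2) by linarith
    qed
    have kk: "real p + real q = real k" using * by (metis of_nat_add)
    have km: "real k \<le> real k * real m" using m by (simp add: mult_le_cancel_left1)
    have Em: "real E \<le> K * real m"
      using kk km by (simp add: E_def K_def distrib_right)
    then have EL: "real E \<le> K * L" using kL(3) by linarith
    \<comment> \<open>\<open>1 + K\<^sup>2 * n\<^sup>2 / E \<le> K\<^sup>2 * (2 + n\<^sup>2 /
      m)\<close> turns the dependence on \<open>k\<close> into a summand \<open>2 * ln K\<close>,
      and \<open>1 \<le> l\<close> turns this summand into a factor.\<close>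
    have lnE: "ln (1 + (real (p + q) + 1)\<^sup>2 * (real n)\<^sup>2 / real E) \<le> (2 * ln K + 1) * l"
    proof -
      have pk: "real (p + q) + 1 = K" using * by (simp add: K_def)
      have "(real n)\<^sup>2 / real E \<le> (real n)\<^sup>2 / real m"
        using m by (intro divide_left_mono) (auto simp: E_def)
      then have "K\<^sup>2 * ((real n)\<^sup>2 / real E) \<le> K\<^sup>2 * ((real n)\<^sup>2 / real m)"
        by (intro mult_left_mono) auto
      moreover have "1 \<le> K\<^sup>2" using K by simp
      ultimately have "1 + K\<^sup>2 * (real n)\<^sup>2 / real E \<le> K\<^sup>2 * (2 + (real n)\<^sup>2 / real m)"
        by (simp add: distrib_left)
      then have "ln (1 + K\<^sup>2 * (real n)\<^sup>2 / real E) \<le> ln (K\<^sup>2 * (2 + (real n)\<^sup>2 / real m))"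
        using K m by (subst ln_le_cancel_iff) (auto intro!: add_pos_nonneg mult_pos_pos)
      also have "\<dots> = 2 * ln K + ln (2 + (real n)\<^sup>2 / real m)"
      proof -
        have "0 < 2 + (real n)\<^sup>2 / real m" by (simp add: add_pos_nonneg)
        then show ?thesis
          using K by (subst ln_mult) (auto simp: ln_realpow)
      qed
      also have "\<dots> \<le> 2 * ln K + l"
        unfolding l_def by (intro add_left_mono ln_le_log2) simp
      also have "\<dots> \<le> (2 * ln K + 1) * l"
      proof -
        have "2 * ln K * 1 \<le> 2 * ln K * l"
          using l K by (intro mult_left_mono) auto
        then show ?thesis by (simp add: distrib_right)
      qed
      finally show ?thesis unfolding pk .
    qed
    have "real E * ln (1 + (real (p + q) + 1)\<^sup>2 * (real n)\<^sup>2 / real E) \<le> (K * real m) * ((2 * ln K + 1) * l)"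
      using Em lnE K l by (intro mult_mono) auto
    also have "\<dots> = K * (2 * ln K + 1) * L"
      by (simp add: L_def)
    finally have BL: "B \<le> C1 * L"
      using EL nL unfolding B_def potential_def C1_def by (simp add: distrib_right)
    have pq: "real (p * q) \<le> K\<^sup>2"
    proof -
      have "real p * real q \<le> K * K"
        using kk by (intro mult_mono) (auto simp: K_def)
      then show ?thesis by (simp add: power2_eq_square)
    qed
    have "real E + B + real (m + 2 + p + q) \<le> (K + C1 + (K + 2)) * L"
      using EL BL L1 by (simp add: E_def distrib_right)
    then have 1: "real (p * q) * (200 * (real E + B + real (m + 2 + p + q))) \<le>
        K\<^sup>2 * (200 * ((K + C1 + (K + 2)) * L))"
      using pq potential_nonneg by (intro mult_mono) (auto simp: B_def)
    have 2: "real n + real m + real p + real q + 1 \<le> (\<bar>c\<bar> + K + 1) * L"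
      using nL EL L1 by (simp add: E_def distrib_right)
    have 3: "real E + 1 \<le> (K + 1) * L"
      using EL L1 by (simp add: distrib_right)
    have "200 * y + 300 * z + (b + 5 + (x + 30)) \<le>
        200 * y' + 300 * z' + (b' + 5 * L + (x' + 30 * L))"
      if "x \<le> x'" "y \<le> y'" "z \<le> z'" "b \<le> b'" for x x' y y' z z' b b' :: real
      using that L1 by linarith
    note this[OF 1 2 3 BL]
    also have "200 * ((\<bar>c\<bar> + K + 1) * L) + 300 * ((K + 1) * L) +
        (C1 * L + 5 * L + (K\<^sup>2 * (200 * ((K + C1 + (K + 2)) * L)) + 30 * L)) = C * L"
      unfolding C_def by (simp add: algebra_simps)
    finally have "200 * (real n + real m + real p + real q + 1) + 300 * (real E + 1) +
        (B + 5 + (real (p * q) * (200 * (real E + B + real (m + 2 + p + q))) + 30)) \<le> C * L" .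
    then show "(let E = m + p + q; B = potential E (p + q) E n in
        200 * (real n + real m + real p + real q + 1) + 300 * (real E + 1) +
        (B + 5 + (real (p * q) * (200 * (real E + B + real (m + 2 + p + q))) + 30)))
      \<le> C * (real m * log 2 (2 + (real n)\<^sup>2 / real m))"
      by (simp add: Let_def E_def B_def L_def l_def)
  qed
qed

text \<open>One program serves real and integer flows alike, because \<open>Z\<close> occurs only in
  the invariants. The code does not depend on \<open>k\<close> and \<open>c\<close> either; they
  only affect the constant \<open>C\<close>.\<close>

lemma decompose_code_correct:
  fixes c :: real
  assumes flow: "\<And>G S T f. flow G S T f \<longleftrightarrow> is_flow G S T f \<and> (\<forall>e\<in>arcs G. f e \<in> Z)"
    and Z: "add_closed Z"
  shows "\<exists>C. \<forall>G ss ts f. decomposition_instance flow k G ss ts f \<and>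
    real (card (verts G)) \<le> c * real (card (arcs G)) \<longrightarrow>
    decomposes_within flow decompose_code G ss ts f
      (C * (real (card (arcs G)) *
         log 2 (2 + (real (card (verts G)))\<^sup>2 / real (card (arcs G)))))"
proof -
  obtain C where C: "\<And>n m p q :: nat. 0 < m \<Longrightarrow> real n \<le> c * real m \<Longrightarrow> p + q = k \<Longrightarrow>
    (let E = m + p + q; B = potential E (p + q) E n in
      200 * (real n + real m + real p + real q + 1) + 300 * (real E + 1) +
      (B + 5 + (real (p * q) * (200 * (real E + B + real (m + 2 + p + q))) + 30)))
    \<le> C * (real m * log 2 (2 + (real n)\<^sup>2 / real m))"
    using time_bound[of c k] by blast
  show ?thesis
  proof (intro exI[of _ C] allI impI)
    fix G ss ts f
    assume *: "decomposition_instance flow k G ss ts f \<and>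
      real (card (verts G)) \<le> c * real (card (arcs G))"
    define n where "n = card (verts G)"
    define m where "m = card (arcs G)"
    have I: "decomposition_instance flow k G ss ts f" and nm: "real n \<le> c * real m"
      using * by (auto simp: n_def m_def)
    interpret network n m "tail G" "head G" ss ts f Z
      unfolding n_def m_def by (rule network_instance[OF I flow Z])
    have k: "ls + lt = k"
      using I distinct by (simp add: decomposition_instance_def ls_def lt_def distinct_card)
    have "0 < n"
      using terminals(1)[of 0] nonempty by auto
    \<comment> \<open>A digraph with vertices but without arcs violates the bound of
      \<open>|V|\<close> by \<open>c * |E|\<close>, so the division by \<open>|E|\<close> is
      meaningful.\<close>
    then have "0 < m"
      using nm by (cases m) auto
    let ?t = "200 * (real n + real m + real ls + real lt + 1) + 300 * (real E + 1) +
      (potential E (ls + lt) E n + 5 + (real (ls * lt) *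
        (200 * (real E + potential E (ls + lt) E n + real E2)) + 30))"
    have "runs decompose_code (input_store G ss ts f) ?t (\<lambda>\<tau>. splits_flow (rstore \<tau> 1))"
    proof (rule runs_decompose)
      show "input_loaded n m (tail G) (head G) ss ts f (input_store G ss ts f)"
        unfolding n_def m_def by (rule input_loaded_input_store)
    qed (auto simp: input_store_def)
    then obtain t \<tau> where run: "exec decompose_code (input_store G ss ts f) t \<tau>" "real t \<le> ?t"
      "splits_flow (rstore \<tau> 1)"
      by (auto simp: runs_def)
    have "?t \<le> C * (real m * log 2 (2 + (real n)\<^sup>2 / real m))"
      using C[OF \<open>0 < m\<close> nm k] by (simp add: Let_def E_def E2_def)
    then have time: "real t \<le> C * (real m * log 2 (2 + (real n)\<^sup>2 / real m))"
      using run(2) by linarith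
    have "arcs G = {..<m}" "verts G = {..<n}"
      using I by (auto simp: decomposition_instance_def n_def m_def)
    then obtain F where
      F: "\<forall>i<ls. \<forall>j<lt. \<forall>e<m. F (ss ! i) (ts ! j) e = rstore \<tau> 1 ((i * lt + j) * m + e)"
        "flow_decomposition flow G (set ss) (set ts) f F"
      using splits_flow_decomposition[of G flow "rstore \<tau> 1"] flow run(3) by blast
    have "output_represents G ss ts \<tau> F"
      unfolding output_represents_def using F(1) by (simp add: ls_def lt_def m_def)
    then show "decomposes_within flow decompose_code G ss ts f
      (C * (real (card (arcs G)) *
         log 2 (2 + (real (card (verts G)))\<^sup>2 / real (card (arcs G)))))"
      unfolding decomposes_within_def using run(1) time F(2) by (auto simp: n_def m_def)
  qed
qed

theorem theorem5p1:
  fixes k :: nat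
  assumes "k > 0"
  shows
    "(\<exists>P. \<forall>c::real. \<exists>C::real. \<forall>G ss ts f.
        decomposition_instance is_flow k G ss ts f \<and>
        real (card (verts G)) \<le> c * real (card (arcs G)) \<longrightarrow>
        decomposes_within is_flow P G ss ts f
          (C * (real (card (arcs G)) *
             log 2 (2 + (real (card (verts G)))\<^sup>2 / real (card (arcs G)))))) \<and>
     (\<exists>P. \<forall>c::real. \<exists>C::real. \<forall>G ss ts f.
        decomposition_instance is_integer_flow k G ss ts f \<and>
        real (card (verts G)) \<le> c * real (card (arcs G)) \<longrightarrow>
        decomposes_within is_integer_flow P G ss ts f
          (C * (real (card (arcs G)) *
             log 2 (2 + (real (card (verts G)))\<^sup>2 / real (card (arcs G))))))"
proof (intro conjI exI[of _ decompose_code] allI, goal_cases)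
  case 1
  show ?case
    by (rule decompose_code_correct[of _ UNIV]) (auto simp: add_closed_def)
next
  case 2
  show ?case
    by (rule decompose_code_correct[of _ "\<int>"]) (auto simp: add_closed_def is_integer_flow_def)
qed

end
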